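(* Let $\mathbb{K}$ be a field, $n\ge1$, let $\Gamma$ be a multiplicatively antisymmetric $n\times n$ matrix over $\mathbb{K}$, and let $Q=(q_1,\ldots,q_n)\in(\mathbb{K}^* )^n$ be such that no $q_i$ is a root of unity ($1\le i\le n$). If $M$ is a nonzero finitely generated (right) module over the graded quantum Weyl algebra $A_n^{Q,\Gamma}(\mathbb{K})$ that is not a $\mathscr{Z}$-torsion module, then $$\operatorname{GK-dim}(M)\ \ge\ n=\frac{\operatorname{GK-dim}(A_n^{Q,\Gamma}(\mathbb{K}))}{2}.$$
   Context: Definition of $K_n$: let $P=(p_1,\ldots,p_n)$ and $Q=(q_1,\ldots,q_n)$ be $n$-tuples of elements of $\mathbb{K}^*$ with $p_i\ne q_i$ for all $i$, and let $\Gamma=(\gamma_{ij})$ be a multiplicatively antisymmetric $n\times n$ matrix over $\mathbb{K}$ (that is, $\gamma_{ii}=1$ and $\gamma_{ij}\gamma_{ji}=1$ for all $i,j$). The algebra $K_n=K_{n,\Gamma}^{P,Q}(\mathbb{K})$ is the $\mathbb{K}$-algebra generated by $x_1,y_1,\ldots,x_n,y_n$ subject to the relations $x_ix_j=q_ip_j^{-1}\gamma_{ij}x_jx_i$ for $i<j$; $y_iy_j=\gamma_{ij}y_jy_i$ for $i<j$; $x_iy_j=p_j\gamma_{ij}^{-1}y_jx_i$ for $i<j$; $x_iy_j=q_j\gamma_{ij}^{-1}y_jx_i$ for $i>j$; $x_iy_i-q_iy_ix_i=\sum_{l=1}^{i-1}(q_l-p_l)y_lx_l$ for all $i$. The graded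 quantum Weyl algebra $A_n^{Q,\Gamma}(\mathbb{K})$ is the algebra $K_{n,\Gamma}^{P,Q}(\mathbb{K})$ with $p_i=1$ for all $1\le i\le n$. The elements $z_i:=\sum_{l\le i}(q_l-p_l)y_lx_l$ ($1\le i\le n$) are normal in $K_n$ and commute with each other, and $\mathscr{Z}:=\{z_1^{j_1}\cdots z_n^{j_n}: j_i\in\mathbb{Z}_{\ge 0}\}$ is an Ore set. A module $M$ is $\mathscr{Z}$-torsion if every $m\in M$ satisfies $ms=0$ for some $s\in\mathscr{Z}$. $\operatorname{GK-dim}$ denotes Gelfand--Kirillov dimension over $\mathbb{K}$. *)

theory Defs
  imports
    "HOL-Library.Poly_Mapping"
    "HOL-Analysis.Extended_Real_Limits"
    "HOL-Algebra.QuotRing"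
    "Jordan_Normal_Form.VS_Connect"
begin

section \<open>Algebras presented by generators and relations\<close>

text \<open>A \<open>'k\<close>-algebra is stored in HOL-Algebra's \<^typ>\<open>('k, 'a) module\<close> record, which extends the
  ring record by a scalar multiplication. The field \<open>'k\<close> enters as \<^term>\<open>class_ring\<close>.\<close>

text \<open>With concatenation, lists are the free monoid (written additively, as
  \<^typ>\<open>'a \<Rightarrow>\<^sub>0 'b\<close> requires), so \<open>'g list \<Rightarrow>\<^sub>0 'k\<close> with its convolution product is the free
  associative algebra on \<open>'g\<close>.\<close>

instantiation list :: (type) monoid_add
begin

definition zero_list :: "'a list" where "zero_list = []"

definition plus_list :: "'a list \<Rightarrow> 'a list \<Rightarrow> 'a list" where "plus_list = (@)"

instance by standard (simp_all add: zero_list_def plus_list_def)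

end

type_synonym ('g, 'k) free_algebra = "'g list \<Rightarrow>\<^sub>0 'k"

definition free_scalar :: "'k::field \<Rightarrow> ('g, 'k) free_algebra" where
  "free_scalar c = Poly_Mapping.single [] c"

definition free_gen :: "'g \<Rightarrow> ('g, 'k::field) free_algebra" where
  "free_gen g = Poly_Mapping.single [g] 1"

definition free_algebra_on :: "'g set \<Rightarrow> ('g, 'k::field) free_algebra ring" where
  "free_algebra_on G =
     class_ring\<lparr>carrier := {f. \<forall>w \<in> Poly_Mapping.keys f. set w \<subseteq> G}\<rparr>"

definition relation_ideal ::
    "'g set \<Rightarrow> ('g, 'k::field) free_algebra set \<Rightarrow> ('g, 'k) free_algebra set" where
  "relation_ideal G Rel = genideal (free_algebra_on G) Rel"

definition presented_class ::
    "'g set \<Rightarrow> ('g, 'k::field) free_algebra set \<Rightarrow> ('g, 'k) free_algebra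
      \<Rightarrow> ('g, 'k) free_algebra set" where
  "presented_class G Rel f = relation_ideal G Rel +>\<^bsub>free_algebra_on G\<^esub> f"

definition presented_algebra ::
    "'g set \<Rightarrow> ('g, 'k::field) free_algebra set \<Rightarrow> ('k, ('g, 'k) free_algebra set) module" where
  "presented_algebra G Rel =
     (let R = free_algebra_on G Quot relation_ideal G Rel in
      \<lparr>carrier = carrier R, mult = mult R, one = one R, zero = zero R, add = add R,
       smult = (\<lambda>c a. presented_class G Rel (free_scalar c) \<otimes>\<^bsub>R\<^esub> a)\<rparr>)"


section \<open>The algebras \<open>K\<^sub>n\<close> and the graded quantum Weyl algebras\<close>

text \<open>The tuples \<open>P\<close>, \<open>Q\<close> and the matrix \<open>\<Gamma>\<close> are functions of which only the values at indices in
  \<open>{1..n}\<close> matter.\<close>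

datatype weyl_gen = X_gen nat | Y_gen nat

definition weyl_gens :: "nat \<Rightarrow> weyl_gen set" where
  "weyl_gens n = X_gen ` {1..n} \<union> Y_gen ` {1..n}"

abbreviation xg :: "nat \<Rightarrow> (weyl_gen, 'k::field) free_algebra" where
  "xg i \<equiv> free_gen (X_gen i)"

abbreviation yg :: "nat \<Rightarrow> (weyl_gen, 'k::field) free_algebra" where
  "yg i \<equiv> free_gen (Y_gen i)"

definition mult_antisymmetric :: "nat \<Rightarrow> (nat \<Rightarrow> nat \<Rightarrow> 'k::field) \<Rightarrow> bool" where
  "mult_antisymmetric n \<gamma> \<longleftrightarrow>
     (\<forall>i\<in>{1..n}. \<gamma> i i = 1) \<and> (\<forall>i\<in>{1..n}. \<forall>j\<in>{1..n}. \<gamma> i j * \<gamma> j i = 1)"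

definition K_relators ::
    "nat \<Rightarrow> (nat \<Rightarrow> 'k::field) \<Rightarrow> (nat \<Rightarrow> 'k) \<Rightarrow> (nat \<Rightarrow> nat \<Rightarrow> 'k)
      \<Rightarrow> (weyl_gen, 'k) free_algebra set" where
  "K_relators n p q \<gamma> =
     {xg i * xg j - free_scalar (q i * inverse (p j) * \<gamma> i j) * xg j * xg i
        | i j. 1 \<le> i \<and> i < j \<and> j \<le> n}
   \<union> {yg i * yg j - free_scalar (\<gamma> i j) * yg j * yg i
        | i j. 1 \<le> i \<and> i < j \<and> j \<le> n}
   \<union> {xg i * yg j - free_scalar (p j * inverse (\<gamma> i j)) * yg j * xg i
        | i j. 1 \<le> i \<and> i < j \<and> j \<le> n}
   \<union> {xg i * yg j - free_scalar (q j * inverse (\<gamma> i j)) * yg j * xg i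
        | i j. 1 \<le> j \<and> j < i \<and> i \<le> n}
   \<union> {xg i * yg i - free_scalar (q i) * yg i * xg i
          - (\<Sum>l\<in>{1..<i}. free_scalar (q l - p l) * yg l * xg l)
        | i. 1 \<le> i \<and> i \<le> n}"

definition K_algebra ::
    "nat \<Rightarrow> (nat \<Rightarrow> 'k::field) \<Rightarrow> (nat \<Rightarrow> 'k) \<Rightarrow> (nat \<Rightarrow> nat \<Rightarrow> 'k)
      \<Rightarrow> ('k, (weyl_gen, 'k) free_algebra set) module" where
  "K_algebra n p q \<gamma> = presented_algebra (weyl_gens n) (K_relators n p q \<gamma>)"

definition z_elem ::
    "(nat \<Rightarrow> 'k::field) \<Rightarrow> (nat \<Rightarrow> 'k) \<Rightarrow> nat \<Rightarrow> (weyl_gen, 'k) free_algebra" where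
  "z_elem p q i = (\<Sum>l\<in>{1..i}. free_scalar (q l - p l) * yg l * xg l)"

text \<open>The product \<open>z\<^sub>1 ^ e 1 * \<dots> * z\<^sub>n ^ e n\<close> is formed, in this order, in the free algebra
  and then mapped to the quotient.\<close>

definition K_Zset ::
    "nat \<Rightarrow> (nat \<Rightarrow> 'k::field) \<Rightarrow> (nat \<Rightarrow> 'k) \<Rightarrow> (nat \<Rightarrow> nat \<Rightarrow> 'k)
      \<Rightarrow> (weyl_gen, 'k) free_algebra set set" where
  "K_Zset n p q \<gamma> =
     {presented_class (weyl_gens n) (K_relators n p q \<gamma>)
        (prod_list (map (\<lambda>i. z_elem p q i ^ e i) [1..<Suc n])) | e :: nat \<Rightarrow> nat. True}"

definition graded_quantum_weyl_algebra ::
    "nat \<Rightarrow> (nat \<Rightarrow> 'k::field) \<Rightarrow> (nat \<Rightarrow> nat \<Rightarrow> 'k)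
      \<Rightarrow> ('k, (weyl_gen, 'k) free_algebra set) module" where
  "graded_quantum_weyl_algebra n q \<gamma> = K_algebra n (\<lambda>_. 1) q \<gamma>"

definition graded_quantum_weyl_Zset ::
    "nat \<Rightarrow> (nat \<Rightarrow> 'k::field) \<Rightarrow> (nat \<Rightarrow> nat \<Rightarrow> 'k)
      \<Rightarrow> (weyl_gen, 'k) free_algebra set set" where
  "graded_quantum_weyl_Zset n q \<gamma> = K_Zset n (\<lambda>_. 1) q \<gamma>"

definition root_of_unity :: "'k::field \<Rightarrow> bool" where
  "root_of_unity x \<longleftrightarrow> (\<exists>k>0. x ^ k = 1)"


section \<open>Right modules\<close>

text \<open>A right module is stored in the same record type as a left module; the field \<^const>\<open>smult\<close>
  holds the right action with its arguments swapped.\<close>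

abbreviation (input) ract :: "('a, 'm, 'e) module_scheme \<Rightarrow> 'm \<Rightarrow> 'a \<Rightarrow> 'm" (infixl \<open>\<star>\<index>\<close> 70) where
  "m \<star>\<^bsub>M\<^esub> a \<equiv> smult M a m"

locale right_module = A: ring A + M: abelian_group M
  for A :: "('a, 'e) ring_scheme" (structure) and M :: "('a, 'm, 'f) module_scheme" (structure) +
  assumes ract_closed: "m \<in> carrier M \<Longrightarrow> a \<in> carrier A \<Longrightarrow> m \<star>\<^bsub>M\<^esub> a \<in> carrier M"
    and ract_add_left: "m \<in> carrier M \<Longrightarrow> m' \<in> carrier M \<Longrightarrow> a \<in> carrier A \<Longrightarrow>
          (m \<oplus>\<^bsub>M\<^esub> m') \<star>\<^bsub>M\<^esub> a = m \<star>\<^bsub>M\<^esub> a \<oplus>\<^bsub>M\<^esub> m' \<star>\<^bsub>M\<^esub> a"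
    and ract_add_right: "m \<in> carrier M \<Longrightarrow> a \<in> carrier A \<Longrightarrow> b \<in> carrier A \<Longrightarrow>
          m \<star>\<^bsub>M\<^esub> (a \<oplus>\<^bsub>A\<^esub> b) = m \<star>\<^bsub>M\<^esub> a \<oplus>\<^bsub>M\<^esub> m \<star>\<^bsub>M\<^esub> b"
    and ract_mult: "m \<in> carrier M \<Longrightarrow> a \<in> carrier A \<Longrightarrow> b \<in> carrier A \<Longrightarrow>
          m \<star>\<^bsub>M\<^esub> (a \<otimes>\<^bsub>A\<^esub> b) = (m \<star>\<^bsub>M\<^esub> a) \<star>\<^bsub>M\<^esub> b"
    and ract_one: "m \<in> carrier M \<Longrightarrow> m \<star>\<^bsub>M\<^esub> \<one>\<^bsub>A\<^esub> = m"

definition fin_gen_right_module ::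
    "('a, 'e) ring_scheme \<Rightarrow> ('a, 'm, 'f) module_scheme \<Rightarrow> bool" where
  "fin_gen_right_module A M \<longleftrightarrow>
     (\<exists>S. finite S \<and> S \<subseteq> carrier M \<and>
        (\<forall>m\<in>carrier M. \<exists>r\<in>S \<rightarrow> carrier A. m = (\<Oplus>\<^bsub>M\<^esub>s\<in>S. s \<star>\<^bsub>M\<^esub> r s)))"

definition torsion_right_module :: "'a set \<Rightarrow> ('a, 'm, 'f) module_scheme \<Rightarrow> bool" where
  "torsion_right_module S M \<longleftrightarrow> (\<forall>m\<in>carrier M. \<exists>s\<in>S. m \<star>\<^bsub>M\<^esub> s = \<zero>\<^bsub>M\<^esub>)"


section \<open>Gelfand--Kirillov dimension\<close>

abbreviation lin_span :: "('k::field, 'a) module \<Rightarrow> 'a set \<Rightarrow> 'a set" where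
  "lin_span V S \<equiv> module.span class_ring V S"

abbreviation lin_dim :: "('k::field, 'a) module \<Rightarrow> 'a set \<Rightarrow> nat" where
  "lin_dim V W \<equiv> vectorspace.dim class_ring (V\<lparr>carrier := W\<rparr>)"

definition fd_subspaces :: "('k::field, 'a) module \<Rightarrow> 'a set set" where
  "fd_subspaces V =
     {W. subspace class_ring W V \<and> vectorspace.fin_dim class_ring (V\<lparr>carrier := W\<rparr>)}"

text \<open>\<open>limsup log\<^sub>m (d m)\<close>, with \<open>log 0 = -\<infinity>\<close>; in HOL, \<^term>\<open>ln (0::real)\<close> is \<open>0\<close>.\<close>

definition growth_exponent :: "(nat \<Rightarrow> nat) \<Rightarrow> ereal" where
  "growth_exponent d =
     limsup (\<lambda>m. if d m = 0 then - \<infinity> else ereal (log (real m) (real (d m))))"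

primrec subspace_power :: "('k::field, 'a) module \<Rightarrow> 'a set \<Rightarrow> nat \<Rightarrow> 'a set" where
  "subspace_power A V 0 = lin_span A {\<one>\<^bsub>A\<^esub>}"
| "subspace_power A V (Suc m) =
     lin_span A {a \<otimes>\<^bsub>A\<^esub> v | a v. a \<in> subspace_power A V m \<and> v \<in> V}"

text \<open>\<open>K + V + V\<^sup>2 + \<dots> + V\<^sup>m\<close>\<close>

definition subspace_power_upto :: "('k::field, 'a) module \<Rightarrow> 'a set \<Rightarrow> nat \<Rightarrow> 'a set" where
  "subspace_power_upto A V m = lin_span A (\<Union>i\<le>m. subspace_power A V i)"

definition gk_dim_algebra :: "('k::field, 'a) module \<Rightarrow> ereal" where
  "gk_dim_algebra A =
     (SUP V\<in>fd_subspaces A. growth_exponent (\<lambda>m. lin_dim A (subspace_power_upto A V m)))"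

text \<open>The \<open>K\<close>-vector space underlying a right module over the \<open>K\<close>-algebra \<open>A\<close>.\<close>

definition scalar_space :: "('k::field, 'a) module \<Rightarrow> ('a, 'm) module \<Rightarrow> ('k, 'm) module" where
  "scalar_space A M =
     \<lparr>carrier = carrier M, mult = mult M, one = one M, zero = zero M, add = add M,
      smult = (\<lambda>c m. m \<star>\<^bsub>M\<^esub> (c \<odot>\<^bsub>A\<^esub> \<one>\<^bsub>A\<^esub>))\<rparr>"

definition gk_dim_module :: "('k::field, 'a) module \<Rightarrow> ('a, 'm) module \<Rightarrow> ereal" where
  "gk_dim_module A M =
     (SUP V\<in>fd_subspaces A. SUP F\<in>fd_subspaces (scalar_space A M).
        growth_exponent (\<lambda>m. lin_dim (scalar_space A M)
          (lin_span (scalar_space A M)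
            {f \<star>\<^bsub>M\<^esub> a | f a. f \<in> F \<and> a \<in> subspace_power_upto A V m})))"

end

theory Submission
  imports
    Defs
    "HOL-Real_Asymp.Real_Asymp"
    "Jordan_Normal_Form.DL_Rank"
begin

text \<open>The proof follows Bernstein's inequality for the Weyl algebra. The elements
  \<open>x\<^sub>i, z\<^sub>i\<close> \<open>q\<close>-commute pairwise. Let \<open>M\<^sub>N = m * V\<^sup>N\<close>, where \<open>V\<close> is spanned by \<open>1\<close> and the
  generators and \<open>m\<close> is not killed by any product of powers of the \<open>z\<^sub>i\<close>. Suppose that a combination
  \<open>f\<close> of the monomials \<open>x\<^sup>d z\<^sup>b\<close> with all exponents at most \<open>k\<close> kills \<open>M\<^sub>N\<close>. Then \<open>u f - v f u\<close> kills
  \<open>M\<^bsub>N-2\<^esub>\<close> for \<open>u\<close> any \<open>z\<^sub>i\<close> or \<open>x\<^sub>i\<close> and any scalar \<open>v\<close>. As no \<open>q\<^sub>i\<close> is a root of unity, \<open>O(k)\<close> such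
  steps with the \<open>z\<^sub>i\<close> isolate \<open>d\<close>, and \<open>O(k)\<close> steps with the \<open>x\<^sub>i\<close> isolate \<open>b\<close>. Commutators with the
  \<open>y\<^sub>i\<close> then replace powers of \<open>x\<^sub>i\<close> by powers of \<open>z\<^sub>i\<close>, so that a product of powers of the \<open>z\<^sub>i\<close> kills
  \<open>m\<close>, a contradiction if \<open>N \<ge> 6n\<^sup>2k\<close>. Hence \<open>(k + 1)\<^bsup>2n\<^esup> \<le> dim M\<^sub>a * dim M\<^sub>b\<close> with \<open>a, b = O(k)\<close>, which
  gives \<open>GK-dim M \<ge> n\<close>. The same argument shows that the monomials are linearly independent in the
  algebra, and replacing \<open>x\<^sub>i\<^sup>d\<close> by a power of \<open>y\<^sub>i\<close> for \<open>d < 0\<close> one obtains enough monomials to span it.\<close>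

section \<open>Linear algebra\<close>

text \<open>The matrix \<gamma> is arbitrary, so the factor by which \<open>x j\<close> passes the
  other \<open>x i\<close> is uncontrolled. In passing a product \<open>y l * x l\<close> with
  \<open>l \<noteq> j\<close>, however, all \<gamma> cancel, and \<open>x j\<close> passes every
  \<open>z i\<close> with factor \<open>q j\<close> or 1. This dictates the order: the
  \<open>z i\<close> separate \<open>d\<close> first; once \<open>d\<close> is fixed, the unknown
  factor between \<open>x j\<close> and the \<open>x\<close>-part is common to all remaining
  monomials, and the \<open>x j\<close> can separate \<open>b\<close>. Each step leaves behind a
  right factor \<open>z i\<close> or \<open>x i\<close>, which turns a monomial into a nonzero
  multiple of a monomial.

  The constant is a budget: a left factor \<open>z i\<close> uses up 2 units of \<open>N\<close>,
  \<open>x i\<close> and \<open>y i\<close> use up 1, right factors are free. With at most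
  \<open>n * k\<close> steps per index the \<open>z i\<close> cost \<open>2 * n\<^sup>2 * k\<close>,
  the \<open>x i\<close> cost \<open>n\<^sup>2 * k\<close>, and the \<open>y i\<close> cost the
  final degree in the \<open>x i\<close>, at most \<open>n * k + 2 * n\<^sup>2 * k\<close>. Two
  dimensions appear because the combinations act as linear maps from M_a to M_b, injectively if only
  0 kills M_a.\<close>

lemma homogeneous_system_nontrivial_solution:
  fixes a :: "'i \<Rightarrow> 'j \<Rightarrow> 'k::field"
  assumes "finite J" "finite I" "card J < card I"
  shows "\<exists>c. (\<exists>i\<in>I. c i \<noteq> 0) \<and> (\<forall>j\<in>J. (\<Sum>i\<in>I. c i * a i j) = 0)"
  using assms
proof (induction J arbitrary: I a rule: finite_induct)
  case empty
  then obtain i where "i \<in> I" by fastforce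
  then show ?case by (intro exI[of _ "\<lambda>_. 1"]) auto
next
  case (insert j J)
  show ?case
  proof (cases "\<forall>i\<in>I. a i j = 0")
    case True
    obtain c where "\<exists>i\<in>I. c i \<noteq> 0" "\<forall>j\<in>J. (\<Sum>i\<in>I. c i * a i j) = 0"
      using insert.IH[of I a] insert.prems insert.hyps by auto
    with True show ?thesis by auto
  next
    case False
    then obtain p where p: "p \<in> I" "a p j \<noteq> 0" by auto
    \<comment> \<open>Gaussian elimination: equation \<open>j\<close> is solved for the unknown
      \<open>p\<close> and substituted into the others.\<close>
    define a' where "a' i l = a i l - a i j / a p j * a p l" for i l
    have "card J < card (I - {p})"
      using insert.prems insert.hyps p by (simp add: card_Diff_singleton)
    then obtain c where c: "\<exists>i\<in>I - {p}. c i \<noteq> 0" "\<forall>l\<in>J. (\<Sum>i\<in>I - {p}. c i * a' i l) = 0"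
      using insert.IH[of "I - {p}" a'] insert.prems by auto
    define c' where "c' = c(p := - (\<Sum>i\<in>I - {p}. c i * (a i j / a p j)))"
    have split: "(\<Sum>i\<in>I. c' i * a i l) = (\<Sum>i\<in>I - {p}. c i * a' i l)" for l
    proof -
      have "(\<Sum>i\<in>I. c' i * a i l) = c' p * a p l + (\<Sum>i\<in>I - {p}. c' i * a i l)"
        using p insert.prems by (simp add: sum.remove)
      also have "(\<Sum>i\<in>I - {p}. c' i * a i l) = (\<Sum>i\<in>I - {p}. c i * a i l)"
        by (intro sum.cong) (auto simp: c'_def)
      also have "c' p * a p l = - (\<Sum>i\<in>I - {p}. c i * (a i j / a p j) * a p l)"
        by (simp add: c'_def sum_distrib_right)
      finally show ?thesis
        by (simp add: a'_def right_diff_distrib sum_subtractf mult.assoc)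
    qed
    have "(\<Sum>i\<in>I - {p}. c i * a' i j) = 0"
      using p by (simp add: a'_def)
    then have "\<forall>l\<in>insert j J. (\<Sum>i\<in>I. c' i * a i l) = 0"
      using c(2) split by auto
    moreover have "\<exists>i\<in>I. c' i \<noteq> 0" using c(1) by (auto simp: c'_def)
    ultimately show ?thesis by blast
  qed
qed

text \<open>An independent subset of \<open>W\<close> stays independent in \<open>V\<close>, so its
  size is at most \<open>dim\<close>; a maximal one is therefore a finite generating set of
  \<open>W\<close>.\<close>

lemma (in vectorspace) fin_dim_subspace:
  assumes fd: "fin_dim" and W: "subspace K W V"
  shows "vectorspace.fin_dim K (vs W)"
proof -
  interpret W: vectorspace K "vs W" by (rule subspace_is_vs[OF W])
  have sub: "submodule K W V" using W by simp
  then have WV: "W \<subseteq> carrier V" by (simp add: submodule_def)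
  have small: "finite S \<and> card S \<le> dim" if "S \<subseteq> W \<and> W.lin_indpt S" for S
  proof -
    have "lin_indpt S" using that span_li_not_depend(2)[OF _ sub, of S] by simp
    then show ?thesis using li_le_dim[OF fd, of S] that WV by auto
  qed
  have "{} \<subseteq> W \<and> W.lin_indpt {}" by (auto simp: W.lin_dep_def)
  then obtain S where S: "finite S" "maximal S (\<lambda>S. S \<subseteq> W \<and> W.lin_indpt S)"
    using maximal_exists[of "\<lambda>S. S \<subseteq> W \<and> W.lin_indpt S" dim "{}"] small by blast
  then have "W.gen_set S" "S \<subseteq> W" using W.max_li_is_gen[of S] by (auto simp: maximal_def)
  then show ?thesis using S(1) by (auto simp: W.fin_dim_def)
qed

text \<open>\<open>T\<close> need not lie in \<open>W\<close>, so the comparison runs through the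
  larger subspace \<open>span T\<close>, which \<open>T\<close> does generate.\<close>

lemma (in vectorspace) subspace_of_span:
  assumes T: "finite T" "T \<subseteq> carrier V" and W: "subspace K W V" "W \<subseteq> span T"
  shows "vectorspace.fin_dim K (vs W)" "vectorspace.dim K (vs W) \<le> card T"
proof -
  have U: "subspace K (span T) V" by (rule span_is_subspace[OF T(2)])
  interpret U: vectorspace K "vs (span T)" by (rule subspace_is_vs[OF U])
  have T_span: "T \<subseteq> span T" by (rule in_own_span[OF T(2)])
  then have gen: "U.gen_set T" using span_li_not_depend(1)[OF _ is_module[OF U]] by simp
  then have fd: "U.fin_dim" using T(1) T_span by (auto simp: U.fin_dim_def)
  have WU: "subspace K W (vs (span T))" by (rule nested_subspaces[OF U W])
  have eq: "(vs (span T))\<lparr>carrier := W\<rparr> = vs W" by simp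
  show fW: "vectorspace.fin_dim K (vs W)" using U.fin_dim_subspace[OF fd WU] unfolding eq .
  have "vectorspace.dim K (vs W) \<le> U.dim"
    using U.subspace_dim[OF WU fd] fW unfolding eq by blast
  also have "\<dots> \<le> card T" using gen T(1) T_span by (intro U.gen_ge_dim) auto
  finally show "vectorspace.dim K (vs W) \<le> card T" .
qed

lemma (in vectorspace) subspace_dim_mono:
  assumes "subspace K W V" "subspace K X V" "X \<subseteq> W" "vectorspace.fin_dim K (vs W)"
  shows "vectorspace.dim K (vs X) \<le> vectorspace.dim K (vs W)"
proof -
  interpret W: vectorspace K "vs W" by (rule subspace_is_vs[OF assms(1)])
  have X: "subspace K X (vs W)" by (rule nested_subspaces[OF assms(1-3)])
  have "(vs W)\<lparr>carrier := X\<rparr> = vs X" by simp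
  then show ?thesis using W.subspace_dim[OF X assms(4)] W.fin_dim_subspace[OF assms(4) X] by simp
qed

lemma (in vectorspace) subspaceI:
  assumes "W \<subseteq> carrier V" "\<zero>\<^bsub>V\<^esub> \<in> W" "\<And>v w. v \<in> W \<Longrightarrow> w \<in> W \<Longrightarrow> v \<oplus>\<^bsub>V\<^esub> w \<in> W"
    "\<And>c v. c \<in> carrier K \<Longrightarrow> v \<in> W \<Longrightarrow> c \<odot>\<^bsub>V\<^esub> v \<in> W"
  shows "subspace K W V"
  unfolding subspace_def submodule_def
  using assms vectorspace_axioms module.module_axioms by auto

text \<open>The source is a whole type, the target a carrier set. The instances are the quotient map
  onto the algebra and the maps sending \<open>f\<close> to the action of its class on a fixed
  module element; they turn computations with free polynomials into dimensions.\<close>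

locale linear_image = S: vector_space scale + V: vectorspace "class_ring :: 'k ring" V
  for scale :: "'k::field \<Rightarrow> 'r::ab_group_add \<Rightarrow> 'r" and V :: "('k, 'v) module" +
  fixes \<Phi> :: "'r \<Rightarrow> 'v"
  assumes \<Phi>_closed: "\<Phi> f \<in> carrier V"
    and \<Phi>_add: "\<Phi> (f + g) = \<Phi> f \<oplus>\<^bsub>V\<^esub> \<Phi> g"
    and \<Phi>_scale: "\<Phi> (scale c f) = c \<odot>\<^bsub>V\<^esub> \<Phi> f"
begin

lemma \<Phi>_zero: "\<Phi> 0 = \<zero>\<^bsub>V\<^esub>"
  using \<Phi>_scale[of 0 0] V.lmult_0[OF \<Phi>_closed, of 0] by simp

lemma \<Phi>_diff_eq_zero: "\<Phi> (f - g) = \<zero>\<^bsub>V\<^esub> \<longleftrightarrow> \<Phi> f = \<Phi> g"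
proof -
  have "\<Phi> f = \<Phi> (f - g) \<oplus>\<^bsub>V\<^esub> \<Phi> g" using \<Phi>_add[of "f - g" g] by simp
  then show ?thesis using V.M.add.l_cancel_one'[of "\<Phi> g" "\<Phi> (f - g)"] \<Phi>_closed
    by (metis V.M.add.r_cancel_one V.M.l_zero)
qed

lemma \<Phi>_sum: "finite E \<Longrightarrow> \<Phi> (\<Sum>e\<in>E. scale (c e) (h e)) = (\<Oplus>\<^bsub>V\<^esub>e\<in>E. c e \<odot>\<^bsub>V\<^esub> \<Phi> (h e))"
proof (induction E rule: finite_induct)
  case (insert e E)
  then show ?case
    using \<Phi>_closed by (simp add: \<Phi>_add \<Phi>_scale Pi_def)
qed (simp add: \<Phi>_zero)

lemma image_subspace:
  assumes "0 \<in> F" "\<And>f g. f \<in> F \<Longrightarrow> g \<in> F \<Longrightarrow> f + g \<in> F" "\<And>c f. f \<in> F \<Longrightarrow> scale c f \<in> F"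
  shows "subspace class_ring (\<Phi> ` F) V"
proof (rule V.subspaceI)
  show "\<zero>\<^bsub>V\<^esub> \<in> \<Phi> ` F" using assms(1) \<Phi>_zero by force
qed (use assms \<Phi>_closed in \<open>auto simp flip: \<Phi>_add \<Phi>_scale\<close>)

lemma image_span: "\<Phi> ` S.span T \<subseteq> lin_span V (\<Phi> ` T)"
proof
  have T: "\<Phi> ` T \<subseteq> carrier V" using \<Phi>_closed by auto
  interpret U: submodule class_ring "lin_span V (\<Phi> ` T)" V by (rule V.span_is_submodule[OF T])
  fix v assume "v \<in> \<Phi> ` S.span T"
  then obtain f where f: "f \<in> S.span T" "v = \<Phi> f" by blast
  from f(1) have "\<Phi> f \<in> lin_span V (\<Phi> ` T)"
  proof (induction rule: S.span_induct_alt)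
    case base
    then show ?case using U.zero_closed by (simp add: \<Phi>_zero)
  next
    case (step c f g)
    then have "\<Phi> f \<in> lin_span V (\<Phi> ` T)" using V.in_own_span[OF T] by blast
    then show ?case using step by (simp add: \<Phi>_add \<Phi>_scale)
  qed
  then show "v \<in> lin_span V (\<Phi> ` T)" using f(2) by simp
qed

text \<open>A basis of the image is lifted to \<open>F\<close>. Dimensions thus become statements
  about congruence modulo the kernel, the form in which the counting arguments use them.\<close>

lemma obtain_spanning_set:
  assumes sub: "subspace class_ring (\<Phi> ` F) V"
    and fd: "vectorspace.fin_dim class_ring (V\<lparr>carrier := \<Phi> ` F\<rparr>)"
  obtains E where "finite E" "E \<subseteq> F" "card E \<le> lin_dim V (\<Phi> ` F)"
    "\<And>f. f \<in> F \<Longrightarrow> \<exists>c. \<Phi> (f - (\<Sum>e\<in>E. scale (c e) e)) = \<zero>\<^bsub>V\<^esub>"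
proof -
  interpret U: vectorspace class_ring "V\<lparr>carrier := \<Phi> ` F\<rparr>" by (rule V.subspace_is_vs[OF sub])
  obtain B where B: "finite B" "U.basis B" using U.finite_basis_exists fd by blast
  then have BF: "B \<subseteq> \<Phi> ` F" by (simp add: U.basis_def)
  then have "\<forall>b\<in>B. \<exists>f. f \<in> F \<and> \<Phi> f = b" by blast
  then obtain h where h: "\<And>b. b \<in> B \<Longrightarrow> h b \<in> F \<and> \<Phi> (h b) = b" by metis
  then have inj: "inj_on h B" by (intro inj_on_inverseI[of B \<Phi> h]) auto
  have "lin_span V B = \<Phi> ` F"
    using B(2) BF V.span_li_not_depend(1)[OF BF V.is_module[OF sub]] by (simp add: U.basis_def)
  have "\<exists>c. \<Phi> (f - (\<Sum>e\<in>h ` B. scale (c e) e)) = \<zero>\<^bsub>V\<^esub>" if "f \<in> F" for f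
  proof -
    have "\<Phi> f \<in> lin_span V B" using that \<open>lin_span V B = \<Phi> ` F\<close> by blast
    then obtain a where a: "\<Phi> f = (\<Oplus>\<^bsub>V\<^esub>b\<in>B. a b \<odot>\<^bsub>V\<^esub> b)"
      using V.finite_span[OF B(1)] BF \<Phi>_closed unfolding V.lincomb_def by auto
    have "\<Phi> (\<Sum>e\<in>h ` B. scale (a (\<Phi> e)) e) = \<Phi> (\<Sum>b\<in>B. scale (a b) (h b))"
      using h by (simp add: sum.reindex[OF inj])
    also have "\<dots> = (\<Oplus>\<^bsub>V\<^esub>b\<in>B. a b \<odot>\<^bsub>V\<^esub> \<Phi> (h b))" by (rule \<Phi>_sum[OF B(1)])
    also have "\<dots> = \<Phi> f"
      unfolding a using h BF \<Phi>_closed by (intro V.M.finsum_cong') auto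
    finally show ?thesis using \<Phi>_diff_eq_zero by metis
  qed
  moreover have "card (h ` B) \<le> lin_dim V (\<Phi> ` F)"
    using U.dim_basis[OF B] card_image_le[OF B(1)] by simp
  ultimately show ?thesis using that[of "h ` B"] B(1) h by blast
qed

end

section \<open>Growth exponents\<close>

text \<open>The constant disappears in the limit: the base-\<open>m\<close> logarithm of
  \<open>(m / C) ^ p\<close> is \<open>p * (1 - ln C / ln m)\<close>.\<close>

lemma growth_exponent_ge:
  assumes C: "C > 0" and d: "\<And>m. m \<ge> 1 \<Longrightarrow> (real m / C) ^ p \<le> real (d m)"
  shows "ereal (real p) \<le> growth_exponent d"
proof -
  let ?g = "\<lambda>m::nat. real p * (ln (real m) - ln C) / ln (real m)"
  have "?g \<longlonglongrightarrow> real p" by real_asymp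
  then have "(\<lambda>m. ereal (?g m)) \<longlonglongrightarrow> ereal (real p)" by simp
  then have "limsup (\<lambda>m. ereal (?g m)) = ereal (real p)"
    by (intro lim_imp_Limsup) auto
  moreover have "limsup (\<lambda>m. ereal (?g m)) \<le> growth_exponent d"
    unfolding growth_exponent_def
  \<comment> \<open>From 2 on \<open>ln m\<close> is positive, so division by it preserves the
    inequality.\<close>
  proof (intro Limsup_mono eventually_sequentiallyI[of 2])
    fix m :: nat assume m: "2 \<le> m"
    then have pos: "(real m / C) ^ p > 0" using C by simp
    then have dpos: "real (d m) > 0" using d[of m] m by linarith
    have "real p * (ln (real m) - ln C) = ln ((real m / C) ^ p)"
      using m C by (simp add: ln_realpow ln_div)
    also have "\<dots> \<le> ln (real (d m))" using d[of m] m pos dpos by simp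
    finally have "?g m \<le> log (real m) (real (d m))"
      using m by (simp add: log_def divide_right_mono)
    then show "ereal (?g m) \<le> (if d m = 0 then - \<infinity> else ereal (log (real m) (real (d m))))"
      using dpos by auto
  qed
  ultimately show ?thesis by simp
qed

lemma growth_exponent_le:
  assumes C: "C > 0" and d: "\<And>m. m \<ge> 1 \<Longrightarrow> real (d m) \<le> (C * real m) ^ p"
  shows "growth_exponent d \<le> ereal (real p)"
proof -
  let ?g = "\<lambda>m::nat. real p * (ln C + ln (real m)) / ln (real m)"
  have "?g \<longlonglongrightarrow> real p" by real_asymp
  then have "(\<lambda>m. ereal (?g m)) \<longlonglongrightarrow> ereal (real p)" by simp
  then have "limsup (\<lambda>m. ereal (?g m)) = ereal (real p)"
    by (intro lim_imp_Limsup) auto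
  moreover have "growth_exponent d \<le> limsup (\<lambda>m. ereal (?g m))"
    unfolding growth_exponent_def
  proof (intro Limsup_mono eventually_sequentiallyI[of 2])
    fix m :: nat assume m: "2 \<le> m"
    show "(if d m = 0 then - \<infinity> else ereal (log (real m) (real (d m)))) \<le> ereal (?g m)"
    proof (cases "d m = 0")
      case False
      then have "ln (real (d m)) \<le> ln ((C * real m) ^ p)" using d[of m] m by simp
      also have "\<dots> = real p * (ln C + ln (real m))"
        using m C by (simp add: ln_realpow ln_mult)
      finally have "log (real m) (real (d m)) \<le> ?g m"
        using m by (simp add: log_def divide_right_mono)
      with False show ?thesis by simp
    qed simp
  qed
  ultimately show ?thesis by simp
qed

text \<open>The bound is available only for \<open>c * k \<le> N\<close>; taking \<open>k\<close>
  proportional to \<open>N\<close> loses a constant factor, which the exponent ignores. Dividing by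
  \<open>c + 1\<close> also covers \<open>c = 0\<close>.\<close>

lemma growth_lower_bound:
  assumes "\<And>k N. c * k \<le> N \<Longrightarrow> (k + 1) ^ p \<le> d N"
  shows "ereal (real p) \<le> growth_exponent d"
proof (rule growth_exponent_ge)
  show "0 < real (c + 1)" by simp
  fix N :: nat
  let ?k = "N div (c + 1)"
  have "N < (c + 1) * (?k + 1)" using dividend_less_div_times[of "c + 1" N] by (simp add: algebra_simps)
  then have "real N < real ((c + 1) * (?k + 1))" by (rule of_nat_less_iff[THEN iffD2])
  then have "real N / real (c + 1) \<le> real (?k + 1)"
    by (simp add: divide_le_eq algebra_simps)
  then have "(real N / real (c + 1)) ^ p \<le> real (?k + 1) ^ p" by (intro power_mono) auto
  also have "\<dots> = real ((?k + 1) ^ p)" by simp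
  also have "\<dots> \<le> real (d N)"
  proof (intro of_nat_mono assms)
    have "c * ?k \<le> (c + 1) * ?k" by simp
    also have "\<dots> \<le> N" by (rule times_div_less_eq_dividend)
    finally show "c * ?k \<le> N" .
  qed
  finally show "(real N / real (c + 1)) ^ p \<le> real (d N)" .
qed

section \<open>Commutation up to scalars modulo an ideal\<close>

lemma prod_list_eq_one:
  fixes f :: "'a \<Rightarrow> 'b::monoid_mult"
  shows "(\<And>i. i \<in> set is \<Longrightarrow> f i = 1) \<Longrightarrow> (\<Prod>i\<leftarrow>is. f i) = 1"
  by (induction "is") auto

text \<open>The outer factors \<open>a\<close> and \<open>b\<close> are the same for every
  \<open>v\<close>, so one slot of a product can be rewritten modulo an ideal while the rest stays
  fixed.\<close>

lemma prod_list_fun_upd_factor: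
  fixes w :: "'a \<Rightarrow> 'b::monoid_mult"
  assumes "distinct is" "j \<in> set is"
  obtains a b where "\<And>v. (\<Prod>i\<leftarrow>is. (w(j := v)) i) = a * v * b"
proof -
  obtain us vs where is_eq: "is = us @ j # vs" using assms(2) split_list by metis
  then have "j \<notin> set us" "j \<notin> set vs" using assms(1) by auto
  then have "map (w(j := v)) us = map w us" "map (w(j := v)) vs = map w vs" for v by auto
  then have "(\<Prod>i\<leftarrow>is. (w(j := v)) i) = prod_list (map w us) * v * prod_list (map w vs)" for v
    by (simp only: is_eq map_append list.map prod_list.append prod_list.Cons fun_upd_same mult.assoc)
  then show ?thesis by (rule that)
qed

text \<open>\<open>I\<close> will be the kernel of the quotient map: congruence modulo
  \<open>I\<close> replaces equality of cosets, and the arithmetic stays free of carrier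
  conditions.\<close>

locale algebra_ideal = vector_space scale
  for scale :: "'k::field \<Rightarrow> 'r::ring_1 \<Rightarrow> 'r" (infixr \<open>*\<^sub>k\<close> 75) +
  fixes I :: "'r set"
  assumes mult_scale_left [simp]: "(c *\<^sub>k f) * g = c *\<^sub>k (f * g)"
    and mult_scale_right [simp]: "f * (c *\<^sub>k g) = c *\<^sub>k (f * g)"
    and I_zero: "0 \<in> I"
    and I_add: "f \<in> I \<Longrightarrow> g \<in> I \<Longrightarrow> f + g \<in> I"
    and I_left: "f \<in> I \<Longrightarrow> g * f \<in> I"
    and I_right: "f \<in> I \<Longrightarrow> f * g \<in> I"
begin

definition eqv :: "'r \<Rightarrow> 'r \<Rightarrow> bool" (infix \<open>\<doteq>\<close> 50) where
  "f \<doteq> g \<longleftrightarrow> f - g \<in> I"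

lemma I_scale: "f \<in> I \<Longrightarrow> c *\<^sub>k f \<in> I"
  using I_left[of f "c *\<^sub>k 1"] by simp

lemma I_uminus: "f \<in> I \<Longrightarrow> - f \<in> I"
  using I_left[of f "-1"] by simp

lemma eqv_refl [simp, intro]: "f \<doteq> f"
  by (simp add: eqv_def I_zero)

lemma eqv_sym: "f \<doteq> g \<Longrightarrow> g \<doteq> f"
  using I_uminus[of "f - g"] by (simp add: eqv_def)

lemma eqv_trans [trans]: "f \<doteq> g \<Longrightarrow> g \<doteq> h \<Longrightarrow> f \<doteq> h"
  using I_add[of "f - g" "g - h"] by (simp add: eqv_def)

lemma eqv_add: "f \<doteq> f' \<Longrightarrow> g \<doteq> g' \<Longrightarrow> f + g \<doteq> f' + g'"
  using I_add[of "f - f'" "g - g'"] by (simp add: eqv_def algebra_simps)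

lemma eqv_scale: "f \<doteq> f' \<Longrightarrow> c *\<^sub>k f \<doteq> c *\<^sub>k f'"
  using I_scale[of "f - f'" c] by (simp add: eqv_def scale_right_diff_distrib)

lemma eqv_diff: "f \<doteq> f' \<Longrightarrow> g \<doteq> g' \<Longrightarrow> f - g \<doteq> f' - g'"
  using eqv_add[of f f' "(-1) *\<^sub>k g" "(-1) *\<^sub>k g'"] eqv_scale[of g g' "-1"] by simp

lemma eqv_mult: "f \<doteq> f' \<Longrightarrow> g \<doteq> g' \<Longrightarrow> f * g \<doteq> f' * g'"
  using I_add[OF I_left[of "g - g'" f] I_right[of "f - f'" g']]
  by (simp add: eqv_def algebra_simps)

lemma eqv_sum: "(\<And>a. a \<in> A \<Longrightarrow> f a \<doteq> g a) \<Longrightarrow> sum f A \<doteq> sum g A"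
  by (induction A rule: infinite_finite_induct) (auto intro!: eqv_add)

definition qcom :: "'k \<Rightarrow> 'r \<Rightarrow> 'r \<Rightarrow> bool" where
  "qcom c u v \<longleftrightarrow> u * v \<doteq> c *\<^sub>k (v * u)"

lemma qcom_one [simp]: "qcom 1 u 1"
  by (simp add: qcom_def)

lemma qcom_sym: "qcom c u v \<Longrightarrow> c \<noteq> 0 \<Longrightarrow> qcom (inverse c) v u"
  using eqv_scale[of "u * v" "c *\<^sub>k (v * u)" "inverse c"] by (simp add: qcom_def eqv_sym)

lemma qcom_mult:
  assumes "qcom c u v" "qcom d u w"
  shows "qcom (c * d) u (v * w)"
proof -
  have "u * (v * w) = (u * v) * w" by (simp add: mult.assoc)
  also have "\<dots> \<doteq> (c *\<^sub>k (v * u)) * w" using assms(1) by (intro eqv_mult eqv_refl) (simp add: qcom_def)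
  also have "\<dots> = c *\<^sub>k (v * (u * w))" by (simp add: mult.assoc)
  also have "\<dots> \<doteq> c *\<^sub>k (v * (d *\<^sub>k (w * u)))"
    using assms(2) by (intro eqv_scale eqv_mult eqv_refl) (simp add: qcom_def)
  also have "\<dots> = (c * d) *\<^sub>k (v * w * u)" by (simp add: mult.assoc)
  finally show ?thesis by (simp add: qcom_def)
qed

lemma qcom_add: "qcom c u v \<Longrightarrow> qcom c u w \<Longrightarrow> qcom c u (v + w)"
  using eqv_add[of "u * v" "c *\<^sub>k (v * u)" "u * w" "c *\<^sub>k (w * u)"]
  by (simp add: qcom_def algebra_simps scale_right_distrib)

lemma qcom_scale: "qcom c u v \<Longrightarrow> qcom c u (a *\<^sub>k v)"
  using eqv_scale[of "u * v" "c *\<^sub>k (v * u)" a] by (simp add: qcom_def mult.commute)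

lemma qcom_zero [simp]: "qcom c u 0"
  by (simp add: qcom_def)

lemma qcom_sum: "(\<And>a. a \<in> A \<Longrightarrow> qcom c u (f a)) \<Longrightarrow> qcom c u (sum f A)"
  by (induction A rule: infinite_finite_induct) (auto intro: qcom_add)

lemma qcom_power: "qcom c u v \<Longrightarrow> qcom (c ^ k) u (v ^ k)"
  by (induction k) (auto intro: qcom_mult)

lemma qcom_prod_list:
  "(\<And>i. i \<in> set is \<Longrightarrow> qcom (c i) u (v i)) \<Longrightarrow> qcom (\<Prod>i\<leftarrow>is. c i) u (\<Prod>i\<leftarrow>is. v i)"
  by (induction "is") (auto intro: qcom_mult)

text \<open>Many factors involve \<gamma> and matter only through being invertible; hiding them
  under a quantifier avoids computing them.\<close>

definition qcommute :: "'r \<Rightarrow> 'r \<Rightarrow> bool" where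
  "qcommute u v \<longleftrightarrow> (\<exists>c. c \<noteq> 0 \<and> qcom c u v)"

lemma qcommuteI: "qcom c u v \<Longrightarrow> c \<noteq> 0 \<Longrightarrow> qcommute u v"
  by (auto simp: qcommute_def)

lemma qcommute_sym: "qcommute u v \<Longrightarrow> qcommute v u"
  unfolding qcommute_def using qcom_sym by (metis nonzero_imp_inverse_nonzero)

lemma qcommute_one [simp]: "qcommute u 1" "qcommute 1 u"
  using qcommuteI[OF qcom_one] qcommute_sym by auto

lemma qcommute_mult: "qcommute u v \<Longrightarrow> qcommute u w \<Longrightarrow> qcommute u (v * w)"
  unfolding qcommute_def using qcom_mult by (metis mult_eq_0_iff)

lemma qcommute_mult_left: "qcommute u w \<Longrightarrow> qcommute v w \<Longrightarrow> qcommute (u * v) w"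
  using qcommute_mult qcommute_sym by blast

lemma qcommute_power: "qcommute u v \<Longrightarrow> qcommute u (v ^ k)"
  by (induction k) (auto intro: qcommute_mult)

lemma qcommute_prod_list: "(\<And>v. v \<in> set vs \<Longrightarrow> qcommute u v) \<Longrightarrow> qcommute u (prod_list vs)"
  by (induction vs) (auto intro: qcommute_mult)

text \<open>The new factor \<open>v\<close> moves left past the later slots until it reaches slot
  \<open>j\<close>. Slot \<open>j\<close> is exempt from the commutation hypothesis, since
  \<open>x j\<close> and \<open>y j\<close> need not commute up to a scalar.\<close>

lemma prod_list_insert_factor:
  assumes "distinct is" "j \<in> set is" "\<And>i. i \<in> set is \<Longrightarrow> i \<noteq> j \<Longrightarrow> qcommute (w i) v"
  shows "\<exists>c. c \<noteq> 0 \<and> (\<Prod>i\<leftarrow>is. w i) * v \<doteq> c *\<^sub>k (\<Prod>i\<leftarrow>is. (w(j := w j * v)) i)"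
  using assms
proof (induction "is")
  case (Cons i "is")
  show ?case
  proof (cases "i = j")
    case True
    then have "j \<notin> set is" using Cons.prems by auto
    have "qcommute v (\<Prod>i\<leftarrow>is. w i)"
      using Cons.prems \<open>j \<notin> set is\<close> by (intro qcommute_prod_list) (auto intro: qcommute_sym)
    then obtain c where c: "c \<noteq> 0" "qcom c (\<Prod>i\<leftarrow>is. w i) v"
      using qcommute_sym qcommute_def by blast
    have "(\<Prod>i\<leftarrow>i # is. w i) * v = w j * ((\<Prod>i\<leftarrow>is. w i) * v)" using True by (simp add: mult.assoc)
    also have "\<dots> \<doteq> w j * (c *\<^sub>k (v * (\<Prod>i\<leftarrow>is. w i)))"
      using c by (intro eqv_mult eqv_refl) (simp add: qcom_def)
    also have "\<dots> = c *\<^sub>k (w j * v * (\<Prod>i\<leftarrow>is. w i))" by (simp add: mult.assoc)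
    also have "(\<Prod>i\<leftarrow>is. w i) = (\<Prod>i\<leftarrow>is. (w(j := w j * v)) i)"
      using \<open>j \<notin> set is\<close> by (intro arg_cong[of _ _ prod_list] map_cong) auto
    finally show ?thesis using True c(1) by auto
  next
    case False
    then obtain c where c: "c \<noteq> 0"
      "(\<Prod>i\<leftarrow>is. w i) * v \<doteq> c *\<^sub>k (\<Prod>i\<leftarrow>is. (w(j := w j * v)) i)"
      using Cons.IH Cons.prems by auto
    have "(\<Prod>i\<leftarrow>i # is. w i) * v = w i * ((\<Prod>i\<leftarrow>is. w i) * v)" by (simp add: mult.assoc)
    also have "\<dots> \<doteq> w i * (c *\<^sub>k (\<Prod>i\<leftarrow>is. (w(j := w j * v)) i))"
      by (intro eqv_mult eqv_refl c(2))
    also have "\<dots> = c *\<^sub>k (\<Prod>i\<leftarrow>i # is. (w(j := w j * v)) i)" using False by simp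
    finally show ?thesis using c(1) by auto
  qed
qed simp

end

section \<open>The defining relations and the elements \<open>z i\<close>\<close>

locale quantum_weyl_mod = algebra_ideal scale I
  for scale :: "'k::field \<Rightarrow> 'r::ring_1 \<Rightarrow> 'r" (infixr \<open>*\<^sub>k\<close> 75) and I :: "'r set" +
  fixes n :: nat and q :: "nat \<Rightarrow> 'k" and \<gamma> :: "nat \<Rightarrow> nat \<Rightarrow> 'k" and x y :: "nat \<Rightarrow> 'r"
  assumes q_nonzero: "i \<in> {1..n} \<Longrightarrow> q i \<noteq> 0"
    and q_not_root: "i \<in> {1..n} \<Longrightarrow> k > 0 \<Longrightarrow> q i ^ k \<noteq> 1"
    and gamma_antisym: "i \<in> {1..n} \<Longrightarrow> j \<in> {1..n} \<Longrightarrow> \<gamma> i j * \<gamma> j i = 1"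
    and x_x: "1 \<le> i \<Longrightarrow> i < j \<Longrightarrow> j \<le> n \<Longrightarrow> qcom (q i * \<gamma> i j) (x i) (x j)"
    and y_y: "1 \<le> i \<Longrightarrow> i < j \<Longrightarrow> j \<le> n \<Longrightarrow> qcom (\<gamma> i j) (y i) (y j)"
    and x_y_less: "1 \<le> i \<Longrightarrow> i < j \<Longrightarrow> j \<le> n \<Longrightarrow> qcom (inverse (\<gamma> i j)) (x i) (y j)"
    and x_y_greater: "1 \<le> j \<Longrightarrow> j < i \<Longrightarrow> i \<le> n \<Longrightarrow> qcom (q j * inverse (\<gamma> i j)) (x i) (y j)"
    and x_y_same: "1 \<le> i \<Longrightarrow> i \<le> n \<Longrightarrow>
          x i * y i \<doteq> q i *\<^sub>k (y i * x i) + (\<Sum>l\<in>{1..<i}. (q l - 1) *\<^sub>k (y l * x l))"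
begin

definition z :: "nat \<Rightarrow> 'r" where
  "z i = (\<Sum>l\<in>{1..i}. (q l - 1) *\<^sub>k (y l * x l))"

lemma z_0 [simp]: "z 0 = 0"
  by (simp add: z_def)

lemma z_Suc: "z (Suc i) = z i + (q (Suc i) - 1) *\<^sub>k (y (Suc i) * x (Suc i))"
  by (simp add: z_def add.commute)

lemma z_rec: "1 \<le> i \<Longrightarrow> z i = z (i - 1) + (q i - 1) *\<^sub>k (y i * x i)"
  using z_Suc[of "i - 1"] by simp

lemma x_y_z_pred: "i \<in> {1..n} \<Longrightarrow> x i * y i \<doteq> q i *\<^sub>k (y i * x i) + z (i - 1)"
proof -
  assume i: "i \<in> {1..n}"
  then have "{1..<i} = {1..i - 1}" by auto
  with x_y_same[of i] i show ?thesis by (simp add: z_def)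
qed

text \<open>The relation in its most useful form: \<open>z i\<close> is the commutator of
  \<open>x i\<close> and \<open>y i\<close>. This is why commutators with \<open>y i\<close> trade
  \<open>x i\<close> for \<open>z i\<close>.\<close>

lemma x_y_z: "i \<in> {1..n} \<Longrightarrow> x i * y i \<doteq> y i * x i + z i"
  using x_y_z_pred[of i] by (simp add: z_rec scale_left_diff_distrib add.commute)

lemma gamma_nonzero: "i \<in> {1..n} \<Longrightarrow> j \<in> {1..n} \<Longrightarrow> \<gamma> i j \<noteq> 0"
  using gamma_antisym[of i j] by auto

lemma gamma_inverse: "i \<in> {1..n} \<Longrightarrow> j \<in> {1..n} \<Longrightarrow> \<gamma> i j = inverse (\<gamma> j i)"
  using gamma_antisym[of i j] by (simp add: inverse_unique mult.commute)

lemma q_neq_1: "i \<in> {1..n} \<Longrightarrow> q i \<noteq> 1"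
  using q_not_root[of i 1] by simp

text \<open>Moving \<open>x j\<close> past \<open>y l\<close> and then past \<open>x l\<close>
  produces \<gamma> and its inverse. For \<open>j < l\<close> only the \<open>q j\<close> from the
  relation between \<open>x j\<close> and \<open>x l\<close> survives; for \<open>l < j\<close> two
  factors \<open>q l\<close> cancel as well.\<close>

lemma qcom_x_yx:
  assumes "j \<in> {1..n}" "l \<in> {1..n}" "l \<noteq> j"
  shows "qcom (if j < l then q j else 1) (x j) (y l * x l)"
proof (cases "j < l")
  case True
  then have "qcom (inverse (\<gamma> j l) * (q j * \<gamma> j l)) (x j) (y l * x l)"
    using assms by (intro qcom_mult x_y_less x_x) auto
  with True show ?thesis using gamma_nonzero[of j l] assms by (simp add: field_simps)
next
  case False
  then have "qcom (q l * inverse (\<gamma> j l) * inverse (q l * \<gamma> l j)) (x j) (y l * x l)"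
    using assms q_nonzero gamma_nonzero by (intro qcom_mult x_y_greater qcom_sym x_x) auto
  with False show ?thesis
    using gamma_nonzero[of j l] gamma_inverse[of l j] q_nonzero[of l] assms by (simp add: field_simps)
qed

lemma qcom_y_yx:
  assumes "j \<in> {1..n}" "l \<in> {1..n}" "l \<noteq> j"
  shows "qcom (if j < l then inverse (q j) else 1) (y j) (y l * x l)"
proof (cases "j < l")
  case True
  then have "qcom (\<gamma> j l * inverse (q j * inverse (\<gamma> l j))) (y j) (y l * x l)"
    using assms q_nonzero gamma_nonzero by (intro qcom_mult y_y qcom_sym x_y_greater) auto
  with True show ?thesis
    using gamma_nonzero[of j l] gamma_inverse[of l j] q_nonzero[of j] assms by (simp add: field_simps)
next
  case False
  then have "qcom (inverse (\<gamma> l j) * inverse (inverse (\<gamma> l j))) (y j) (y l * x l)"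
    using assms gamma_nonzero by (intro qcom_mult qcom_sym y_y x_y_less) auto
  with False show ?thesis using gamma_nonzero[of l j] assms by (simp add: field_simps)
qed

text \<open>The term \<open>y i * x i\<close> alone need not commute with \<open>x i\<close> up to a
  scalar, but the remainder \<open>z (i - 1)\<close> that it leaves combines with the commuting part
  of \<open>z i\<close>: \<open>1 + (q i - 1) = q i\<close>.\<close>

lemma x_z_same: "i \<in> {1..n} \<Longrightarrow> qcom (q i) (x i) (z i)"
proof -
  assume i: "i \<in> {1..n}"
  let ?z = "z (i - 1)" and ?a = "q i - 1"
  have zc: "qcom 1 (x i) ?z"
    unfolding z_def
  proof (intro qcom_sum qcom_scale)
    fix l assume "l \<in> {1..i - 1}"
    with i have "l \<in> {1..n}" "l \<noteq> i" "\<not> i < l" by auto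
    with qcom_x_yx[of i l] i show "qcom 1 (x i) (y l * x l)" by simp
  qed
  have "x i * z i = x i * ?z + ?a *\<^sub>k ((x i * y i) * x i)"
    using i by (simp add: z_rec distrib_left mult.assoc)
  also have "\<dots> \<doteq> ?z * x i + ?a *\<^sub>k ((q i *\<^sub>k (y i * x i) + ?z) * x i)"
    using zc x_y_z_pred[OF i] by (auto simp: qcom_def intro!: eqv_add eqv_scale eqv_mult)
  also have "\<dots> = q i *\<^sub>k (z i * x i)"
    using i by (simp add: z_rec algebra_simps scale_left_distrib scale_right_distrib
        scale_left_diff_distrib scale_right_diff_distrib)
  finally show ?thesis by (simp add: qcom_def)
qed

lemma z_y_same: "i \<in> {1..n} \<Longrightarrow> qcom (q i) (z i) (y i)"
proof -
  assume i: "i \<in> {1..n}"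
  let ?z = "z (i - 1)" and ?a = "q i - 1"
  have "qcom 1 (y i) ?z"
    unfolding z_def
  proof (intro qcom_sum qcom_scale)
    fix l assume "l \<in> {1..i - 1}"
    with i have "l \<in> {1..n}" "l \<noteq> i" "\<not> i < l" by auto
    with qcom_y_yx[of i l] i show "qcom 1 (y i) (y l * x l)" by simp
  qed
  then have zc: "y i * ?z \<doteq> ?z * y i" by (simp add: qcom_def)
  have "z i * y i = ?z * y i + ?a *\<^sub>k (y i * (x i * y i))"
    using i by (simp add: z_rec distrib_right mult.assoc)
  also have "\<dots> \<doteq> y i * ?z + ?a *\<^sub>k (y i * (q i *\<^sub>k (y i * x i) + ?z))"
    using eqv_sym[OF zc] x_y_z_pred[OF i] by (auto intro!: eqv_add eqv_scale eqv_mult)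
  also have "\<dots> = q i *\<^sub>k (y i * z i)"
    using i by (simp add: z_rec algebra_simps scale_left_distrib scale_right_distrib
        scale_left_diff_distrib scale_right_diff_distrib)
  finally show ?thesis by (simp add: qcom_def)
qed

lemma qcom_x_z:
  assumes "j \<in> {1..n}" "i \<le> n"
  shows "qcom (if j \<le> i then q j else 1) (x j) (z i)"
proof (cases "j \<le> i")
  case True
  \<comment> \<open>Starting from \<open>z j\<close>, each further term \<open>y l * x l\<close>
    with \<open>l > j\<close> has the same factor \<open>q j\<close>.\<close>
  from True assms(2) have "qcom (q j) (x j) (z i)"
  proof (induction i rule: dec_induct)
    case base
    then show ?case using x_z_same assms by simp
  next
    case (step i)
    then show ?case
      unfolding z_Suc using qcom_x_yx[of j "Suc i"] assms by (intro qcom_add qcom_scale) auto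
  qed
  with True show ?thesis by simp
next
  case False
  have "qcom 1 (x j) (z i)"
    unfolding z_def
  proof (intro qcom_sum qcom_scale)
    fix l assume "l \<in> {1..i}"
    then show "qcom 1 (x j) (y l * x l)" using qcom_x_yx[of j l] False assms by auto
  qed
  with False show ?thesis by simp
qed

lemma qcom_y_z:
  assumes "j \<in> {1..n}" "i \<le> n"
  shows "qcom (if j \<le> i then inverse (q j) else 1) (y j) (z i)"
proof (cases "j \<le> i")
  case True
  from True assms(2) have "qcom (inverse (q j)) (y j) (z i)"
  proof (induction i rule: dec_induct)
    case base
    then show ?case using z_y_same[THEN qcom_sym] q_nonzero assms by simp
  next
    case (step i)
    then show ?case
      unfolding z_Suc using qcom_y_yx[of j "Suc i"] assms by (intro qcom_add qcom_scale) auto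
  qed
  with True show ?thesis by simp
next
  case False
  have "qcom 1 (y j) (z i)"
    unfolding z_def
  proof (intro qcom_sum qcom_scale)
    fix l assume "l \<in> {1..i}"
    then show "qcom 1 (y j) (y l * x l)" using qcom_y_yx[of j l] False assms by auto
  qed
  with False show ?thesis by simp
qed

text \<open>The factors of \<open>y l\<close> and \<open>x l\<close> past \<open>z i\<close> are
  inverse to each other, so every term of \<open>z j\<close> commutes with
  \<open>z i\<close>.\<close>

lemma qcom_z_z:
  assumes "i \<le> n" "j \<le> n"
  shows "qcom 1 (z i) (z j)"
  unfolding z_def[of j]
proof (intro qcom_sum qcom_scale)
  fix l assume "l \<in> {1..j}"
  then have l: "l \<in> {1..n}" using assms by auto
  have "qcom (inverse (if l \<le> i then inverse (q l) else 1) * inverse (if l \<le> i then q l else 1))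
      (z i) (y l * x l)"
    using l assms q_nonzero by (intro qcom_mult qcom_sym qcom_y_z qcom_x_z) auto
  then show "qcom 1 (z i) (y l * x l)" using q_nonzero[OF l] by (simp split: if_splits)
qed

lemma qcommute_x_x: "i \<in> {1..n} \<Longrightarrow> j \<in> {1..n} \<Longrightarrow> qcommute (x i) (x j)"
proof (induction i j rule: linorder_wlog)
  case (le i j)
  show ?case
  proof (cases "i = j")
    case False
    then show ?thesis using le q_nonzero gamma_nonzero by (intro qcommuteI[OF x_x]) auto
  qed (auto intro: qcommuteI[of 1] simp: qcom_def)
qed (blast intro: qcommute_sym)

lemma qcommute_y_y: "i \<in> {1..n} \<Longrightarrow> j \<in> {1..n} \<Longrightarrow> qcommute (y i) (y j)"
proof (induction i j rule: linorder_wlog)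
  case (le i j)
  show ?case
  proof (cases "i = j")
    case False
    then show ?thesis using le q_nonzero gamma_nonzero by (intro qcommuteI[OF y_y]) auto
  qed (auto intro: qcommuteI[of 1] simp: qcom_def)
qed (blast intro: qcommute_sym)

lemma qcommute_x_y: "i \<in> {1..n} \<Longrightarrow> j \<in> {1..n} \<Longrightarrow> i \<noteq> j \<Longrightarrow> qcommute (x i) (y j)"
  using x_y_less[of i j] x_y_greater[of j i] q_nonzero gamma_nonzero
  by (cases "i < j") (auto intro!: qcommuteI)

lemma qcommute_x_z: "j \<in> {1..n} \<Longrightarrow> i \<le> n \<Longrightarrow> qcommute (x j) (z i)"
  using q_nonzero by (intro qcommuteI[OF qcom_x_z]) auto

lemma qcommute_y_z: "j \<in> {1..n} \<Longrightarrow> i \<le> n \<Longrightarrow> qcommute (y j) (z i)"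
  using q_nonzero by (intro qcommuteI[OF qcom_y_z]) auto

lemma qcommute_z_z: "i \<le> n \<Longrightarrow> j \<le> n \<Longrightarrow> qcommute (z i) (z j)"
  by (intro qcommuteI[OF qcom_z_z]) auto

section \<open>Ordered monomials and multiplication by generators\<close>

definition w :: "nat \<Rightarrow> int \<Rightarrow> 'r" where
  "w i t = (if 0 \<le> t then x i ^ nat t else y i ^ nat (- t))"

definition W :: "(nat \<Rightarrow> int) \<Rightarrow> 'r" where
  "W d = (\<Prod>i\<leftarrow>[1..<Suc n]. w i (d i))"

definition Z :: "(nat \<Rightarrow> nat) \<Rightarrow> 'r" where
  "Z b = (\<Prod>i\<leftarrow>[1..<Suc n]. z i ^ b i)"

definition mon :: "(nat \<Rightarrow> int) \<times> (nat \<Rightarrow> nat) \<Rightarrow> 'r" where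
  "mon s = W (fst s) * Z (snd s)"

lemma set_indices [simp]: "set [1..<Suc n] = {1..n}"
  by auto

lemma W_fun_upd: "W (d(j := t)) = (\<Prod>i\<leftarrow>[1..<Suc n]. ((\<lambda>i. w i (d i))(j := w j t)) i)"
  unfolding W_def by (intro arg_cong[of _ _ prod_list] map_cong) auto

lemma qcommute_w_x: "i \<in> {1..n} \<Longrightarrow> j \<in> {1..n} \<Longrightarrow> i \<noteq> j \<Longrightarrow> qcommute (w i t) (x j)"
  unfolding w_def using qcommute_power qcommute_sym qcommute_x_x qcommute_x_y by simp

lemma qcommute_w_y: "i \<in> {1..n} \<Longrightarrow> j \<in> {1..n} \<Longrightarrow> i \<noteq> j \<Longrightarrow> qcommute (w i t) (y j)"
  unfolding w_def using qcommute_power qcommute_sym qcommute_y_y qcommute_x_y by simp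

lemma qcommute_w_z: "i \<in> {1..n} \<Longrightarrow> j \<le> n \<Longrightarrow> qcommute (w i t) (z j)"
  unfolding w_def using qcommute_power qcommute_sym qcommute_y_z qcommute_x_z by simp

lemma qcommute_Z:
  assumes "\<And>i. i \<in> {1..n} \<Longrightarrow> qcommute u (z i)"
  shows "qcommute u (Z b)"
  unfolding Z_def using assms by (intro qcommute_prod_list) (auto intro: qcommute_power)

lemma W_mult_same:
  assumes j: "j \<in> {1..n}" and "\<And>i. i \<in> {1..n} \<Longrightarrow> i \<noteq> j \<Longrightarrow> qcommute (w i (d i)) v"
    and "w j (d j) * v = w j t"
  shows "\<exists>c. c \<noteq> 0 \<and> W d * v \<doteq> c *\<^sub>k W (d(j := t))"
  using prod_list_insert_factor[of "[1..<Suc n]" j "\<lambda>i. w i (d i)" v] assms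
  unfolding W_fun_upd set_indices by (simp add: W_def del: upt_Suc fun_upd_apply)

lemma W_mult_x:
  "j \<in> {1..n} \<Longrightarrow> 0 \<le> d j \<Longrightarrow> \<exists>c. c \<noteq> 0 \<and> W d * x j \<doteq> c *\<^sub>k W (d(j := d j + 1))"
  by (intro W_mult_same qcommute_w_x) (auto simp: w_def nat_add_distrib power_commutes)

lemma W_mult_y:
  assumes "j \<in> {1..n}" "d j \<le> 0"
  shows "\<exists>c. c \<noteq> 0 \<and> W d * y j \<doteq> c *\<^sub>k W (d(j := d j - 1))"
proof (intro W_mult_same qcommute_w_y)
  have "nat (- (d j - 1)) = Suc (nat (- d j))" using assms by auto
  then show "w j (d j) * y j = w j (d j - 1)" using assms by (auto simp: w_def power_commutes)
qed (use assms in auto)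

text \<open>For the case that \<open>x j\<close> and \<open>y j\<close> meet in slot
  \<open>j\<close>. The pair becomes a combination of \<open>z j\<close> and
  \<open>z (j - 1)\<close>, which commute up to scalars with every slot and can be moved to the
  right end.\<close>

lemma W_mult_collapse:
  assumes j: "j \<in> {1..n}" and com: "\<And>i. i \<in> {1..n} \<Longrightarrow> i \<noteq> j \<Longrightarrow> qcommute (w i (d i)) v"
    and v: "w j (d j) * v \<doteq> w j t * (a *\<^sub>k z j + b *\<^sub>k z (j - 1))"
  shows "\<exists>a b. W d * v \<doteq> a *\<^sub>k (W (d(j := t)) * z j) + b *\<^sub>k (W (d(j := t)) * z (j - 1))"
proof -
  let ?w = "\<lambda>i. w i (d i)" and ?is = "[1..<Suc n]"
  obtain l r where lr: "\<And>v. (\<Prod>i\<leftarrow>?is. (?w(j := v)) i) = l * v * r"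
    using prod_list_fun_upd_factor[of ?is j ?w] j set_indices by (metis distinct_upt)
  have "\<exists>c. l * (w j t * z i) * r \<doteq> c *\<^sub>k (W (d(j := t)) * z i)" if "i \<le> n" for i
  proof -
    have "\<exists>c. c \<noteq> 0 \<and> W (d(j := t)) * z i \<doteq>
        c *\<^sub>k (\<Prod>i'\<leftarrow>?is. ((?w(j := w j t))(j := (?w(j := w j t)) j * z i)) i')"
      unfolding W_fun_upd using j that
      by (intro prod_list_insert_factor) (auto simp del: upt_Suc intro: qcommute_w_z)
    then obtain c where c: "c \<noteq> 0" "W (d(j := t)) * z i \<doteq> c *\<^sub>k (l * (w j t * z i) * r)"
      by (auto simp only: fun_upd_upd fun_upd_same lr)
    show ?thesis
      using eqv_scale[OF c(2), of "inverse c"] c(1) by (auto intro: eqv_sym)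
  qed
  then obtain c where c: "\<And>i. i \<le> n \<Longrightarrow> l * (w j t * z i) * r \<doteq> c i *\<^sub>k (W (d(j := t)) * z i)"
    by metis
  have "\<exists>c. c \<noteq> 0 \<and> W d * v \<doteq> c *\<^sub>k (\<Prod>i\<leftarrow>?is. (?w(j := ?w j * v)) i)"
    unfolding W_def using j com by (intro prod_list_insert_factor) (auto simp del: upt_Suc)
  then obtain e where e: "W d * v \<doteq> e *\<^sub>k (l * (w j (d j) * v) * r)"
    by (auto simp only: lr)
  note e
  also have "e *\<^sub>k (l * (w j (d j) * v) * r) \<doteq> e *\<^sub>k (l * (w j t * (a *\<^sub>k z j + b *\<^sub>k z (j - 1))) * r)"
    by (intro eqv_scale eqv_mult eqv_refl v)
  also have "\<dots> = (e * a) *\<^sub>k (l * (w j t * z j) * r) + (e * b) *\<^sub>k (l * (w j t * z (j - 1)) * r)"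
    by (simp add: algebra_simps scale_right_distrib)
  also have "\<dots> \<doteq> (e * a) *\<^sub>k (c j *\<^sub>k (W (d(j := t)) * z j))
      + (e * b) *\<^sub>k (c (j - 1) *\<^sub>k (W (d(j := t)) * z (j - 1)))"
    using j by (intro eqv_add eqv_scale c) auto
  finally show ?thesis by auto
qed

lemma y_x_eq: "j \<in> {1..n} \<Longrightarrow> y j * x j = inverse (q j - 1) *\<^sub>k (z j - z (j - 1))"
  using q_neq_1[of j] by (simp add: z_rec)

lemma W_mult_x_collapse:
  assumes j: "j \<in> {1..n}" and "d j < 0"
  shows "\<exists>a b. W d * x j \<doteq> a *\<^sub>k (W (d(j := d j + 1)) * z j) + b *\<^sub>k (W (d(j := d j + 1)) * z (j - 1))"
proof (rule W_mult_collapse[OF j])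
  define m where "m = nat (- d j) - 1"
  have "nat (- d j) = Suc m" using assms by (simp add: m_def)
  moreover have "w j (d j + 1) = y j ^ m"
    using assms by (auto simp: w_def m_def nat_diff_distrib intro!: arg_cong[of _ _ "\<lambda>t. y j ^ t"])
  ultimately have "w j (d j) * x j = w j (d j + 1) * (y j * x j)"
    using assms by (simp add: w_def mult.assoc power_Suc2 del: power_Suc)
  then show "w j (d j) * x j \<doteq>
      w j (d j + 1) * (inverse (q j - 1) *\<^sub>k z j + (- inverse (q j - 1)) *\<^sub>k z (j - 1))"
    using j by (simp add: y_x_eq scale_right_diff_distrib)
qed (use j qcommute_w_x in auto)

lemma W_mult_y_collapse:
  assumes j: "j \<in> {1..n}" and "d j > 0"
  shows "\<exists>a b. W d * y j \<doteq> a *\<^sub>k (W (d(j := d j - 1)) * z j) + b *\<^sub>k (W (d(j := d j - 1)) * z (j - 1))"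
proof (rule W_mult_collapse[OF j])
  define m where "m = nat (d j) - 1"
  let ?a = "q j * inverse (q j - 1)"
  have "nat (d j) = Suc m" using assms by (simp add: m_def)
  moreover have "w j (d j - 1) = x j ^ m"
    using assms by (auto simp: w_def m_def nat_diff_distrib)
  ultimately have "w j (d j) * y j = w j (d j - 1) * (x j * y j)"
    using assms by (simp add: w_def mult.assoc power_Suc2 del: power_Suc)
  also have "\<dots> \<doteq> w j (d j - 1) * (q j *\<^sub>k (y j * x j) + z (j - 1))"
    by (intro eqv_mult eqv_refl x_y_z_pred j)
  also have "q j *\<^sub>k (y j * x j) + z (j - 1) = ?a *\<^sub>k z j + (1 - ?a) *\<^sub>k z (j - 1)"
    using j by (simp add: y_x_eq scale_right_diff_distrib scale_left_diff_distrib)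
  finally show "w j (d j) * y j \<doteq> w j (d j - 1) * (?a *\<^sub>k z j + (1 - ?a) *\<^sub>k z (j - 1))" .
qed (use j qcommute_w_y in auto)

lemma Z_mult_z_power:
  assumes j: "j \<in> {1..n}"
  shows "\<exists>c. c \<noteq> 0 \<and> Z b * z j ^ k \<doteq> c *\<^sub>k Z (b(j := b j + k))"
proof -
  have "Z (b(j := b j + k))
      = (\<Prod>i\<leftarrow>[1..<Suc n]. ((\<lambda>i. z i ^ b i)(j := z j ^ b j * z j ^ k)) i)"
    unfolding Z_def by (intro arg_cong[of _ _ prod_list] map_cong) (auto simp: power_add)
  moreover have "\<exists>c. c \<noteq> 0 \<and> Z b * z j ^ k \<doteq>
      c *\<^sub>k (\<Prod>i\<leftarrow>[1..<Suc n]. ((\<lambda>i. z i ^ b i)(j := z j ^ b j * z j ^ k)) i)"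
    unfolding Z_def using j
    by (intro prod_list_insert_factor)
      (auto simp del: upt_Suc intro!: qcommute_power qcommute_sym[OF qcommute_power] qcommute_z_z)
  ultimately show ?thesis by simp
qed

section \<open>Every word is a combination of ordered monomials\<close>

definition box :: "nat \<Rightarrow> ((nat \<Rightarrow> int) \<times> (nat \<Rightarrow> nat)) set" where
  "box N = (PiE {1..n} (\<lambda>_. {- int N..int N})) \<times> (PiE {1..n} (\<lambda>_. {0..N}))"

definition spanned :: "nat \<Rightarrow> 'r set" where
  "spanned N = {f. \<exists>g \<in> span (mon ` box N). f \<doteq> g}"

lemma finite_box: "finite (box N)"
  unfolding box_def by (intro finite_cartesian_product finite_PiE) auto

lemma box_mono: "M \<le> N \<Longrightarrow> box M \<subseteq> box N"
  unfolding box_def by (intro Sigma_mono PiE_mono) auto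

lemma box_fun_upd:
  assumes "(d, b) \<in> box N" "j \<in> {1..n}"
  shows "t \<in> {- int N..int N} \<Longrightarrow> (d(j := t), b) \<in> box N" "k \<le> N \<Longrightarrow> (d, b(j := k)) \<in> box N"
  using assms unfolding box_def by (auto simp: PiE_def Pi_def extensional_def)

lemma card_box: "card (box N) \<le> (2 * N + 1) ^ (2 * n)"
proof -
  have "nat (2 * int N + 1) = 2 * N + 1" by simp
  then have "card (box N) = (2 * N + 1) ^ n * (N + 1) ^ n"
    by (simp add: box_def card_cartesian_product card_PiE)
  also have "\<dots> \<le> (2 * N + 1) ^ n * (2 * N + 1) ^ n"
    by (intro mult_left_mono power_mono) auto
  finally show ?thesis by (simp add: mult_2 power_add)
qed

lemma spanned_add: "f \<in> spanned N \<Longrightarrow> g \<in> spanned N \<Longrightarrow> f + g \<in> spanned N"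
  unfolding spanned_def by (blast intro: span_add eqv_add)

lemma spanned_scale: "f \<in> spanned N \<Longrightarrow> c *\<^sub>k f \<in> spanned N"
  unfolding spanned_def by (blast intro: span_scale eqv_scale)

lemma spanned_zero: "0 \<in> spanned N"
  unfolding spanned_def by (blast intro: span_zero)

lemma spanned_eqv: "f \<in> spanned N \<Longrightarrow> g \<doteq> f \<Longrightarrow> g \<in> spanned N"
  unfolding spanned_def by (blast intro: eqv_trans)

lemma spanned_mono: "M \<le> N \<Longrightarrow> spanned M \<subseteq> spanned N"
proof -
  assume "M \<le> N"
  then have "span (mon ` box M) \<subseteq> span (mon ` box N)"
    by (intro span_mono image_mono box_mono)
  then show ?thesis unfolding spanned_def by blast
qed

lemma mon_in_spanned: "s \<in> box N \<Longrightarrow> mon s \<in> spanned N"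
  unfolding spanned_def by (blast intro: span_base)

text \<open>The case \<open>i = 0\<close> is included because it arises as \<open>z (j - 1)\<close>
  with \<open>j = 1\<close>; there \<open>z 0 = 0\<close>.\<close>

lemma W_z_Z_in_spanned:
  assumes "(d, b) \<in> box N" "j \<in> {1..n}" "i \<le> n" "t \<in> {- int (Suc N)..int (Suc N)}"
  shows "W (d(j := t)) * z i * Z b \<in> spanned (Suc N)"
proof (cases "i = 0")
  case False
  then have i: "i \<in> {1..n}" using assms by auto
  obtain c where c: "qcom c (z i) (Z b)"
    using qcommute_Z[of "z i" b] qcommute_z_z i unfolding qcommute_def by auto
  obtain c' where c': "Z b * z i ^ 1 \<doteq> c' *\<^sub>k Z (b(i := b i + 1))"
    using Z_mult_z_power[OF i] by blast
  have "z i * Z b \<doteq> c *\<^sub>k (Z b * z i ^ 1)" using c by (simp add: qcom_def)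
  also have "\<dots> \<doteq> c *\<^sub>k (c' *\<^sub>k Z (b(i := b i + 1)))" by (intro eqv_scale c')
  finally have "W (d(j := t)) * (z i * Z b) \<doteq> W (d(j := t)) * (c *\<^sub>k (c' *\<^sub>k Z (b(i := b i + 1))))"
    by (intro eqv_mult eqv_refl)
  then have "W (d(j := t)) * z i * Z b \<doteq> (c * c') *\<^sub>k mon (d(j := t), b(i := b i + 1))"
    by (simp add: mon_def mult.assoc)
  then show ?thesis
  proof (rule spanned_eqv[rotated], intro spanned_scale mon_in_spanned box_fun_upd)
    show "(d, b) \<in> box (Suc N)" using assms(1) box_mono[of N "Suc N"] by auto
    have "b i \<le> N" using assms(1) i by (auto simp: box_def)
    then show "b i + 1 \<le> Suc N" by simp
  qed (use assms i in auto)
qed (simp add: spanned_zero)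

text \<open>Give \<open>x j\<close> degree 1, \<open>y j\<close> degree -1 and every
  \<open>z i\<close> degree 0: a generator shifts one exponent \<open>d j\<close> by one and, if it
  cancels against the power in slot \<open>j\<close>, adds one factor \<open>z j\<close> or
  \<open>z (j - 1)\<close>. So the box grows by one.\<close>

lemma spanned_mult_generator:
  assumes f: "f \<in> spanned N" and j: "j \<in> {1..n}" and g: "g = x j \<or> g = y j"
  shows "f * g \<in> spanned (Suc N)"
proof -
  have mon: "mon s * g \<in> spanned (Suc N)" if s: "s \<in> box N" for s
  proof -
    obtain d b where db: "s = (d, b)" by (cases s)
    have dN: "d j \<in> {- int N..int N}" using s j by (auto simp: db box_def)
    have "qcommute (Z b) g"
      using g j by (auto intro!: qcommute_sym[OF qcommute_Z] qcommute_x_z qcommute_y_z)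
    then obtain c where "qcom c (Z b) g" by (auto simp: qcommute_def)
    then have "W d * (Z b * g) \<doteq> W d * (c *\<^sub>k (g * Z b))"
      by (intro eqv_mult eqv_refl) (simp add: qcom_def)
    then have 1: "mon s * g \<doteq> c *\<^sub>k (W d * g * Z b)" by (simp add: db mon_def mult.assoc)
    define t where "t = (if g = x j then d j + 1 else d j - 1)"
    have t: "t \<in> {- int (Suc N)..int (Suc N)}" using dN by (auto simp: t_def)
    \<comment> \<open>The power in slot \<open>j\<close> is extended or a pair cancels, depending on
      the sign of \<open>d j\<close>.\<close>
    have "\<exists>e a a'. W d * g \<doteq> e *\<^sub>k W (d(j := t))
         \<or> W d * g \<doteq> a *\<^sub>k (W (d(j := t)) * z j) + a' *\<^sub>k (W (d(j := t)) * z (j - 1))"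
    proof (cases "g = x j")
      case True
      then have "t = d j + 1" by (simp add: t_def)
      then show ?thesis
        unfolding True using W_mult_x[of j d, OF j] W_mult_x_collapse[of j d, OF j]
        by (cases "0 \<le> d j") (blast, auto)
    next
      case False
      then have gt: "g = y j" "t = d j - 1" using g by (auto simp: t_def)
      then show ?thesis
        unfolding gt using W_mult_y[of j d, OF j] W_mult_y_collapse[of j d, OF j]
        by (cases "d j \<le> 0") (blast, auto)
    qed
    then obtain e a a' where 2: "W d * g \<doteq> e *\<^sub>k W (d(j := t))
         \<or> W d * g \<doteq> a *\<^sub>k (W (d(j := t)) * z j) + a' *\<^sub>k (W (d(j := t)) * z (j - 1))"
      by blast
    have "W d * g * Z b \<in> spanned (Suc N)"
      using 2
    proof
      assume "W d * g \<doteq> e *\<^sub>k W (d(j := t))"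
      then have "W d * g * Z b \<doteq> (e *\<^sub>k W (d(j := t))) * Z b" by (intro eqv_mult eqv_refl)
      also have "\<dots> = e *\<^sub>k mon (d(j := t), b)" by (simp add: mon_def)
      finally show ?thesis
      proof (rule spanned_eqv[rotated], intro spanned_scale mon_in_spanned box_fun_upd)
        show "(d, b) \<in> box (Suc N)" using s box_mono[of N "Suc N"] by (auto simp: db)
      qed (use t j in auto)
    next
      assume "W d * g \<doteq> a *\<^sub>k (W (d(j := t)) * z j) + a' *\<^sub>k (W (d(j := t)) * z (j - 1))"
      then have "W d * g * Z b \<doteq>
          (a *\<^sub>k (W (d(j := t)) * z j) + a' *\<^sub>k (W (d(j := t)) * z (j - 1))) * Z b"
        by (intro eqv_mult eqv_refl)
      also have "\<dots> = a *\<^sub>k (W (d(j := t)) * z j * Z b) + a' *\<^sub>k (W (d(j := t)) * z (j - 1) * Z b)"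
        by (simp add: distrib_right)
      finally show ?thesis
      proof (rule spanned_eqv[rotated], intro spanned_add spanned_scale W_z_Z_in_spanned)
        show "(d, b) \<in> box N" "(d, b) \<in> box N" using s by (simp_all add: db)
      qed (use t j in auto)
    qed
    with 1 show ?thesis by (auto intro: spanned_eqv spanned_scale)
  qed
  obtain h where h: "h \<in> span (mon ` box N)" "f \<doteq> h" using f by (auto simp: spanned_def)
  from h(1) have "h * g \<in> spanned (Suc N)"
  proof (induction rule: span_induct_alt)
    case base
    then show ?case by (simp add: spanned_zero)
  next
    case (step c v u)
    then show ?case using mon by (auto simp: distrib_right intro!: spanned_add spanned_scale)
  qed
  then show ?thesis using eqv_mult[OF h(2) eqv_refl] by (rule spanned_eqv)
qed

lemma one_in_spanned: "1 \<in> spanned 0"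
proof -
  let ?s = "(restrict (\<lambda>_. 0) {1..n}, restrict (\<lambda>_. 0) {1..n})"
  have "W (fst ?s) = 1"
    unfolding W_def by (rule prod_list_eq_one) (auto simp: w_def)
  moreover have "Z (snd ?s) = 1"
    unfolding Z_def by (rule prod_list_eq_one) auto
  ultimately have "mon ?s = 1" by (simp add: mon_def)
  moreover have "mon ?s \<in> spanned 0" by (intro mon_in_spanned) (simp add: box_def)
  ultimately show ?thesis by simp
qed

lemma prod_list_generators_in_spanned:
  "set vs \<subseteq> x ` {1..n} \<union> y ` {1..n} \<Longrightarrow> prod_list vs \<in> spanned (length vs)"
proof (induction vs rule: rev_induct)
  case (snoc v vs)
  then obtain j where "j \<in> {1..n}" "v = x j \<or> v = y j" by auto
  moreover have "prod_list vs \<in> spanned (length vs)" using snoc by simp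
  ultimately show ?case using spanned_mult_generator[of "prod_list vs" "length vs" j v] by simp
qed (simp add: one_in_spanned)

end

section \<open>Bernstein's inequality\<close>

text \<open>\<open>L\<close> will be the annihilator of a nontorsion element, in general only a
  right ideal. \<open>F\<close> will be the filtration by word length.\<close>

locale quantum_weyl_annihilator = quantum_weyl_mod scale I n q \<gamma> x y
  for scale :: "'k::field \<Rightarrow> 'r::ring_1 \<Rightarrow> 'r" (infixr \<open>*\<^sub>k\<close> 75) and I n q \<gamma> x y +
  fixes L :: "'r set" and F :: "nat \<Rightarrow> 'r set"
  assumes I_subset_L: "I \<subseteq> L"
    and L_add: "f \<in> L \<Longrightarrow> g \<in> L \<Longrightarrow> f + g \<in> L"
    and L_right: "f \<in> L \<Longrightarrow> f * g \<in> L"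
    and one_in_F: "1 \<in> F 0"
    and F_mult: "f \<in> F a \<Longrightarrow> g \<in> F b \<Longrightarrow> f * g \<in> F (a + b)"
    and F_add: "f \<in> F a \<Longrightarrow> g \<in> F a \<Longrightarrow> f + g \<in> F a"
    and F_scale: "f \<in> F a \<Longrightarrow> c *\<^sub>k f \<in> F a"
    and F_mono: "a \<le> b \<Longrightarrow> F a \<subseteq> F b"
    and x_in_F: "i \<in> {1..n} \<Longrightarrow> x i \<in> F 1"
    and y_in_F: "i \<in> {1..n} \<Longrightarrow> y i \<in> F 1"
    and Z_notin_L: "Z e \<notin> L"
begin

lemma L_scale: "f \<in> L \<Longrightarrow> c *\<^sub>k f \<in> L"
  using L_right[of f "c *\<^sub>k 1"] by simp

lemma L_zero: "0 \<in> L"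
  using I_zero I_subset_L by blast

lemma L_diff: "f \<in> L \<Longrightarrow> g \<in> L \<Longrightarrow> f - g \<in> L"
  using L_add[of f "(-1) *\<^sub>k g"] L_scale[of g "-1"] by simp

lemma L_sum: "(\<And>a. a \<in> A \<Longrightarrow> f a \<in> L) \<Longrightarrow> sum f A \<in> L"
  by (induction A rule: infinite_finite_induct) (auto intro: L_zero L_add)

lemma L_eqv: "f \<in> L \<Longrightarrow> f \<doteq> g \<Longrightarrow> g \<in> L"
  using L_diff[of f "f - g"] I_subset_L by (auto simp: eqv_def)

lemma F_power: "f \<in> F a \<Longrightarrow> f ^ k \<in> F (a * k)"
  by (induction k) (auto intro: one_in_F F_mult)

lemma F_prod_list: "(\<And>i. i \<in> set is \<Longrightarrow> f i \<in> F a) \<Longrightarrow> (\<Prod>i\<leftarrow>is. f i) \<in> F (a * length is)"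
  by (induction "is") (auto intro: one_in_F F_mult)

lemma F_sum:
  assumes "\<And>a. a \<in> A \<Longrightarrow> f a \<in> F N"
  shows "sum f A \<in> F N"
proof -
  have "0 \<in> F N" using F_scale[of 1 N 0] one_in_F F_mono[of 0 N] by auto
  then show ?thesis using assms
    by (induction A rule: infinite_finite_induct) (auto intro: F_add)
qed

lemma z_in_F: "i \<le> n \<Longrightarrow> z i \<in> F 2"
  unfolding z_def
  by (intro F_sum F_scale) (use F_mult[OF y_in_F x_in_F] in \<open>auto simp: numeral_2_eq_2\<close>)

section \<open>Annihilators of the pieces of the filtration, and eigencomponents\<close>

definition kills :: "nat \<Rightarrow> 'r \<Rightarrow> bool" where
  "kills N f \<longleftrightarrow> (\<forall>g \<in> F N. g * f \<in> L)"

lemma kills_eqv: "kills N f \<Longrightarrow> f \<doteq> g \<Longrightarrow> kills N g"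
  unfolding kills_def using L_eqv eqv_mult[OF eqv_refl] by blast

lemma kills_diff: "kills N f \<Longrightarrow> kills N g \<Longrightarrow> kills N (f - g)"
  unfolding kills_def by (auto simp: right_diff_distrib intro: L_diff)

lemma kills_scale: "kills N f \<Longrightarrow> kills N (c *\<^sub>k f)"
  unfolding kills_def by (auto intro: L_scale)

lemma kills_scaleD: "kills N (c *\<^sub>k f) \<Longrightarrow> c \<noteq> 0 \<Longrightarrow> kills N f"
  using kills_scale[of N "c *\<^sub>k f" "inverse c"] by simp

lemma kills_right: "kills N f \<Longrightarrow> kills N (f * g)"
  unfolding kills_def by (auto simp: mult.assoc[symmetric] intro: L_right)

text \<open>Left multiplication lowers the level \<open>N\<close>, right multiplication does not.
  The level thus measures how many left factors are still available; this makes up for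
  \<open>L\<close> not being a left ideal.\<close>

lemma kills_left: "kills (N + D) f \<Longrightarrow> u \<in> F D \<Longrightarrow> kills N (u * f)"
  unfolding kills_def by (auto simp: mult.assoc[symmetric] intro: F_mult)

lemma kills_mono: "kills N f \<Longrightarrow> M \<le> N \<Longrightarrow> kills M f"
  unfolding kills_def using F_mono by blast

lemma not_kills_Z: "\<not> kills 0 (Z b)"
  unfolding kills_def using one_in_F Z_notin_L by force

text \<open>If \<open>u\<close> \<open>q\<close>-commutes with \<open>g\<close>, with factor \<open>\<theta>\<close>, then \<open>u * g - v *\<^sub>k (g * u)\<close> is congruent
  to \<open>(\<theta> - v) *\<^sub>k (g * u)\<close>: letting \<open>v\<close> run through all the other values of \<open>\<theta>\<close> isolates one
  eigencomponent.\<close>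

lemma kills_eigen_factor:
  assumes "finite V" "u \<in> F D" "\<And>s. s \<in> S \<Longrightarrow> qcom (\<theta> s) u (g s)"
    and "kills (N + D * card V) (\<Sum>s\<in>S. c s *\<^sub>k g s)"
  shows "kills N (\<Sum>s\<in>S. (c s * (\<Prod>v\<in>V. \<theta> s - v)) *\<^sub>k (g s * u ^ card V))"
  using assms(1,4)
proof (induction V arbitrary: N rule: finite_induct)
  case (insert v V)
  let ?k = "card V" and ?c = "\<lambda>s. c s * (\<Prod>v\<in>V. \<theta> s - v)"
  let ?f = "\<Sum>s\<in>S. ?c s *\<^sub>k (g s * u ^ ?k)"
  have "N + D * card (insert v V) = N + D + D * ?k" using insert.hyps by simp
  then have kf: "kills (N + D) ?f" using insert.IH[of "N + D"] insert.prems by (simp add: add.assoc)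
  \<comment> \<open>Only the left factor \<open>u\<close> costs \<open>D\<close>; the term with
    \<open>u\<close> on the right is merely weakened to the same level.\<close>
  have "kills N (u * ?f - v *\<^sub>k (?f * u))"
    using kills_left[OF kf assms(2)] kills_right[OF kills_mono[OF kf], of N u]
    by (intro kills_diff kills_scale) auto
  moreover have "u * ?f - v *\<^sub>k (?f * u) \<doteq>
      (\<Sum>s\<in>S. (c s * (\<Prod>v\<in>insert v V. \<theta> s - v)) *\<^sub>k (g s * u ^ card (insert v V)))"
  proof -
    have "u * ?f - v *\<^sub>k (?f * u)
        = (\<Sum>s\<in>S. ?c s *\<^sub>k (u * g s * u ^ ?k) - (v * ?c s) *\<^sub>k (g s * u ^ Suc ?k))"
      by (simp add: sum_distrib_left sum_distrib_right scale_sum_right sum_subtractf mult.assoc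
          power_commutes)
    also have "\<dots> \<doteq> (\<Sum>s\<in>S. ?c s *\<^sub>k (\<theta> s *\<^sub>k (g s * u) * u ^ ?k) - (v * ?c s) *\<^sub>k (g s * u ^ Suc ?k))"
      using assms(3) by (intro eqv_sum eqv_diff eqv_scale eqv_mult eqv_refl) (simp add: qcom_def)
    also have "\<dots> = (\<Sum>s\<in>S. (c s * (\<Prod>v\<in>insert v V. \<theta> s - v)) *\<^sub>k (g s * u ^ card (insert v V)))"
    proof (intro sum.cong refl)
      fix s
      have "?c s *\<^sub>k (\<theta> s *\<^sub>k (g s * u) * u ^ ?k) - (v * ?c s) *\<^sub>k (g s * u ^ Suc ?k)
          = (?c s * \<theta> s - v * ?c s) *\<^sub>k (g s * u ^ Suc ?k)"
        by (simp only: scale_left_diff_distrib scale_scale mult_scale_left power_Suc mult.assoc)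
      also have "?c s * \<theta> s - v * ?c s = c s * (\<Prod>v\<in>insert v V. \<theta> s - v)"
        using insert.hyps by (simp add: algebra_simps)
      finally show "?c s *\<^sub>k (\<theta> s *\<^sub>k (g s * u) * u ^ ?k) - (v * ?c s) *\<^sub>k (g s * u ^ Suc ?k)
          = (c s * (\<Prod>v\<in>insert v V. \<theta> s - v)) *\<^sub>k (g s * u ^ card (insert v V))"
        using insert.hyps by simp
    qed
    finally show ?thesis .
  qed
  ultimately show ?case by (rule kills_eqv)
qed simp

text \<open>The other eigenvalues are removed one at a time, so the power of \<open>u\<close> left
  behind is their number, of which only the bound \<open>R\<close> is known; hence the existential
  \<open>r\<close>.\<close>

lemma kills_eigencomponent:
  assumes "finite S" "s0 \<in> S" "u \<in> F D" "\<And>s. s \<in> S \<Longrightarrow> qcom (\<theta> s) u (g s)"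
    and "card (\<theta> ` S) \<le> Suc R" and "kills (N + D * R) (\<Sum>s\<in>S. c s *\<^sub>k g s)"
  obtains r where "r \<le> R" "kills N (\<Sum>s\<in>{s \<in> S. \<theta> s = \<theta> s0}. c s *\<^sub>k (g s * u ^ r))"
proof -
  define V where "V = \<theta> ` S - {\<theta> s0}"
  have finV: "finite V" using assms(1) by (simp add: V_def)
  have "card V = card (\<theta> ` S) - 1" using assms(1,2) by (simp add: V_def)
  then have cV: "card V \<le> R" using assms(5) by simp
  have "kills (N + D * card V) (\<Sum>s\<in>S. c s *\<^sub>k g s)"
    using kills_mono[OF assms(6)] cV by simp
  from kills_eigen_factor[OF finV assms(3) assms(4) this]
  have k: "kills N (\<Sum>s\<in>S. (c s * (\<Prod>v\<in>V. \<theta> s - v)) *\<^sub>k (g s * u ^ card V))" .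
  let ?\<kappa> = "\<Prod>v\<in>V. \<theta> s0 - v"
  have "(\<Sum>s\<in>S. (c s * (\<Prod>v\<in>V. \<theta> s - v)) *\<^sub>k (g s * u ^ card V))
      = (\<Sum>s\<in>{s \<in> S. \<theta> s = \<theta> s0}. (c s * (\<Prod>v\<in>V. \<theta> s - v)) *\<^sub>k (g s * u ^ card V))"
  proof (intro sum.mono_neutral_right ballI)
    fix s assume "s \<in> S - {s \<in> S. \<theta> s = \<theta> s0}"
    then have "\<theta> s \<in> V" by (auto simp: V_def)
    then have "(\<Prod>v\<in>V. \<theta> s - v) = 0" using finV by (auto simp: prod_zero_iff)
    then show "(c s * (\<Prod>v\<in>V. \<theta> s - v)) *\<^sub>k (g s * u ^ card V) = 0" by simp
  qed (use assms(1) in auto)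
  also have "\<dots> = ?\<kappa> *\<^sub>k (\<Sum>s\<in>{s \<in> S. \<theta> s = \<theta> s0}. c s *\<^sub>k (g s * u ^ card V))"
    by (simp add: scale_sum_right mult.commute)
  finally have "kills N (?\<kappa> *\<^sub>k (\<Sum>s\<in>{s \<in> S. \<theta> s = \<theta> s0}. c s *\<^sub>k (g s * u ^ card V)))"
    using k by simp
  moreover have "?\<kappa> \<noteq> 0" using finV by (auto simp: prod_zero_iff V_def)
  ultimately show ?thesis using that[OF cV] kills_scaleD by blast
qed

text \<open>The values of \<open>\<theta> i\<close> are counted only where the earlier eigenvalues
  already agree with those of \<open>s0\<close>. In the application this keeps each count linear in
  \<open>k\<close>, whereas on all of \<open>S\<close> it could grow with every index.\<close>

lemma kills_joint_eigencomponent: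
  assumes "finite S" "s0 \<in> S"
    and "\<And>i. i < r \<Longrightarrow> u i \<in> F D"
    and "\<And>i s. i < r \<Longrightarrow> s \<in> S \<Longrightarrow> qcom (\<theta> i s) (u i) (g s)"
    and "\<And>i j. i < r \<Longrightarrow> j < r \<Longrightarrow> qcommute (u i) (u j)"
    and "\<And>i. i < r \<Longrightarrow> card (\<theta> i ` {s \<in> S. \<forall>j<i. \<theta> j s = \<theta> j s0}) \<le> Suc R"
    and "kills (N + D * R * r) (\<Sum>s\<in>S. c s *\<^sub>k g s)"
  obtains vs where "set vs \<subseteq> u ` {..<r}" "length vs \<le> R * r"
    "kills N (\<Sum>s\<in>{s \<in> S. \<forall>j<r. \<theta> j s = \<theta> j s0}. c s *\<^sub>k (g s * prod_list vs))"
  using assms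
proof (induction r arbitrary: N thesis)
  case 0
  then show ?case by (auto intro: "0.prems"(1)[of "[]"])
next
  case (Suc r)
  let ?S = "{s \<in> S. \<forall>j<r. \<theta> j s = \<theta> j s0}"
  have "kills (N + D * R + D * R * r) (\<Sum>s\<in>S. c s *\<^sub>k g s)"
    using Suc.prems(8) by (simp add: algebra_simps)
  note k = this
  obtain vs where vs: "set vs \<subseteq> u ` {..<r}" "length vs \<le> R * r"
    "kills (N + D * R) (\<Sum>s\<in>?S. c s *\<^sub>k (g s * prod_list vs))"
  proof (rule Suc.IH[OF _ Suc.prems(2,3) _ _ _ _ k])
    show "u i \<in> F D" if "i < r" for i using Suc.prems(4)[of i] that by simp
    show "qcom (\<theta> i s) (u i) (g s)" if "i < r" "s \<in> S" for i s
      using Suc.prems(5)[of i s] that by simp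
    show "qcommute (u i) (u j)" if "i < r" "j < r" for i j using Suc.prems(6)[of i j] that by simp
    show "card (\<theta> i ` {s \<in> S. \<forall>j<i. \<theta> j s = \<theta> j s0}) \<le> Suc R" if "i < r" for i
      using Suc.prems(7)[of i] that by simp
  qed
  have "qcommute (u r) (prod_list vs)"
    using vs(1) Suc.prems(6) by (intro qcommute_prod_list) auto
  then obtain \<mu> where \<mu>: "\<mu> \<noteq> 0" "qcom \<mu> (u r) (prod_list vs)" by (auto simp: qcommute_def)
  \<comment> \<open>The factors left behind by the earlier steps multiply all eigenvalues by the
    same nonzero \<mu>, so these separate exactly as before.\<close>
  define \<theta>' where "\<theta>' s = \<theta> r s * \<mu>" for s
  have "card (\<theta>' ` ?S) = card ((\<lambda>t. t * \<mu>) ` \<theta> r ` ?S)"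
    by (simp add: image_image \<theta>'_def)
  also have "\<dots> \<le> card (\<theta> r ` ?S)" using Suc.prems(2) by (intro card_image_le) auto
  also have "\<dots> \<le> Suc R" using Suc.prems(7)[of r] by simp
  finally have "card (\<theta>' ` ?S) \<le> Suc R" .
  moreover have "qcom (\<theta>' s) (u r) (g s * prod_list vs)" if "s \<in> ?S" for s
    unfolding \<theta>'_def using Suc.prems(5)[of r s] that \<mu>(2) by (intro qcom_mult) auto
  moreover have "finite ?S" "s0 \<in> ?S" "u r \<in> F D" using Suc.prems(2-4) by auto
  ultimately obtain r' where r': "r' \<le> R"
    "kills N (\<Sum>s\<in>{s \<in> ?S. \<theta>' s = \<theta>' s0}. c s *\<^sub>k (g s * prod_list vs * u r ^ r'))"
    using kills_eigencomponent[of ?S s0 "u r" D \<theta>' "\<lambda>s. g s * prod_list vs" R N c] vs(3)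
    by blast
  have "{s \<in> ?S. \<theta>' s = \<theta>' s0} = {s \<in> S. \<forall>j<Suc r. \<theta> j s = \<theta> j s0}"
    using \<mu>(1) by (auto simp: \<theta>'_def less_Suc_eq)
  with r' have "kills N (\<Sum>s\<in>{s \<in> S. \<forall>j<Suc r. \<theta> j s = \<theta> j s0}.
      c s *\<^sub>k (g s * prod_list (vs @ replicate r' (u r))))"
    by (simp add: mult.assoc)
  moreover have "set (vs @ replicate r' (u r)) \<subseteq> u ` {..<Suc r}"
    using vs(1) by (auto simp: set_replicate_conv_if split: if_splits)
  moreover have "length (vs @ replicate r' (u r)) \<le> R * Suc r"
    using vs(2) r'(1) by simp
  ultimately show ?case by (rule Suc.prems(1)[rotated 2])
qed

section \<open>Commutators with the \<open>y i\<close>: trading \<open>x i\<close> for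
  \<open>z i\<close>\<close>

lemma x_power_y:
  assumes i: "i \<in> {1..n}"
  shows "x i ^ Suc c * y i \<doteq> y i * x i ^ Suc c + (\<Sum>k\<le>c. q i ^ k) *\<^sub>k (z i * x i ^ c)"
proof (induction c)
  case 0
  then show ?case using x_y_z[OF i] by simp
next
  case (Suc c)
  let ?\<kappa> = "\<Sum>k\<le>c. q i ^ k"
  have xz: "x i * z i \<doteq> q i *\<^sub>k (z i * x i)" using qcom_x_z[OF i, of i] i by (simp add: qcom_def)
  have "x i * (x i ^ Suc c * y i) \<doteq> x i * (y i * x i ^ Suc c + ?\<kappa> *\<^sub>k (z i * x i ^ c))"
    by (intro eqv_mult eqv_refl Suc.IH)
  then have "x i ^ Suc (Suc c) * y i \<doteq> (x i * y i) * x i ^ Suc c + ?\<kappa> *\<^sub>k ((x i * z i) * x i ^ c)"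
    by (simp add: distrib_left mult.assoc)
  also have "\<dots> \<doteq> (y i * x i + z i) * x i ^ Suc c + ?\<kappa> *\<^sub>k ((q i *\<^sub>k (z i * x i)) * x i ^ c)"
    by (intro eqv_add eqv_scale eqv_mult eqv_refl x_y_z[OF i] xz)
  also have "\<dots> = y i * x i ^ Suc (Suc c) + (1 + q i * ?\<kappa>) *\<^sub>k (z i * x i ^ Suc c)"
    by (simp add: distrib_right mult.assoc scale_left_distrib mult.commute add.assoc)
  also have "1 + q i * ?\<kappa> = (\<Sum>k\<le>Suc c. q i ^ k)"
    by (simp add: sum.atMost_Suc_shift sum_distrib_left del: sum.atMost_Suc)
  finally show ?case .
qed

text \<open>\<open>1 - q i\<close> times the sum is \<open>1 - q i ^ Suc c\<close>. The sum is the
  coefficient in the q-derivative of \<open>x i ^ Suc c\<close>, which has to be inverted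
  below.\<close>

lemma geometric_q_nonzero:
  assumes "i \<in> {1..n}"
  shows "(\<Sum>k\<le>c. q i ^ k) \<noteq> 0"
proof
  assume "(\<Sum>k\<le>c. q i ^ k) = 0"
  then have "1 - q i ^ Suc c = 0"
    using one_diff_power_eq[of "q i" "Suc c"] by (simp add: lessThan_Suc_atMost)
  then show False using q_not_root[OF assms, of "Suc c"] by simp
qed

text \<open>The commutator with \<open>y i\<close> acts on powers of \<open>x i\<close> like a
  q-derivative that releases a \<open>z i\<close>. Each application costs one unit of level; the
  released \<open>z i\<close> is moved behind \<open>g\<close>, so that the induction hypothesis
  applies to \<open>g * z i\<close>.\<close>

lemma kills_x_power:
  assumes i: "i \<in> {1..n}" and "qcommute (y i) g" "qcommute (z i) g"
    and "kills (N + c) (x i ^ c * g)"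
  shows "kills N (g * z i ^ c)"
  using assms(2-)
proof (induction c arbitrary: N g)
  case (Suc c)
  let ?\<kappa> = "\<Sum>k\<le>c. q i ^ k"
  obtain \<mu> where \<mu>: "qcom \<mu> (y i) g" using Suc.prems(1) by (auto simp: qcommute_def)
  have "qcommute (x i ^ c * g) (z i)"
    using i Suc.prems(2)
    by (intro qcommute_mult_left qcommute_sym[OF qcommute_power[OF qcommute_sym[OF qcommute_x_z]]]
        qcommute_sym[of "z i" g]) auto
  then obtain \<nu> where \<nu>: "\<nu> \<noteq> 0" "qcom \<nu> (x i ^ c * g) (z i)" by (auto simp: qcommute_def)
  let ?f = "x i ^ Suc c * g"
  have kf: "kills (N + c + 1) ?f" using Suc.prems(3) by simp
  \<comment> \<open>The factor \<mu> undoes the one that arises when \<open>y i\<close> passes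
    \<open>g\<close>, so only the commutator of \<open>x i ^ Suc c\<close> and \<open>y i\<close>
    remains.\<close>
  have "kills (N + c) (\<mu> *\<^sub>k (?f * y i) - y i * ?f)"
    using kills_left[OF kf y_in_F[OF i]] kills_right[OF kills_mono[OF kf], of "N + c" "y i"]
    by (intro kills_diff kills_scale) auto
  moreover have "\<mu> *\<^sub>k (?f * y i) - y i * ?f \<doteq> ?\<kappa> *\<^sub>k (z i * (x i ^ c * g))"
  proof -
    have "\<mu> *\<^sub>k (?f * y i) - y i * ?f = x i ^ Suc c * (\<mu> *\<^sub>k (g * y i)) - y i * ?f"
      by (simp add: mult.assoc)
    also have "\<dots> \<doteq> x i ^ Suc c * (y i * g) - y i * ?f"
      using \<mu> by (intro eqv_diff eqv_mult eqv_refl) (simp add: qcom_def eqv_sym)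
    also have "\<dots> = (x i ^ Suc c * y i) * g - y i * ?f" by (simp add: mult.assoc)
    also have "\<dots> \<doteq> (y i * x i ^ Suc c + ?\<kappa> *\<^sub>k (z i * x i ^ c)) * g - y i * ?f"
      by (intro eqv_diff eqv_mult eqv_refl x_power_y[OF i])
    also have "\<dots> = ?\<kappa> *\<^sub>k (z i * (x i ^ c * g))" by (simp add: distrib_right mult.assoc)
    finally show ?thesis .
  qed
  ultimately have "kills (N + c) (?\<kappa> *\<^sub>k (z i * (x i ^ c * g)))" by (rule kills_eqv)
  then have "kills (N + c) (z i * (x i ^ c * g))"
    using geometric_q_nonzero[OF i] by (rule kills_scaleD)
  then have "kills (N + c) (\<nu> *\<^sub>k (z i * (x i ^ c * g)))" by (rule kills_scale)
  then have "kills (N + c) ((x i ^ c * g) * z i)"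
    using \<nu>(2) by (auto simp: qcom_def intro: kills_eqv eqv_sym)
  then have "kills (N + c) (x i ^ c * (g * z i))" by (simp add: mult.assoc)
  then have "kills N ((g * z i) * z i ^ c)"
    using Suc.prems i by (intro Suc.IH qcommute_mult qcommute_y_z qcommute_z_z) auto
  then show ?case by (simp add: mult.assoc)
qed simp

text \<open>A level equal to the total degree in the \<open>x i\<close> suffices to trade every
  \<open>x i\<close> for a \<open>z i\<close>. What is left is, up to a nonzero scalar, some
  \<open>Z b'\<close>, and this is not in \<open>L\<close>.\<close>

lemma not_kills_mon:
  assumes "\<And>i. i \<in> {1..n} \<Longrightarrow> 0 \<le> d i"
  shows "\<not> kills (\<Sum>i\<in>{1..n}. nat (d i)) (mon (d, b))"
proof -
  \<comment> \<open>Stated for a list of distinct indices so that the leading factor can be stripped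
    off; \<open>b\<close> varies because it collects the released \<open>z i\<close>.\<close>
  have "\<not> kills (\<Sum>i\<leftarrow>is. nat (d i)) ((\<Prod>i\<leftarrow>is. w i (d i)) * Z b)"
    if "distinct is" "set is \<subseteq> {1..n}" for "is"
    using that
  proof (induction "is" arbitrary: b)
    case (Cons i "is")
    then have i: "i \<in> {1..n}" by auto
    let ?g = "(\<Prod>i\<leftarrow>is. w i (d i)) * Z b"
    show ?case
    proof
      assume "kills (\<Sum>i\<leftarrow>i # is. nat (d i)) ((\<Prod>i\<leftarrow>i # is. w i (d i)) * Z b)"
      then have "kills ((\<Sum>i\<leftarrow>is. nat (d i)) + nat (d i)) (x i ^ nat (d i) * ?g)"
        using assms i by (simp add: w_def mult.assoc add.commute)
      moreover have "qcommute (y i) ?g"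
        using Cons.prems i
        by (intro qcommute_mult qcommute_prod_list qcommute_Z)
          (auto intro!: qcommute_y_z qcommute_sym[OF qcommute_w_y])
      moreover have "qcommute (z i) ?g"
        using Cons.prems i
        by (intro qcommute_mult qcommute_prod_list qcommute_Z)
          (auto intro!: qcommute_z_z qcommute_sym[OF qcommute_w_z])
      ultimately have k: "kills (\<Sum>i\<leftarrow>is. nat (d i)) (?g * z i ^ nat (d i))"
        using kills_x_power[OF i] by blast
      let ?b = "b(i := b i + nat (d i))"
      obtain c where c: "c \<noteq> 0" "Z b * z i ^ nat (d i) \<doteq> c *\<^sub>k Z ?b"
        using Z_mult_z_power[OF i] by blast
      have "(\<Prod>i\<leftarrow>is. w i (d i)) * (Z b * z i ^ nat (d i)) \<doteq> (\<Prod>i\<leftarrow>is. w i (d i)) * (c *\<^sub>k Z ?b)"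
        by (intro eqv_mult eqv_refl c(2))
      then have "?g * z i ^ nat (d i) \<doteq> c *\<^sub>k ((\<Prod>i\<leftarrow>is. w i (d i)) * Z ?b)"
        by (simp add: mult.assoc)
      from kills_scaleD[OF kills_eqv[OF k this] c(1)] show False
        using Cons by auto
    qed
  qed (simp add: not_kills_Z)
  from this[of "[1..<Suc n]", OF distinct_upt]
  have "\<not> kills (\<Sum>i\<leftarrow>[1..<Suc n]. nat (d i)) (mon (d, b))"
    unfolding mon_def W_def fst_conv snd_conv set_indices by blast
  then show ?thesis
    by (simp only: sum_list_distinct_conv_sum_set distinct_upt set_indices simp_thms)
qed

section \<open>Separating the exponents of the monomials by weights\<close>

definition pos_box :: "nat \<Rightarrow> ((nat \<Rightarrow> int) \<times> (nat \<Rightarrow> nat)) set" where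
  "pos_box k = (PiE {1..n} (\<lambda>_. {0..int k})) \<times> (PiE {1..n} (\<lambda>_. {0..k}))"

lemma pos_box_fst: "s \<in> pos_box k \<Longrightarrow> j \<in> {1..n} \<Longrightarrow> fst s j \<in> {0..int k}"
  by (auto simp: pos_box_def dest: PiE_mem)

lemma finite_pos_box: "finite (pos_box k)"
  unfolding pos_box_def by (intro finite_cartesian_product finite_PiE) auto

lemma card_pos_box: "card (pos_box k) = (k + 1) ^ (2 * n)"
proof -
  have "nat (int k + 1) = k + 1" by simp
  then show ?thesis
    by (simp add: pos_box_def card_cartesian_product card_PiE mult_2 power_add)
qed

text \<open>The constant 3: in each of the \<open>n\<close> slots, \<open>x i\<close> has degree 1
  and \<open>z i\<close> degree 2.\<close>

lemma mon_in_F: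
  assumes "s \<in> pos_box k"
  shows "mon s \<in> F (3 * n * k)"
proof -
  have "w i (fst s i) \<in> F k" if "i \<in> {1..n}" for i
  proof -
    have "0 \<le> fst s i" "nat (fst s i) \<le> k" using pos_box_fst[OF assms that] by auto
    then show ?thesis
      using F_power[OF x_in_F[OF that], of "nat (fst s i)"] F_mono[of "nat (fst s i)" k]
      by (auto simp: w_def)
  qed
  then have "W (fst s) \<in> F (k * n)"
    unfolding W_def using F_prod_list[of "[1..<Suc n]" "\<lambda>i. w i (fst s i)" k] by (simp del: upt_Suc)
  moreover have "z i ^ snd s i \<in> F (2 * k)" if "i \<in> {1..n}" for i
  proof -
    have "snd s i \<le> k" using assms that by (auto simp: pos_box_def)
    then show ?thesis
      using F_power[OF z_in_F, of i "snd s i"] F_mono[of "2 * snd s i" "2 * k"] that by auto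
  qed
  then have "Z (snd s) \<in> F (2 * k * n)"
    unfolding Z_def using F_prod_list[of "[1..<Suc n]" "\<lambda>i. z i ^ snd s i" "2 * k"]
    by (simp del: upt_Suc)
  ultimately have "mon s \<in> F (k * n + 2 * k * n)" unfolding mon_def by (rule F_mult)
  then show ?thesis by (simp add: algebra_simps)
qed

lemma q_power_inj:
  assumes i: "i \<in> {1..n}" and "q i ^ a = q i ^ b"
  shows "a = b"
  using assms(2)
proof (induction a b rule: linorder_wlog)
  case (le a b)
  have "q i ^ a * q i ^ (b - a) = q i ^ b" using le(1) by (simp flip: power_add)
  then have "q i ^ (b - a) = 1" using q_nonzero[OF i] le(2) by simp
  then show ?case using q_not_root[OF i, of "b - a"] le by (cases "b = a") auto
qed simp

text \<open>The scalar by which \<open>z i\<close> passes the \<open>x\<close>-part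
  \<open>W d\<close> for nonnegative \<open>d\<close>: only the \<open>x j\<close> with
  \<open>j \<le> i\<close> contribute, and no \<gamma> enters.\<close>

definition z_weight :: "nat \<Rightarrow> (nat \<Rightarrow> int) \<Rightarrow> 'k" where
  "z_weight i d = (\<Prod>j\<in>{1..i}. inverse (q j) ^ nat (d j))"

lemma prod_list_indices: "(\<Prod>i\<leftarrow>[1..<Suc n]. f i) = (\<Prod>i\<in>{1..n}. f i :: 'k)"
  using prod.distinct_set_conv_list[of "[1..<Suc n]" f, OF distinct_upt]
  unfolding set_indices by (rule sym)

lemma qcom_z_W:
  assumes i: "i \<in> {1..n}" and d: "\<And>j. j \<in> {1..n} \<Longrightarrow> 0 \<le> d j"
  shows "qcom (z_weight i d) (z i) (W d)"
proof -
  define c where "c j = (if j \<le> i then inverse (q j) else 1) ^ nat (d j)" for j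
  have "qcom (c j) (z i) (w j (d j))" if j: "j \<in> {1..n}" for j
  proof -
    have "qcom (inverse (if j \<le> i then q j else 1)) (z i) (x j)"
      using i j q_nonzero by (intro qcom_sym qcom_x_z) auto
    from qcom_power[OF this] show ?thesis
      using d[OF j] by (auto simp: w_def c_def)
  qed
  then have "qcom (\<Prod>j\<leftarrow>[1..<Suc n]. c j) (z i) (W d)"
    unfolding W_def by (intro qcom_prod_list) (simp del: upt_Suc)
  moreover have "(\<Prod>j\<in>{1..n}. c j) = z_weight i d"
    unfolding z_weight_def using i
    by (intro prod.mono_neutral_cong_right) (auto simp: c_def)
  ultimately show ?thesis unfolding prod_list_indices by simp
qed

lemma qcom_z_mon:
  assumes i: "i \<in> {1..n}" and "\<And>j. j \<in> {1..n} \<Longrightarrow> 0 \<le> fst s j"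
  shows "qcom (z_weight i (fst s)) (z i) (mon s)"
proof -
  have "qcom (\<Prod>j\<leftarrow>[1..<Suc n]. 1 ^ snd s j) (z i) (Z (snd s))"
    unfolding Z_def using i by (intro qcom_prod_list qcom_power qcom_z_z) auto
  then have "qcom 1 (z i) (Z (snd s))" unfolding prod_list_indices by simp
  from qcom_mult[OF qcom_z_W this] show ?thesis using assms by (simp add: mon_def)
qed

lemma z_weight_Suc: "z_weight (Suc i) d = z_weight i d * inverse (q (Suc i)) ^ nat (d (Suc i))"
  by (simp add: z_weight_def mult.commute)

lemma z_weight_nonzero: "i \<le> n \<Longrightarrow> z_weight i d \<noteq> 0"
  unfolding z_weight_def using q_nonzero by (auto simp: prod_zero_iff)

text \<open>The weights are triangular: consecutive ones differ by a power of
  \<open>inverse (q (Suc i))\<close>, which determines the next exponent because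
  \<open>q (Suc i)\<close> is not a root of unity.\<close>

lemma z_weight_eqD:
  assumes "\<And>j. j < i \<Longrightarrow> z_weight (Suc j) d = z_weight (Suc j) d'" "i \<le> n"
    and "\<And>j. j \<in> {1..n} \<Longrightarrow> 0 \<le> d j" "\<And>j. j \<in> {1..n} \<Longrightarrow> 0 \<le> d' j" "j \<in> {1..i}"
  shows "d j = d' j"
  using assms(1,2,5)
proof (induction i arbitrary: j)
  case (Suc i)
  have eq: "d l = d' l" if "l \<in> {1..i}" for l using Suc that by auto
  show ?case
  proof (cases "j = Suc i")
    case True
    have "z_weight i d = z_weight i d'" unfolding z_weight_def using eq by (intro prod.cong) auto
    then have "inverse (q j) ^ nat (d j) = inverse (q j) ^ nat (d' j)"
      using Suc.prems(1)[of i] z_weight_nonzero[of i d'] Suc.prems(2) True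
      by (simp add: z_weight_Suc)
    then have "q j ^ nat (d j) = q j ^ nat (d' j)" by (simp add: power_inverse)
    then have "nat (d j) = nat (d' j)" using q_power_inj[of j] Suc.prems by auto
    then show ?thesis using assms(3)[of j] assms(4)[of j] Suc.prems True by auto
  next
    case False
    then show ?thesis using eq Suc.prems by auto
  qed
qed simp

text \<open>Modulo \<open>I\<close> these satisfy relations of a quantum affine space, in which
  right multiplication by a letter preserves monomials up to nonzero scalars.\<close>

definition letters :: "'r set" where
  "letters = x ` {1..n} \<union> z ` {1..n}"

lemma qcommute_letters: "u \<in> letters \<Longrightarrow> v \<in> letters \<Longrightarrow> qcommute u v"
  unfolding letters_def
  using qcommute_x_x qcommute_x_z qcommute_z_z qcommute_sym[OF qcommute_x_z] by auto

text \<open>Only the degree in the \<open>x i\<close> is controlled, because it is what the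
  commutators with the \<open>y i\<close> will have to remove; since no \<open>Z b'\<close> lies in
  \<open>L\<close>, the exponents \<open>b'\<close> may be arbitrary.\<close>

lemma mon_mult_letters:
  assumes "set vs \<subseteq> letters" "\<And>i. i \<in> {1..n} \<Longrightarrow> 0 \<le> d i"
  shows "\<exists>c d' b'. c \<noteq> 0 \<and> mon (d, b) * prod_list vs \<doteq> c *\<^sub>k mon (d', b')
    \<and> (\<forall>i\<in>{1..n}. 0 \<le> d' i) \<and> (\<Sum>i\<in>{1..n}. nat (d' i)) \<le> (\<Sum>i\<in>{1..n}. nat (d i)) + length vs"
  using assms
proof (induction vs arbitrary: d b)
  case Nil
  then show ?case by (intro exI[of _ 1] exI[of _ d] exI[of _ b]) auto
next
  case (Cons v vs)
  have "\<exists>c d' b'. c \<noteq> 0 \<and> mon (d, b) * v \<doteq> c *\<^sub>k mon (d', b')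
    \<and> (\<forall>i\<in>{1..n}. 0 \<le> d' i) \<and> (\<Sum>i\<in>{1..n}. nat (d' i)) \<le> (\<Sum>i\<in>{1..n}. nat (d i)) + 1"
  proof -
    from Cons.prems(1) consider j where "j \<in> {1..n}" "v = x j" | j where "j \<in> {1..n}" "v = z j"
      by (auto simp: letters_def)
    then show ?thesis
    proof cases
      case 1
      let ?d = "d(j := d j + 1)"
      obtain e where e: "e \<noteq> 0" "qcom e (Z b) (x j)"
        using qcommute_sym[OF qcommute_Z[of "x j" b]] qcommute_x_z 1 by (auto simp: qcommute_def)
      obtain c where c: "c \<noteq> 0" "W d * x j \<doteq> c *\<^sub>k W ?d"
        using W_mult_x[of j d] Cons.prems(2)[of j] 1 by auto
      have "mon (d, b) * v = W d * (Z b * x j)" using 1 by (simp add: mon_def mult.assoc)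
      also have "\<dots> \<doteq> W d * (e *\<^sub>k (x j * Z b))"
        using e by (intro eqv_mult eqv_refl) (simp add: qcom_def)
      finally have "mon (d, b) * v \<doteq> e *\<^sub>k (W d * x j * Z b)" by (simp add: mult.assoc)
      also have "\<dots> \<doteq> e *\<^sub>k ((c *\<^sub>k W ?d) * Z b)" by (intro eqv_scale eqv_mult eqv_refl c)
      finally have "mon (d, b) * v \<doteq> (e * c) *\<^sub>k mon (?d, b)" by (simp add: mon_def)
      moreover have "(\<Sum>i\<in>{1..n}. nat (?d i)) = (\<Sum>i\<in>{1..n}. nat (d i)) + 1"
      proof -
        have "(\<Sum>i\<in>{1..n} - {j}. nat (?d i)) = (\<Sum>i\<in>{1..n} - {j}. nat (d i))"
          by (intro sum.cong) auto
        then show ?thesis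
          using 1 Cons.prems(2)[of j] sum.remove[of "{1..n}" j "\<lambda>i. nat (?d i)"]
            sum.remove[of "{1..n}" j "\<lambda>i. nat (d i)"]
          by (simp add: nat_add_distrib)
      qed
      moreover have "\<forall>i\<in>{1..n}. 0 \<le> ?d i"
        using Cons.prems(2) by (metis add_nonneg_nonneg fun_upd_apply zero_le_one)
      ultimately show ?thesis using e(1) c(1)
        by (intro exI[of _ "e * c"] exI[of _ ?d] exI[of _ b]) auto
    next
      case 2
      obtain c where c: "c \<noteq> 0" "Z b * z j ^ 1 \<doteq> c *\<^sub>k Z (b(j := b j + 1))"
        using Z_mult_z_power[of j b 1] 2 by blast
      have "W d * (Z b * z j ^ 1) \<doteq> W d * (c *\<^sub>k Z (b(j := b j + 1)))"
        by (intro eqv_mult eqv_refl c)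
      then have "mon (d, b) * v \<doteq> c *\<^sub>k mon (d, b(j := b j + 1))"
        using 2 by (simp add: mon_def mult.assoc)
      then show ?thesis using c(1) Cons.prems(2)
        by (intro exI[of _ c] exI[of _ d] exI[of _ "b(j := b j + 1)"]) auto
    qed
  qed
  then obtain c d' b' where 1: "c \<noteq> 0" "mon (d, b) * v \<doteq> c *\<^sub>k mon (d', b')"
    "\<And>i. i \<in> {1..n} \<Longrightarrow> 0 \<le> d' i"
    "(\<Sum>i\<in>{1..n}. nat (d' i)) \<le> (\<Sum>i\<in>{1..n}. nat (d i)) + 1"
    by blast
  obtain c' d'' b'' where 2: "c' \<noteq> 0" "mon (d', b') * prod_list vs \<doteq> c' *\<^sub>k mon (d'', b'')"
    "\<forall>i\<in>{1..n}. 0 \<le> d'' i"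
    "(\<Sum>i\<in>{1..n}. nat (d'' i)) \<le> (\<Sum>i\<in>{1..n}. nat (d' i)) + length vs"
    using Cons.IH[of d' b'] Cons.prems(1) 1(3) by auto
  have "mon (d, b) * prod_list (v # vs) = (mon (d, b) * v) * prod_list vs" by (simp add: mult.assoc)
  also have "\<dots> \<doteq> (c *\<^sub>k mon (d', b')) * prod_list vs" by (intro eqv_mult eqv_refl 1)
  also have "\<dots> = c *\<^sub>k (mon (d', b') * prod_list vs)" by simp
  also have "\<dots> \<doteq> c *\<^sub>k (c' *\<^sub>k mon (d'', b''))" by (intro eqv_scale 2)
  finally have "mon (d, b) * prod_list (v # vs) \<doteq> (c * c') *\<^sub>k mon (d'', b'')" by simp
  moreover have "(\<Sum>i\<in>{1..n}. nat (d'' i)) \<le> (\<Sum>i\<in>{1..n}. nat (d i)) + length (v # vs)"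
    using 1(4) 2(4) by simp
  ultimately show ?case using 1(1) 2(1,3)
    by (intro exI[of _ "c * c'"] exI[of _ d''] exI[of _ b'']) auto
qed

lemma kills_mon_combination:
  assumes kills: "kills (6 * n\<^sup>2 * k) (\<Sum>s\<in>pos_box k. c s *\<^sub>k mon s)" and s0: "s0 \<in> pos_box k"
  shows "c s0 = 0"
proof (rule ccontr)
  assume c0: "c s0 \<noteq> 0"
  \<comment> \<open>Bounds the number of eigenvalues to be removed per index: at most
    \<open>k\<close> for a \<open>z i\<close>, and at most \<open>n * k\<close> for an
    \<open>x i\<close>, whose weights depend on sums of up to \<open>n\<close> exponents.\<close>
  define R where "R = n * k"
  \<comment> \<open>Bounds the final degree in the \<open>x i\<close>: at most \<open>n * k\<close>
    from \<open>d0\<close>, and at most \<open>R * n\<close> from each of the two lists of letters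
    left behind.\<close>
  define T where "T = n * k + (R * n + R * n)"
  obtain d0 b0 where s0_eq: "s0 = (d0, b0)" by (cases s0)
  have nonneg: "0 \<le> fst s j" if "s \<in> pos_box k" "j \<in> {1..n}" for s j
    using that by (auto simp: pos_box_def)
  have k_le_R: "k \<le> R" if "i < n" for i using that by (simp add: R_def)
  define S where "S = {s \<in> pos_box k. \<forall>j<n. z_weight (Suc j) (fst s) = z_weight (Suc j) d0}"
  have "n * k \<le> n * n * k" by (cases n) auto
  then have "T + 1 * R * n + 2 * R * n \<le> 6 * n\<^sup>2 * k"
    by (simp add: T_def R_def power2_eq_square algebra_simps)
  then have kf: "kills (T + 1 * R * n + 2 * R * n) (\<Sum>s\<in>pos_box k. c s *\<^sub>k mon s)"
    by (rule kills_mono[OF kills])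
  obtain vs where vs: "set vs \<subseteq> (\<lambda>i. z (Suc i)) ` {..<n}" "length vs \<le> R * n"
    "kills (T + 1 * R * n) (\<Sum>s\<in>S. c s *\<^sub>k (mon s * prod_list vs))"
  proof (rule kills_joint_eigencomponent[OF finite_pos_box s0 _ _ _ _ kf])
    show "z (Suc i) \<in> F 2" if "i < n" for i using z_in_F that by simp
    show "qcom (z_weight (Suc i) (fst s)) (z (Suc i)) (mon s)" if "i < n" "s \<in> pos_box k" for i s
      using that nonneg by (intro qcom_z_mon) auto
    show "qcommute (z (Suc i)) (z (Suc j))" if "i < n" "j < n" for i j
      using that by (intro qcommute_z_z) auto
    show "card ((\<lambda>s. z_weight (Suc i) (fst s)) `
        {s \<in> pos_box k. \<forall>j<i. z_weight (Suc j) (fst s) = z_weight (Suc j) (fst s0)}) \<le> Suc R"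
      (is "card (_ ` ?S) \<le> _") if i: "i < n" for i
    proof -
      \<comment> \<open>Agreement of the first \<open>i\<close> weights fixes the first
        \<open>i\<close> exponents, so the next weight varies only with
        \<open>fst s (Suc i)\<close>, which has \<open>k + 1\<close> possible values.\<close>
      have "(\<lambda>s. z_weight (Suc i) (fst s)) ` ?S
          \<subseteq> (\<lambda>t. z_weight i d0 * inverse (q (Suc i)) ^ t) ` {0..k}"
      proof (intro image_subsetI)
        fix s assume s: "s \<in> ?S"
        then have "fst s j = d0 j" if "j \<in> {1..i}" for j
          using i that nonneg[OF s0] nonneg[of s] s0_eq by (intro z_weight_eqD[of i]) auto
        then have "z_weight i (fst s) = z_weight i d0"
          unfolding z_weight_def by (intro prod.cong) auto
        moreover have "nat (fst s (Suc i)) \<in> {0..k}" using pos_box_fst[of s k "Suc i"] s i by auto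
        ultimately show "z_weight (Suc i) (fst s)
            \<in> (\<lambda>t. z_weight i d0 * inverse (q (Suc i)) ^ t) ` {0..k}"
          unfolding z_weight_Suc by auto
      qed
      then have "card ((\<lambda>s. z_weight (Suc i) (fst s)) ` ?S) \<le> card {0..k}"
        by (meson card_image_le card_mono finite_atLeastAtMost finite_imageI le_trans)
      then show ?thesis using k_le_R[OF i] by simp
    qed
  qed (auto simp: S_def s0_eq)
  \<comment> \<open>Outside the index range both functions are \<open>undefined\<close>, so they
    agree everywhere and not only on \<open>{1..n}\<close>.\<close>
  have S_fst: "fst s = d0" if "s \<in> S" for s
  proof
    fix j
    show "fst s j = d0 j"
    proof (cases "j \<in> {1..n}")
      case True
      then show ?thesis
        using that nonneg[OF s0] nonneg[of s] s0_eq by (intro z_weight_eqD[of n]) (auto simp: S_def)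
    next
      case False
      then show ?thesis using that s0 by (auto simp: S_def s0_eq pos_box_def PiE_def extensional_def)
    qed
  qed
  have vs_letters: "set vs \<subseteq> letters"
    using vs(1) by (auto simp: letters_def)
  \<comment> \<open>These factors involve \<gamma> and are never computed: only \<open>d0\<close> is
    left, so one \<mu> per \<open>j\<close> serves all of \<open>S\<close>.\<close>
  have "\<exists>\<mu>. \<mu> \<noteq> 0 \<and> qcom \<mu> (x j) (W d0)" if "j \<in> {1..n}" for j
  proof -
    have "qcommute (x j) (W d0)"
      unfolding W_def
    proof (intro qcommute_prod_list)
      fix v assume "v \<in> set (map (\<lambda>i. w i (d0 i)) [1..<Suc n])"
      then obtain i where "i \<in> {1..n}" "v = w i (d0 i)" by (auto simp only: set_map set_indices)
      then show "qcommute (x j) v"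
        using nonneg[OF s0] s0_eq that by (auto simp: w_def intro!: qcommute_power qcommute_x_x)
    qed
    then show ?thesis by (simp add: qcommute_def)
  qed
  then obtain \<mu> where \<mu>: "\<And>j. j \<in> {1..n} \<Longrightarrow> \<mu> j \<noteq> 0 \<and> qcom (\<mu> j) (x j) (W d0)" by metis
  have "\<exists>\<nu>. \<nu> \<noteq> 0 \<and> qcom \<nu> (x j) (prod_list vs)" if "j \<in> {1..n}" for j
  proof -
    have "x j \<in> letters" using that by (simp add: letters_def)
    then have "qcommute (x j) (prod_list vs)"
      using vs_letters by (intro qcommute_prod_list qcommute_letters) auto
    then show ?thesis by (simp add: qcommute_def)
  qed
  then obtain \<nu> where \<nu>: "\<And>j. j \<in> {1..n} \<Longrightarrow> \<nu> j \<noteq> 0 \<and> qcom (\<nu> j) (x j) (prod_list vs)" by metis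
  \<comment> \<open>Passing \<open>x j\<close> through \<open>Z b\<close> picks up
    \<open>q j\<close> from every factor \<open>z l\<close> with \<open>l \<ge> j\<close>, so the
    eigenvalues reveal tail sums of \<open>b\<close>.\<close>
  define \<sigma> where "\<sigma> j s = (\<Sum>l\<in>{j..n}. snd s l)" for j and s :: "(nat \<Rightarrow> int) \<times> (nat \<Rightarrow> nat)"
  define \<theta> where "\<theta> i s = \<mu> (Suc i) * q (Suc i) ^ \<sigma> (Suc i) s * \<nu> (Suc i)" for i s
  have qcom_x_Z: "qcom (q j ^ \<sigma> j s) (x j) (Z (snd s))" if j: "j \<in> {1..n}" for j s
  proof -
    have "qcom (\<Prod>i\<leftarrow>[1..<Suc n]. (if j \<le> i then q j else 1) ^ snd s i) (x j) (Z (snd s))"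
      unfolding Z_def using j by (intro qcom_prod_list qcom_power qcom_x_z) auto
    moreover have "(\<Prod>i\<in>{1..n}. (if j \<le> i then q j else 1) ^ snd s i) = (\<Prod>i\<in>{j..n}. q j ^ snd s i)"
      using j by (intro prod.mono_neutral_cong_right) auto
    ultimately show ?thesis unfolding prod_list_indices by (simp add: \<sigma>_def power_sum)
  qed
  have finS: "finite S" by (simp add: S_def finite_pos_box)
  have s0S: "s0 \<in> S" using s0 by (simp add: S_def s0_eq)
  have sum_le: "\<sigma> j s \<le> R" if "s \<in> S" "j \<in> {1..n}" for s j
  proof -
    have "\<sigma> j s \<le> (\<Sum>l\<in>{j..n}. k)"
      unfolding \<sigma>_def using that by (intro sum_mono) (auto simp: S_def pos_box_def)
    also have "\<dots> = (Suc n - j) * k" by simp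
    also have "\<dots> \<le> n * k" using that by (intro mult_right_mono) auto
    finally show ?thesis by (simp add: R_def)
  qed
  obtain us where us: "set us \<subseteq> (\<lambda>i. x (Suc i)) ` {..<n}" "length us \<le> R * n"
    "kills T (\<Sum>s\<in>{s \<in> S. \<forall>j<n. \<theta> j s = \<theta> j s0}. c s *\<^sub>k (mon s * prod_list vs * prod_list us))"
  proof (rule kills_joint_eigencomponent[OF finS s0S _ _ _ _ vs(3)])
    show "x (Suc i) \<in> F 1" if "i < n" for i using that by (intro x_in_F) auto
    show "qcom (\<theta> i s) (x (Suc i)) (mon s * prod_list vs)" if "i < n" "s \<in> S" for i s
      unfolding \<theta>_def mon_def using \<mu>[of "Suc i"] \<nu>[of "Suc i"] S_fst[OF that(2)] that(1)
      by (intro qcom_mult qcom_x_Z) auto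
    show "qcommute (x (Suc i)) (x (Suc j))" if "i < n" "j < n" for i j
      using that by (intro qcommute_x_x) auto
    show "card (\<theta> i ` {s \<in> S. \<forall>j<i. \<theta> j s = \<theta> j s0}) \<le> Suc R" if i: "i < n" for i
    proof -
      have "\<theta> i ` {s \<in> S. \<forall>j<i. \<theta> j s = \<theta> j s0}
          \<subseteq> (\<lambda>t. \<mu> (Suc i) * q (Suc i) ^ t * \<nu> (Suc i)) ` {0..R}"
        using sum_le i by (auto simp: \<theta>_def)
      then have "card (\<theta> i ` {s \<in> S. \<forall>j<i. \<theta> j s = \<theta> j s0}) \<le> card {0..R}"
        by (meson card_image_le card_mono finite_atLeastAtMost finite_imageI le_trans)
      then show ?thesis by simp
    qed
  qed
  have "{s \<in> S. \<forall>j<n. \<theta> j s = \<theta> j s0} = {s0}"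
  proof (intro equalityI subsetI)
    fix s assume s: "s \<in> {s \<in> S. \<forall>j<n. \<theta> j s = \<theta> j s0}"
    \<comment> \<open>The range includes \<open>Suc n\<close>, where the tail sum is empty, so that
      every \<open>snd s j\<close> is a difference of two consecutive tail sums.\<close>
    have \<sigma>: "\<sigma> j s = \<sigma> j s0" if "j \<in> {1..Suc n}" for j
    proof (cases "j = Suc n")
      case False
      then have j: "j \<in> {1..n}" "Suc (j - 1) = j" "j - 1 < n" using that by auto
      then have "\<theta> (j - 1) s = \<theta> (j - 1) s0" using s by blast
      then have "q j ^ \<sigma> j s = q j ^ \<sigma> j s0" using \<mu>[of j] \<nu>[of j] j by (simp add: \<theta>_def)
      then show ?thesis using q_power_inj j(1) by blast
    qed (simp add: \<sigma>_def)
    have "snd s j = snd s0 j" for j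
    proof (cases "j \<in> {1..n}")
      case True
      then have "\<sigma> j t = snd t j + \<sigma> (Suc j) t" for t
        by (simp add: \<sigma>_def sum.atLeast_Suc_atMost)
      then show ?thesis using \<sigma>[of j] \<sigma>[of "Suc j"] True by auto
    next
      case False
      then show ?thesis using s s0
        by (auto simp: S_def s0_eq pos_box_def PiE_def extensional_def)
    qed
    then have "snd s = snd s0" by blast
    moreover have "fst s = fst s0" using S_fst[of s] s by (simp add: s0_eq)
    ultimately show "s \<in> {s0}" by (simp add: prod_eq_iff)
  qed (use s0S in auto)
  with us(3) have "kills T (c s0 *\<^sub>k (mon s0 * prod_list vs * prod_list us))" by simp
  then have kT: "kills T (mon (d0, b0) * prod_list (vs @ us))"
    using c0 by (auto simp: s0_eq mult.assoc dest: kills_scaleD)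
  have "set (vs @ us) \<subseteq> letters" using vs_letters us(1) by (auto simp: letters_def)
  then obtain e d' b' where e: "e \<noteq> 0" "mon (d0, b0) * prod_list (vs @ us) \<doteq> e *\<^sub>k mon (d', b')"
    "\<forall>i\<in>{1..n}. 0 \<le> d' i"
    "(\<Sum>i\<in>{1..n}. nat (d' i)) \<le> (\<Sum>i\<in>{1..n}. nat (d0 i)) + length (vs @ us)"
    using mon_mult_letters[of "vs @ us" d0 b0] nonneg[OF s0] s0_eq by auto
  have "(\<Sum>i\<in>{1..n}. nat (d0 i)) \<le> (\<Sum>i\<in>{1..n}. k)"
    using pos_box_fst[OF s0] by (intro sum_mono) (simp add: s0_eq nat_le_iff)
  then have "(\<Sum>i\<in>{1..n}. nat (d' i)) \<le> T"
    using e(4) vs(2) us(2) by (simp add: T_def)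
  moreover have "kills T (mon (d', b'))" using kills_eqv[OF kT e(2)] e(1) by (rule kills_scaleD)
  ultimately have "kills (\<Sum>i\<in>{1..n}. nat (d' i)) (mon (d', b'))" using kills_mono by blast
  with not_kills_mon e(3) show False by blast
qed

text \<open>An element of the two-sided ideal \<open>I\<close> kills at every level, since
  \<open>I\<close> is contained in \<open>L\<close>.\<close>

lemma mon_independent:
  assumes "(\<Sum>s\<in>pos_box k. c s *\<^sub>k mon s) \<doteq> 0" "s \<in> pos_box k"
  shows "c s = 0"
proof (rule kills_mon_combination[OF _ assms(2)])
  show "kills (6 * n\<^sup>2 * k) (\<Sum>s\<in>pos_box k. c s *\<^sub>k mon s)"
    using assms(1) I_left I_subset_L by (auto simp: kills_def eqv_def)
qed

text \<open>Modulo \<open>L\<close>, the condition that a combination of the monomials kills every element of \<open>E\<close> is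
  a system of \<open>card E * card E'\<close> homogeneous linear equations for its coefficients.\<close>

lemma pos_box_le_spanning:
  assumes "finite E" "E \<subseteq> F (6 * n\<^sup>2 * k)" "finite E'"
    and E: "\<And>f. f \<in> F (6 * n\<^sup>2 * k) \<Longrightarrow> \<exists>c. f - (\<Sum>e\<in>E. c e *\<^sub>k e) \<in> L"
    and E': "\<And>f. f \<in> F (9 * n\<^sup>2 * k) \<Longrightarrow> \<exists>c. f - (\<Sum>e\<in>E'. c e *\<^sub>k e) \<in> L"
  shows "(k + 1) ^ (2 * n) \<le> card E * card E'"
proof (rule ccontr)
  assume "\<not> ?thesis"
  then have card: "card (E \<times> E') < card (pos_box k)"
    by (simp add: card_pos_box card_cartesian_product)
  have "n * k \<le> n * n * k" by (cases n) auto
  \<comment> \<open>Room for the products: \<open>e\<close> has degree at most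
    \<open>6 * n\<^sup>2 * k\<close> and \<open>mon s\<close> at most
    \<open>3 * n * k\<close>.\<close>
  then have le: "6 * n\<^sup>2 * k + 3 * n * k \<le> 9 * n\<^sup>2 * k"
    by (simp add: power2_eq_square algebra_simps)
  have "\<exists>a. e * mon s - (\<Sum>e'\<in>E'. a e' *\<^sub>k e') \<in> L" if "e \<in> E" "s \<in> pos_box k" for e s
  proof (rule E')
    show "e * mon s \<in> F (9 * n\<^sup>2 * k)"
      using F_mult[of e _ "mon s", OF _ mon_in_F] that assms(2) F_mono[OF le] by blast
  qed
  then obtain a where a: "\<And>e s. e \<in> E \<Longrightarrow> s \<in> pos_box k \<Longrightarrow>
      e * mon s - (\<Sum>e'\<in>E'. a e s e' *\<^sub>k e') \<in> L"
    by metis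
  obtain c where c: "\<exists>s\<in>pos_box k. c s \<noteq> 0"
    "\<forall>p\<in>E \<times> E'. (\<Sum>s\<in>pos_box k. c s * a (fst p) s (snd p)) = 0"
    using homogeneous_system_nontrivial_solution
      [OF finite_cartesian_product[OF assms(1,3)] finite_pos_box card, of "\<lambda>s p. a (fst p) s (snd p)"]
    by blast
  let ?f = "\<Sum>s\<in>pos_box k. c s *\<^sub>k mon s"
  have ef: "e * ?f \<in> L" if e: "e \<in> E" for e
  proof -
    have "(\<Sum>s\<in>pos_box k. c s *\<^sub>k (e * mon s - (\<Sum>e'\<in>E'. a e s e' *\<^sub>k e'))) \<in> L"
      using a[OF e] by (intro L_sum L_scale) auto
    moreover have "(\<Sum>s\<in>pos_box k. c s *\<^sub>k (e * mon s - (\<Sum>e'\<in>E'. a e s e' *\<^sub>k e')))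
        = e * ?f - (\<Sum>s\<in>pos_box k. \<Sum>e'\<in>E'. (c s * a e s e') *\<^sub>k e')"
      by (simp add: scale_right_diff_distrib sum_subtractf sum_distrib_left scale_sum_right)
    moreover have "(\<Sum>s\<in>pos_box k. \<Sum>e'\<in>E'. (c s * a e s e') *\<^sub>k e')
        = (\<Sum>e'\<in>E'. (\<Sum>s\<in>pos_box k. c s * a e s e') *\<^sub>k e')"
      by (subst sum.swap) (simp add: scale_sum_left)
    moreover have "\<dots> = 0" using c(2) e by (intro sum.neutral) auto
    ultimately show ?thesis by simp
  qed
  have "kills (6 * n\<^sup>2 * k) ?f"
    unfolding kills_def
  proof
    \<comment> \<open>Replacing \<open>g\<close> by its reduction to \<open>E\<close> changes
      \<open>g * ?f\<close> by an element of \<open>L\<close>, because \<open>L\<close> is a right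
      ideal.\<close>
    fix g assume "g \<in> F (6 * n\<^sup>2 * k)"
    then obtain b where b: "g - (\<Sum>e\<in>E. b e *\<^sub>k e) \<in> L" using E by blast
    have "(g - (\<Sum>e\<in>E. b e *\<^sub>k e)) * ?f + (\<Sum>e\<in>E. b e *\<^sub>k (e * ?f)) \<in> L"
      using ef by (intro L_add L_right[OF b] L_sum L_scale)
    moreover have "(g - (\<Sum>e\<in>E. b e *\<^sub>k e)) * ?f + (\<Sum>e\<in>E. b e *\<^sub>k (e * ?f)) = g * ?f"
      by (simp add: left_diff_distrib sum_distrib_right)
    ultimately show "g * ?f \<in> L" by simp
  qed
  with kills_mon_combination c(1) show False by blast
qed

end

section \<open>Presented algebras and their modules\<close>

lemma poly_mapping_sum_single:
  "f = (\<Sum>a\<in>Poly_Mapping.keys f. Poly_Mapping.single a (Poly_Mapping.lookup f a))"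
proof (rule poly_mapping_eqI)
  fix k
  have "(\<Sum>a\<in>Poly_Mapping.keys f. Poly_Mapping.lookup (Poly_Mapping.single a (Poly_Mapping.lookup f a)) k)
      = (\<Sum>a\<in>Poly_Mapping.keys f. if k = a then Poly_Mapping.lookup f a else 0)"
    by (intro sum.cong) (auto simp: lookup_single when_def)
  then show "Poly_Mapping.lookup f k = Poly_Mapping.lookup
      (\<Sum>a\<in>Poly_Mapping.keys f. Poly_Mapping.single a (Poly_Mapping.lookup f a)) k"
    by (simp add: lookup_sum in_keys_iff)
qed

lemma free_algebra_induct [case_names zero single add]:
  fixes f :: "('g, 'k::field) free_algebra"
  assumes "P 0" "\<And>u c. P (Poly_Mapping.single u c)" "\<And>f g. P f \<Longrightarrow> P g \<Longrightarrow> P (f + g)"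
  shows "P f"
proof -
  have "P (\<Sum>a\<in>A. Poly_Mapping.single a (Poly_Mapping.lookup f a))" for A
    by (induction A rule: infinite_finite_induct) (auto intro: assms)
  then show ?thesis by (subst poly_mapping_sum_single)
qed

lemma free_scalar_simps [simp]:
  "free_scalar 0 = 0" "free_scalar 1 = 1"
  "free_scalar (a + b) = free_scalar a + free_scalar b"
  "free_scalar a * free_scalar b = free_scalar (a * b)"
  by (simp_all add: free_scalar_def single_add mult_single plus_list_def)
    (simp flip: zero_list_def)

lemma single_eq_scalar_mult:
  "Poly_Mapping.single u c = free_scalar c * Poly_Mapping.single u (1::'k::field)"
  by (simp add: free_scalar_def mult_single plus_list_def)

lemma free_scalar_commute: "f * free_scalar c = free_scalar c * f"
  by (induction f rule: free_algebra_induct)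
    (simp_all add: free_scalar_def mult_single plus_list_def algebra_simps)

lemma single_Nil_one: "Poly_Mapping.single [] 1 = 1"
  by (simp flip: zero_list_def)

lemma single_eq_prod_list: "Poly_Mapping.single u (1::'k::field) = prod_list (map free_gen u)"
proof (induction u)
  case (Cons g u)
  have "Poly_Mapping.single (g # u) (1::'k) = free_gen g * Poly_Mapping.single u 1"
    by (simp add: free_gen_def mult_single plus_list_def)
  then show ?case using Cons by simp
next
  case Nil
  then show ?case by (simp add: single_Nil_one)
qed

definition restrict_words :: "'g set \<Rightarrow> ('g, 'k::field) free_algebra \<Rightarrow> ('g, 'k) free_algebra" where
  "restrict_words G f = Poly_Mapping.mapp (\<lambda>u c. c when set u \<subseteq> G) f"

lemma lookup_restrict_words:
  "Poly_Mapping.lookup (restrict_words G f) u = (Poly_Mapping.lookup f u when set u \<subseteq> G)"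
  by (auto simp: restrict_words_def lookup_mapp when_def in_keys_iff)

lemma restrict_words_add: "restrict_words G (f + g) = restrict_words G f + restrict_words G g"
  by (rule poly_mapping_eqI) (simp add: lookup_restrict_words lookup_add when_def)

lemma restrict_words_single:
  "restrict_words G (Poly_Mapping.single u c) = (Poly_Mapping.single u c when set u \<subseteq> G)"
  by (rule poly_mapping_eqI) (auto simp: lookup_restrict_words lookup_single when_def)

lemma restrict_words_zero [simp]: "restrict_words G 0 = 0"
  by (rule poly_mapping_eqI) (simp add: lookup_restrict_words)

text \<open>A concatenation lies over \<open>G\<close> exactly if both words do, so dropping the
  other words is a retraction of rings.\<close>

lemma restrict_words_mult: "restrict_words G (f * g) = restrict_words G f * restrict_words G g"
proof (induction f rule: free_algebra_induct)
  case (single u c)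
  show ?case
  proof (induction g rule: free_algebra_induct)
    case (single v d)
    show ?case by (auto simp: mult_single restrict_words_single plus_list_def when_def)
  qed (simp_all add: restrict_words_add distrib_left)
qed (simp_all add: restrict_words_add distrib_right)

lemma restrict_words_in_carrier: "restrict_words G f \<in> carrier (free_algebra_on G)"
  by (auto simp: free_algebra_on_def in_keys_iff lookup_restrict_words when_def split: if_splits)

lemma restrict_words_id: "f \<in> carrier (free_algebra_on G) \<Longrightarrow> restrict_words G f = f"
  by (rule poly_mapping_eqI)
    (auto simp: free_algebra_on_def lookup_restrict_words when_def in_keys_iff)

lemma restrict_words_free_scalar [simp]: "restrict_words G (free_scalar c) = free_scalar c"
  by (simp add: free_scalar_def restrict_words_single)

lemma free_algebra_on_iff: "f \<in> carrier (free_algebra_on G) \<longleftrightarrow> restrict_words G f = f"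
  using restrict_words_id restrict_words_in_carrier by metis

lemma free_algebra_on_simps [simp]:
  "mult (free_algebra_on G) = (*)" "one (free_algebra_on G) = 1"
  "add (free_algebra_on G) = (+)" "zero (free_algebra_on G) = 0"
  by (simp_all add: free_algebra_on_def)

lemma restrict_words_uminus: "restrict_words G (- f) = - restrict_words G f"
  by (rule poly_mapping_eqI) (simp add: lookup_restrict_words when_def)

lemma restrict_words_diff: "restrict_words G (f - g) = restrict_words G f - restrict_words G g"
  by (rule poly_mapping_eqI) (simp add: lookup_restrict_words when_def lookup_minus)

lemma restrict_words_one [simp]: "restrict_words G 1 = 1"
  using restrict_words_free_scalar[of G 1] by simp

lemma restrict_words_sum: "restrict_words G (sum f A) = (\<Sum>a\<in>A. restrict_words G (f a))"
  by (induction A rule: infinite_finite_induct) (auto simp: restrict_words_add)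

lemma restrict_words_power: "restrict_words G (f ^ k) = restrict_words G f ^ k"
  by (induction k) (auto simp: restrict_words_mult)

lemma restrict_words_prod_list:
  "restrict_words G (prod_list fs) = prod_list (map (restrict_words G) fs)"
  by (induction fs) (auto simp: restrict_words_mult)

lemma restrict_words_free_gen: "g \<in> G \<Longrightarrow> restrict_words G (free_gen g) = free_gen g"
  by (simp add: free_gen_def restrict_words_single)

lemma ring_free_algebra_on: "ring (free_algebra_on G :: ('g, 'k::field) free_algebra ring)"
proof (rule ringI)
  show "abelian_group (free_algebra_on G :: ('g, 'k) free_algebra ring)"
  proof (rule abelian_groupI)
    fix f :: "('g, 'k) free_algebra" assume "f \<in> carrier (free_algebra_on G)"
    then show "\<exists>g\<in>carrier (free_algebra_on G). g \<oplus>\<^bsub>free_algebra_on G\<^esub> f = \<zero>\<^bsub>free_algebra_on G\<^esub>"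
      by (intro bexI[of _ "- f"]) (auto simp: free_algebra_on_iff restrict_words_uminus)
  qed (auto simp: free_algebra_on_iff restrict_words_add algebra_simps)
  show "Group.monoid (free_algebra_on G :: ('g, 'k) free_algebra ring)"
    by (rule monoidI) (auto simp: free_algebra_on_iff restrict_words_mult mult.assoc)
qed (auto simp: algebra_simps)

locale presentation =
  fixes G :: "'g set" and Rel :: "('g, 'k::field) free_algebra set"
  assumes Rel_subset: "Rel \<subseteq> carrier (free_algebra_on G)"
begin

abbreviation R :: "('g, 'k) free_algebra ring" where "R \<equiv> free_algebra_on G"
abbreviation J where "J \<equiv> relation_ideal G Rel"
abbreviation A where "A \<equiv> presented_algebra G Rel"

sublocale R: ring R by (rule ring_free_algebra_on)

sublocale J: ideal J R
  unfolding relation_ideal_def using Rel_subset by (rule R.genideal_ideal)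

text \<open>Discarding the words that involve letters outside \<open>G\<close> extends the quotient map to a
  homomorphism on the whole type, so that the arithmetic of the free algebra is available without
  carrier conditions.\<close>

definition cls :: "('g, 'k) free_algebra \<Rightarrow> ('g, 'k) free_algebra set" where
  "cls f = presented_class G Rel (restrict_words G f)"

lemma A_simps:
  "carrier A = carrier (R Quot J)" "mult A = mult (R Quot J)" "one A = one (R Quot J)"
  "zero A = zero (R Quot J)" "add A = add (R Quot J)"
  "c \<odot>\<^bsub>A\<^esub> a = presented_class G Rel (free_scalar c) \<otimes>\<^bsub>R Quot J\<^esub> a"
  by (simp_all add: presented_algebra_def Let_def)

lemma cls_add: "cls (f + g) = cls f \<oplus>\<^bsub>A\<^esub> cls g"
  using J.a_rcos_sum[OF restrict_words_in_carrier restrict_words_in_carrier, of f g]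
  by (simp add: A_simps FactRing_def cls_def presented_class_def restrict_words_add)

lemma cls_mult: "cls (f * g) = cls f \<otimes>\<^bsub>A\<^esub> cls g"
  using J.rcoset_mult_add[OF restrict_words_in_carrier restrict_words_in_carrier, of f g]
  by (simp add: A_simps FactRing_def cls_def presented_class_def restrict_words_mult)

lemma cls_one: "cls 1 = \<one>\<^bsub>A\<^esub>"
  by (simp add: A_simps FactRing_def cls_def presented_class_def)

lemma a_minus_R: "f \<in> carrier R \<Longrightarrow> g \<in> carrier R \<Longrightarrow> f \<ominus>\<^bsub>R\<^esub> g = f - g"
proof -
  assume fg: "f \<in> carrier R" "g \<in> carrier R"
  then have "\<ominus>\<^bsub>R\<^esub> g = - g"
    by (intro R.minus_equality) (auto simp: free_algebra_on_iff restrict_words_uminus)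
  then show ?thesis by (simp add: R.minus_eq)
qed

lemma cls_eq_iff: "cls f = cls g \<longleftrightarrow> restrict_words G (f - g) \<in> J"
  unfolding cls_def presented_class_def
  using R.quotient_eq_iff_same_a_r_cos[OF J.ideal_axioms restrict_words_in_carrier
      restrict_words_in_carrier, of f g]
  by (simp add: a_minus_R restrict_words_in_carrier restrict_words_diff)

lemma cls_zero: "cls 0 = \<zero>\<^bsub>A\<^esub>"
  using R.a_coset_join2[OF R.zero_closed J.a_subgroup additive_subgroup.zero_closed[OF J.additive_subgroup_axioms]]
  by (simp add: A_simps FactRing_def cls_def presented_class_def)

lemma cls_scalar: "cls (free_scalar c * f) = c \<odot>\<^bsub>A\<^esub> cls f"
  using cls_mult[of "free_scalar c" f] by (simp add: A_simps cls_def)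

lemma carrier_A: "carrier A = range cls"
proof
  show "carrier A \<subseteq> range cls"
  proof
    fix a assume "a \<in> carrier A"
    then obtain f where "f \<in> carrier R" "a = J +>\<^bsub>R\<^esub> f"
      by (auto simp: A_simps FactRing_def A_RCOSETS_def')
    then have "a = cls f" by (simp add: cls_def presented_class_def restrict_words_id)
    then show "a \<in> range cls" by blast
  qed
  show "range cls \<subseteq> carrier A"
    using restrict_words_in_carrier
    by (auto simp: A_simps FactRing_def A_RCOSETS_def' cls_def presented_class_def)
qed

lemma cls_relator: "f \<in> Rel \<Longrightarrow> cls f = \<zero>\<^bsub>A\<^esub>"
proof -
  assume f: "f \<in> Rel"
  then have "f \<in> J" unfolding relation_ideal_def using R.genideal_self[OF Rel_subset] by blast
  moreover have "restrict_words G f = f" using f Rel_subset restrict_words_id by blast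
  ultimately have "cls f = cls 0" by (simp add: cls_eq_iff)
  then show ?thesis by (simp add: cls_zero)
qed

lemma cls_restrict_words: "cls (restrict_words G f) = cls f"
  by (simp add: cls_def restrict_words_id restrict_words_in_carrier)

end

definition free_scale :: "'k::field \<Rightarrow> ('g, 'k) free_algebra \<Rightarrow> ('g, 'k) free_algebra" where
  "free_scale c f = free_scalar c * f"

interpretation free_algebra: vector_space free_scale
  by unfold_locales (simp_all add: free_scale_def distrib_left distrib_right flip: mult.assoc)

section \<open>The filtration by word length\<close>

definition short_words :: "nat \<Rightarrow> ('g, 'k::field) free_algebra set" where
  "short_words N = {f. \<forall>u \<in> Poly_Mapping.keys f. length u \<le> N}"

lemma single_short_words: "length u \<le> N \<Longrightarrow> Poly_Mapping.single u c \<in> short_words N"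
  by (simp add: short_words_def)

lemma short_words_mono: "M \<le> N \<Longrightarrow> short_words M \<subseteq> short_words N"
  by (auto simp: short_words_def)

lemma zero_short_words: "0 \<in> short_words N"
  by (simp add: short_words_def)

lemma free_scalar_short_words: "free_scalar c \<in> short_words N"
  by (simp add: free_scalar_def single_short_words)

lemma one_short_words: "1 \<in> short_words N"
  using free_scalar_short_words[of 1] by simp

lemma free_gen_short_words: "free_gen g \<in> short_words 1"
  by (simp add: free_gen_def single_short_words)

lemma short_words_add: "f \<in> short_words N \<Longrightarrow> g \<in> short_words N \<Longrightarrow> f + g \<in> short_words N"
  using keys_add[of f g] by (auto simp: short_words_def)

lemma short_words_mult:
  "f \<in> short_words M \<Longrightarrow> g \<in> short_words N \<Longrightarrow> f * g \<in> short_words (M + N)"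
  using keys_mult[of f g] by (fastforce simp: short_words_def plus_list_def)

lemma short_words_scale: "f \<in> short_words N \<Longrightarrow> free_scale c f \<in> short_words N"
  unfolding free_scale_def using short_words_mult[OF free_scalar_short_words[of c 0]] by fastforce

lemma ex_short_words: "\<exists>N. f \<in> short_words N"
proof -
  have "f \<in> short_words (Max (length ` Poly_Mapping.keys f))"
    by (simp add: short_words_def)
  then show ?thesis by blast
qed

definition words :: "'g set \<Rightarrow> nat \<Rightarrow> ('g, 'k::field) free_algebra set" where
  "words G N = (\<lambda>u. Poly_Mapping.single u 1) ` {u. set u \<subseteq> G \<and> length u \<le> N}"

lemma finite_words: "finite G \<Longrightarrow> finite (words G N)"
  by (simp add: words_def finite_lists_length_le)

lemma restrict_words_in_span:
  assumes "f \<in> short_words N"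
  shows "restrict_words G f \<in> free_algebra.span (words G N)"
proof -
  let ?f = "restrict_words G f"
  have "Poly_Mapping.single u (Poly_Mapping.lookup ?f u) \<in> free_algebra.span (words G N)"
    if "u \<in> Poly_Mapping.keys ?f" for u
  proof -
    have "Poly_Mapping.single u 1 \<in> words G N"
      using that assms unfolding words_def
      by (auto simp: in_keys_iff lookup_restrict_words when_def short_words_def split: if_splits)
    then have "free_scale c (Poly_Mapping.single u 1) \<in> free_algebra.span (words G N)" for c
      by (intro free_algebra.span_scale free_algebra.span_base)
    then show ?thesis by (subst single_eq_scalar_mult) (simp add: free_scale_def)
  qed
  then show ?thesis
    by (subst poly_mapping_sum_single) (intro free_algebra.span_sum)
qed

section \<open>Modules over a presented algebra and their growth\<close>

locale presented_module = presentation G Rel + right_module A M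
  for G :: "'g set" and Rel :: "('g, 'k::field) free_algebra set"
    and M :: "(('g, 'k) free_algebra set, 'm) module" +
  assumes finite_G: "finite G"
begin

lemma cls_closed: "cls f \<in> carrier A"
  using carrier_A by simp

lemma vectorspace_A: "vectorspace class_ring A"
proof -
  have "module class_ring A"
  proof (rule moduleI)
    show "cring (class_ring :: 'k ring)" by (rule class_cring.cring_axioms)
    show "abelian_group A" by (rule A.abelian_group_axioms)
  qed (auto simp: carrier_A simp flip: cls_scalar cls_add,
      simp_all add: distrib_left distrib_right flip: mult.assoc)
  then show ?thesis by (simp add: vectorspace_def class_field)
qed

sublocale A: linear_image free_scale A cls
proof -
  interpret vectorspace class_ring A by (rule vectorspace_A)
  show "linear_image free_scale A cls"
    by unfold_locales (simp_all add: cls_closed cls_add cls_scalar free_scale_def)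
qed

abbreviation S where "S \<equiv> scalar_space A M"

lemma S_simps [simp]:
  "carrier S = carrier M" "zero S = zero M" "add S = add M"
  by (simp_all add: scalar_space_def)

lemma S_scale: "c \<odot>\<^bsub>S\<^esub> m = m \<star>\<^bsub>M\<^esub> cls (free_scalar c)"
  using cls_scalar[of c 1] by (simp add: scalar_space_def cls_one)

lemma vectorspace_S: "vectorspace class_ring S"
proof -
  have "module class_ring S"
  proof (rule moduleI)
    show "cring (class_ring :: 'k ring)" by (rule class_cring.cring_axioms)
    show "abelian_group S"
    proof (rule abelian_groupI)
      fix m assume "m \<in> carrier S"
      then show "\<exists>m'\<in>carrier S. m' \<oplus>\<^bsub>S\<^esub> m = \<zero>\<^bsub>S\<^esub>"
        using M.l_neg by (intro bexI[of _ "\<ominus>\<^bsub>M\<^esub> m"]) auto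
    qed (auto simp: M.a_ac)
  qed (auto simp: S_scale cls_closed ract_closed ract_add_left cls_one ract_one cls_add ract_add_right
      simp flip: ract_mult cls_mult, simp add: mult.commute)
  then show ?thesis by (simp add: vectorspace_def class_field)
qed

lemma linear_image_S: "m \<in> carrier M \<Longrightarrow> linear_image free_scale S (\<lambda>f. m \<star>\<^bsub>M\<^esub> cls f)"
proof -
  assume m: "m \<in> carrier M"
  interpret vectorspace class_ring S by (rule vectorspace_S)
  show ?thesis
    using m by unfold_locales
      (simp_all add: cls_closed ract_closed cls_add ract_add_right S_scale free_scale_def
        flip: ract_mult cls_mult free_scalar_commute)
qed

text \<open>\<open>short_words N\<close> itself need not be finite-dimensional, as its letters range
  over the whole type. The hypothesis makes \<Phi> factor through the words over the finite set
  \<open>G\<close>, of which finitely many have length at most \<open>N\<close>.\<close>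

lemma short_image_fd:
  fixes \<Phi> :: "('g, 'k) free_algebra \<Rightarrow> 'v"
  assumes "linear_image free_scale V \<Phi>" and \<Phi>: "\<And>f. \<Phi> (restrict_words G f) = \<Phi> f"
  shows "\<Phi> ` short_words N \<in> fd_subspaces V"
proof -
  interpret linear_image free_scale V \<Phi> by fact
  have sub: "subspace class_ring (\<Phi> ` short_words N) V"
    by (intro image_subspace zero_short_words short_words_add short_words_scale)
  have "\<Phi> ` short_words N \<subseteq> \<Phi> ` free_algebra.span (words G N)"
  proof (rule image_subsetI)
    fix f :: "('g, 'k) free_algebra" assume "f \<in> short_words N"
    from imageI[OF restrict_words_in_span[OF this], of \<Phi> G]
    show "\<Phi> f \<in> \<Phi> ` free_algebra.span (words G N)" by (simp only: \<Phi>)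
  qed
  then have in_span: "\<Phi> ` short_words N \<subseteq> lin_span V (\<Phi> ` words G N)"
    using image_span[of "words G N"] by (rule subset_trans)
  have "vectorspace.fin_dim class_ring (V\<lparr>carrier := \<Phi> ` short_words N\<rparr>)"
  proof (rule V.subspace_of_span(1)[OF _ _ sub in_span])
    show "finite (\<Phi> ` words G N)" by (intro finite_imageI finite_words finite_G)
    show "\<Phi> ` words G N \<subseteq> carrier V" using \<Phi>_closed by auto
  qed
  with sub show ?thesis by (simp add: fd_subspaces_def)
qed

lemma cls_short_fd: "cls ` short_words N \<in> fd_subspaces A"
  using A.linear_image_axioms cls_restrict_words by (rule short_image_fd)

lemma ract_short_fd: "m \<in> carrier M \<Longrightarrow> (\<lambda>f. m \<star>\<^bsub>M\<^esub> cls f) ` short_words N \<in> fd_subspaces S"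
  by (intro short_image_fd linear_image_S) (auto simp: cls_restrict_words)

lemma subspace_powers_subset:
  assumes V: "V \<subseteq> cls ` short_words D"
  shows "subspace_power A V m \<subseteq> cls ` short_words (D * m)"
    "subspace_power_upto A V m \<subseteq> cls ` short_words (D * m)"
proof -
  have sub: "submodule class_ring (cls ` short_words N) A" for N
    using cls_short_fd by (simp add: fd_subspaces_def)
  show pow: "subspace_power A V m \<subseteq> cls ` short_words (D * m)" for m
  proof (induction m)
    case 0
    have "{\<one>\<^bsub>A\<^esub>} \<subseteq> cls ` short_words (D * 0)" using one_short_words by (auto simp flip: cls_one)
    then show ?case using A.V.span_is_subset[OF _ sub] by simp
  next
    case (Suc m)
    have "a \<otimes>\<^bsub>A\<^esub> v \<in> cls ` short_words (D * Suc m)"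
      if av: "a \<in> subspace_power A V m" "v \<in> V" for a v
    proof -
      obtain f g where "a = cls f" "f \<in> short_words (D * m)" "v = cls g" "g \<in> short_words D"
        using Suc V av by blast
      then show ?thesis
        using short_words_mult[of f "D * m" g D] by (auto simp: add.commute simp flip: cls_mult)
    qed
    then have "lin_span A {a \<otimes>\<^bsub>A\<^esub> v | a v. a \<in> subspace_power A V m \<and> v \<in> V}
        \<subseteq> cls ` short_words (D * Suc m)"
      by (intro A.V.span_is_subset[OF _ sub]) blast
    then show ?case by simp
  qed
  show "subspace_power_upto A V m \<subseteq> cls ` short_words (D * m)"
    unfolding subspace_power_upto_def
  proof (intro A.V.span_is_subset sub UN_least)
    fix i assume "i \<in> {..m}"
    then have "D * i \<le> D * m" by simp
    then show "subspace_power A V i \<subseteq> cls ` short_words (D * m)"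
      using pow[of i] short_words_mono by blast
  qed
qed

definition gen_space where "gen_space = cls ` short_words 1"

text \<open>\<open>gen_space\<close> is spanned by 1 and the generators, so its powers are exactly
  the steps of the word-length filtration. Lower bounds for both dimensions thus reduce to the
  growth of images of \<open>short_words\<close>.\<close>

lemma subspace_powers_gen_space: "subspace_power_upto A gen_space m = cls ` short_words m"
proof
  show "subspace_power_upto A gen_space m \<subseteq> cls ` short_words m"
    using subspace_powers_subset(2)[of gen_space 1 m] by (simp add: gen_space_def)
  have power_carrier: "subspace_power A gen_space i \<subseteq> carrier A" for i
    using subspace_powers_subset(1)[of gen_space 1 i] cls_closed by (auto simp: gen_space_def)
  have mult_carrier: "{a \<otimes>\<^bsub>A\<^esub> v | a v. a \<in> subspace_power A gen_space i \<and> v \<in> gen_space} \<subseteq> carrier A" for i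
    using power_carrier cls_closed by (auto simp: gen_space_def)
  have word: "cls (Poly_Mapping.single u 1) \<in> subspace_power A gen_space (length u)" for u
  proof (induction u rule: rev_induct)
    case Nil
    show ?case
      using A.V.in_own_span[of "{\<one>\<^bsub>A\<^esub>}"] by (simp add: cls_one single_Nil_one)
  next
    case (snoc g u)
    have "Poly_Mapping.single (u @ [g]) (1::'k) = Poly_Mapping.single u 1 * free_gen g"
      by (simp add: free_gen_def mult_single plus_list_def)
    then have "cls (Poly_Mapping.single (u @ [g]) 1)
        = cls (Poly_Mapping.single u 1) \<otimes>\<^bsub>A\<^esub> cls (free_gen g)"
      by (simp add: cls_mult)
    moreover have "cls (free_gen g) \<in> gen_space" unfolding gen_space_def by (intro imageI free_gen_short_words)
    ultimately have "cls (Poly_Mapping.single (u @ [g]) 1)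
        \<in> {a \<otimes>\<^bsub>A\<^esub> v | a v. a \<in> subspace_power A gen_space (length u) \<and> v \<in> gen_space}"
      using snoc by blast
    then have "cls (Poly_Mapping.single (u @ [g]) 1) \<in> subspace_power A gen_space (Suc (length u))"
      using A.V.in_own_span[OF mult_carrier[of "length u"]] by (simp only: subspace_power.simps) blast
    then show ?case by simp
  qed
  have U: "(\<Union>i\<le>m. subspace_power A gen_space i) \<subseteq> carrier A" using power_carrier by blast
  show "cls ` short_words m \<subseteq> subspace_power_upto A gen_space m"
  proof -
    have "cls ` words G m \<subseteq> (\<Union>i\<le>m. subspace_power A gen_space i)"
      using word by (auto simp: words_def)
    then have "lin_span A (cls ` words G m) \<subseteq> subspace_power_upto A gen_space m"
      unfolding subspace_power_upto_def by (rule A.V.span_is_monotone)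
    moreover have "cls ` short_words m \<subseteq> cls ` free_algebra.span (words G m)"
    proof (rule image_subsetI)
      fix f :: "('g, 'k) free_algebra" assume "f \<in> short_words m"
      from imageI[OF restrict_words_in_span[OF this], of cls G]
      show "cls f \<in> cls ` free_algebra.span (words G m)" by (simp only: cls_restrict_words)
    qed
    ultimately show ?thesis using A.image_span[of "words G m"] by blast
  qed
qed

lemma gen_space_fd: "gen_space \<in> fd_subspaces A"
  unfolding gen_space_def by (rule cls_short_fd)

lemma gk_dim_algebra_ge: "growth_exponent (\<lambda>m. lin_dim A (cls ` short_words m)) \<le> gk_dim_algebra A"
  unfolding gk_dim_algebra_def
  by (rule order_trans[OF _ SUP_upper[OF gen_space_fd]]) (simp add: subspace_powers_gen_space)

lemma gk_dim_module_ge: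
  assumes m: "m \<in> carrier M"
  shows "growth_exponent (\<lambda>N. lin_dim S ((\<lambda>f. m \<star>\<^bsub>M\<^esub> cls f) ` short_words N)) \<le> gk_dim_module A M"
proof -
  let ?\<Phi> = "\<lambda>f. m \<star>\<^bsub>M\<^esub> cls f"
  \<comment> \<open>\<open>short_words 0\<close> consists of the scalars, so this is the line
    spanned by \<open>m\<close>.\<close>
  let ?F = "?\<Phi> ` short_words 0"
  interpret L: linear_image free_scale S ?\<Phi> by (rule linear_image_S[OF m])
  have "lin_span S {f \<star>\<^bsub>M\<^esub> a | f a. f \<in> ?F \<and> a \<in> subspace_power_upto A gen_space N}
      = ?\<Phi> ` short_words N" (is "lin_span S ?X = ?Y") for N
  proof
    have "f \<star>\<^bsub>M\<^esub> a \<in> ?Y" if fa: "f \<in> ?F" "a \<in> subspace_power_upto A gen_space N" for f a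
    proof -
      obtain g h where "f = ?\<Phi> g" "g \<in> short_words 0" "a = cls h" "h \<in> short_words N"
        using fa unfolding subspace_powers_gen_space by blast
      then show ?thesis
        using short_words_mult[of g 0 h N] m by (auto simp: cls_closed simp flip: ract_mult cls_mult)
    qed
    then have XY: "?X \<subseteq> ?Y" by blast
    moreover have "submodule class_ring ?Y S"
      using ract_short_fd[OF m] by (simp add: fd_subspaces_def)
    ultimately show "lin_span S ?X \<subseteq> ?Y" by (rule L.V.span_is_subset)
    have "?\<Phi> f \<in> ?X" if "f \<in> short_words N" for f
    proof -
      have "m = ?\<Phi> 1" using m by (simp add: cls_one ract_one)
      then have "m \<in> ?F" using one_short_words by blast
      with that show ?thesis unfolding subspace_powers_gen_space by blast
    qed
    moreover have "?Y \<subseteq> carrier S" using m by (auto simp: cls_closed ract_closed)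
    then have "?X \<subseteq> carrier S" using XY by order
    ultimately show "?Y \<subseteq> lin_span S ?X" using L.V.in_own_span by blast
  qed
  then have "growth_exponent (\<lambda>N. lin_dim S (?\<Phi> ` short_words N)) =
      growth_exponent (\<lambda>N. lin_dim S (lin_span S
        {f \<star>\<^bsub>M\<^esub> a | f a. f \<in> ?F \<and> a \<in> subspace_power_upto A gen_space N}))"
    by simp
  also have "\<dots> \<le> gk_dim_module A M"
    unfolding gk_dim_module_def
    by (rule SUP_upper2[OF gen_space_fd]) (rule SUP_upper, rule ract_short_fd[OF m])
  finally show ?thesis .
qed

lemma finite_subset_short_image:
  "finite B \<Longrightarrow> B \<subseteq> carrier A \<Longrightarrow> \<exists>D. B \<subseteq> cls ` short_words D"
proof (induction B rule: finite_induct)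
  case (insert b B)
  then obtain D where D: "B \<subseteq> cls ` short_words D" by auto
  obtain f where f: "b = cls f" using insert.prems carrier_A by auto
  obtain N where N: "f \<in> short_words N" using ex_short_words by blast
  have "insert b B \<subseteq> cls ` short_words (max D N)"
    using D f N short_words_mono[of D "max D N"] short_words_mono[of N "max D N"] by auto
  then show ?case by blast
qed simp

text \<open>A finite generating set involves only words of bounded length. With
  \<open>D \<ge> 1\<close> the additive constant in \<open>2 * (D * m) + 1\<close> can later be
  absorbed into \<open>3 * D * m\<close>.\<close>

lemma fd_subspace_short:
  assumes "V \<in> fd_subspaces A"
  obtains D where "D \<ge> 1" "V \<subseteq> cls ` short_words D"
proof -
  have V: "subspace class_ring V A" "vectorspace.fin_dim class_ring (A\<lparr>carrier := V\<rparr>)"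
    using assms by (auto simp: fd_subspaces_def)
  interpret U: vectorspace class_ring "A\<lparr>carrier := V\<rparr>" by (rule A.V.subspace_is_vs[OF V(1)])
  have VA: "V \<subseteq> carrier A" using A.V.is_module[OF V(1)] by (simp add: submodule_def)
  obtain B where B: "finite B" "B \<subseteq> V" "U.gen_set B" using V(2) by (auto simp: U.fin_dim_def)
  have "lin_span A B = V"
    using B(3) A.V.span_li_not_depend(1)[OF B(2) A.V.is_module[OF V(1)]] by simp
  moreover obtain D where "B \<subseteq> cls ` short_words D"
    using finite_subset_short_image[OF B(1)] B(2) VA by blast
  then have "B \<subseteq> cls ` short_words (Suc D)" using short_words_mono[of D "Suc D"] by fastforce
  then have "lin_span A B \<subseteq> cls ` short_words (Suc D)"
    using cls_short_fd by (intro A.V.span_is_subset) (auto simp: fd_subspaces_def)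
  ultimately show ?thesis using that[of "Suc D"] by simp
qed

text \<open>Every finite-dimensional \<open>V\<close> lies in some step \<open>D\<close> of the
  filtration, so its growth is at most that of the generators rescaled by \<open>D\<close>, and
  rescaling does not change the exponent.\<close>

lemma gk_dim_algebra_le:
  assumes T: "\<And>N. \<exists>T. finite T \<and> card T \<le> (2 * N + 1) ^ p \<and> T \<subseteq> carrier A
      \<and> cls ` short_words N \<subseteq> lin_span A T"
  shows "gk_dim_algebra A \<le> ereal (real p)"
  unfolding gk_dim_algebra_def
proof (rule SUP_least)
  fix V assume "V \<in> fd_subspaces A"
  then obtain D where D: "D \<ge> 1" "V \<subseteq> cls ` short_words D" by (rule fd_subspace_short)
  show "growth_exponent (\<lambda>m. lin_dim A (subspace_power_upto A V m)) \<le> ereal (real p)"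
  proof (rule growth_exponent_le)
    show "0 < 3 * real D" using D(1) by simp
    fix m :: nat assume m: "1 \<le> m"
    let ?W = "subspace_power_upto A V m"
    obtain T where T: "finite T" "card T \<le> (2 * (D * m) + 1) ^ p" "T \<subseteq> carrier A"
      "cls ` short_words (D * m) \<subseteq> lin_span A T"
      using T by blast
    have "subspace_power A V i \<subseteq> carrier A" for i
      using subspace_powers_subset(1)[OF D(2), of i] cls_closed by auto
    then have "subspace class_ring ?W A"
      unfolding subspace_power_upto_def by (intro A.V.span_is_subspace) auto
    then have "lin_dim A ?W \<le> card T"
      using subspace_powers_subset(2)[OF D(2), of m] T
      by (intro A.V.subspace_of_span(2)) auto
    also have "\<dots> \<le> (2 * (D * m) + 1) ^ p" by (rule T)
    also have "\<dots> \<le> (3 * D * m) ^ p" using D(1) m by (intro power_mono) auto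
    finally have "real (lin_dim A ?W) \<le> real ((3 * D * m) ^ p)" by (rule of_nat_mono)
    then show "real (lin_dim A ?W) \<le> (3 * real D * real m) ^ p" by simp
  qed
qed

end

section \<open>Graded quantum Weyl algebras\<close>

lemma weyl_gens_iff [simp]:
  "X_gen i \<in> weyl_gens n \<longleftrightarrow> i \<in> {1..n}" "Y_gen i \<in> weyl_gens n \<longleftrightarrow> i \<in> {1..n}"
  by (auto simp: weyl_gens_def)

lemma restrict_words_z_elem:
  "i \<le> n \<Longrightarrow> restrict_words (weyl_gens n) (z_elem p q i) = z_elem p q i"
  unfolding z_elem_def restrict_words_sum
  by (intro sum.cong) (auto simp: restrict_words_mult restrict_words_free_gen)

lemma K_relators_subset: "K_relators n p q \<gamma> \<subseteq> carrier (free_algebra_on (weyl_gens n))"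
proof -
  have "restrict_words (weyl_gens n) (\<Sum>l\<in>{1..<i}. free_scalar (q l - p l) * yg l * xg l)
      = (\<Sum>l\<in>{1..<i}. free_scalar (q l - p l) * yg l * xg l)" if "i \<le> n" for i
    unfolding restrict_words_sum using that
    by (intro sum.cong) (auto simp: restrict_words_mult restrict_words_free_gen)
  then show ?thesis
    unfolding K_relators_def
    by (auto simp: free_algebra_on_iff restrict_words_diff restrict_words_mult
        restrict_words_free_gen)
qed

text \<open>The element \<open>m\<close> also gives the algebra its lower bound: independence of the
  monomials is tested on \<open>m\<close>, so the dimension of the algebra is computed in the same
  locale.\<close>

locale nontorsion_graded_weyl_module =
  presented_module "weyl_gens n" "K_relators n (\<lambda>_. 1) q \<gamma>" M
  for n :: nat and q :: "nat \<Rightarrow> 'k::field" and \<gamma> :: "nat \<Rightarrow> nat \<Rightarrow> 'k"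
    and M :: "((weyl_gen, 'k) free_algebra set, 'm) module" +
  fixes m :: 'm
  assumes mult_antisym: "mult_antisymmetric n \<gamma>"
    and q_nonzero: "i \<in> {1..n} \<Longrightarrow> q i \<noteq> 0"
    and q_not_root: "i \<in> {1..n} \<Longrightarrow> \<not> root_of_unity (q i)"
    and m_closed: "m \<in> carrier M"
    and m_not_torsion: "s \<in> graded_quantum_weyl_Zset n q \<gamma> \<Longrightarrow> m \<star>\<^bsub>M\<^esub> s \<noteq> \<zero>\<^bsub>M\<^esub>"
begin

definition I where "I = {f. cls f = \<zero>\<^bsub>A\<^esub>}"
definition L where "L = {f. m \<star>\<^bsub>M\<^esub> cls f = \<zero>\<^bsub>M\<^esub>}"

sublocale algebra_ideal free_scale I
proof unfold_locales
  fix f g :: "(weyl_gen, 'k) free_algebra" and c :: 'k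
  show "f * free_scale c g = free_scale c (f * g)"
    unfolding free_scale_def by (metis free_scalar_commute mult.assoc)
qed (auto simp: I_def cls_zero cls_add cls_mult cls_closed free_scale_def mult.assoc)

lemma eqv_iff_cls_eq: "eqv f g \<longleftrightarrow> cls f = cls g"
  unfolding eqv_def unfolding I_def mem_Collect_eq by (rule A.\<Phi>_diff_eq_zero)

lemma relator_eqv: "f - g \<in> K_relators n (\<lambda>_. 1) q \<gamma> \<Longrightarrow> eqv f g"
  unfolding eqv_def unfolding I_def mem_Collect_eq by (rule cls_relator)

sublocale quantum_weyl_mod free_scale I n q \<gamma> "\<lambda>i. xg i" "\<lambda>i. yg i"
proof unfold_locales
  fix i k assume "i \<in> {1..n}" "(0::nat) < k"
  then show "q i ^ k \<noteq> 1" using q_not_root[of i] unfolding root_of_unity_def by blast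
next
  fix i j assume "i \<in> {1..n}" "j \<in> {1..n}"
  then show "\<gamma> i j * \<gamma> j i = 1" using mult_antisym by (simp add: mult_antisymmetric_def)
next
  fix i j assume "1 \<le> i" "i < j" "j \<le> n"
  then show "qcom (q i * \<gamma> i j) (xg i) (xg j)" "qcom (\<gamma> i j) (yg i) (yg j)"
    "qcom (inverse (\<gamma> i j)) (xg i) (yg j)"
    unfolding qcom_def free_scale_def K_relators_def
    by (intro relator_eqv; fastforce simp: K_relators_def mult.assoc)+
next
  fix i j assume "1 \<le> j" "j < i" "i \<le> n"
  then show "qcom (q j * inverse (\<gamma> i j)) (xg i) (yg j)"
    unfolding qcom_def free_scale_def
    by (intro relator_eqv) (fastforce simp: K_relators_def mult.assoc)
next
  fix i assume "1 \<le> i" "i \<le> n"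
  then show "eqv (xg i * yg i) (free_scale (q i) (yg i * xg i)
      + (\<Sum>l\<in>{1..<i}. free_scale (q l - 1) (yg l * xg l)))"
    unfolding free_scale_def
    by (intro relator_eqv) (fastforce simp: K_relators_def mult.assoc diff_diff_eq)
qed (rule q_nonzero)

lemma Z_eq: "Z e = prod_list (map (\<lambda>i. z_elem (\<lambda>_. 1) q i ^ e i) [1..<Suc n])"
  by (simp add: Z_def z_def z_elem_def free_scale_def mult.assoc)

sublocale quantum_weyl_annihilator free_scale I n q \<gamma> "\<lambda>i. xg i" "\<lambda>i. yg i" L short_words
proof unfold_locales
  interpret \<Phi>: linear_image free_scale S "\<lambda>f. m \<star>\<^bsub>M\<^esub> cls f" by (rule linear_image_S[OF m_closed])
  have zero_act: "\<zero>\<^bsub>M\<^esub> \<star>\<^bsub>M\<^esub> cls g = \<zero>\<^bsub>M\<^esub>" for g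
  proof -
    interpret \<Psi>: linear_image free_scale S "\<lambda>f. \<zero>\<^bsub>M\<^esub> \<star>\<^bsub>M\<^esub> cls f" by (rule linear_image_S) simp
    have "\<zero>\<^bsub>M\<^esub> \<star>\<^bsub>M\<^esub> cls g = (\<zero>\<^bsub>M\<^esub> \<oplus>\<^bsub>M\<^esub> \<zero>\<^bsub>M\<^esub>) \<star>\<^bsub>M\<^esub> cls g" by simp
    also have "\<dots> = \<zero>\<^bsub>M\<^esub> \<star>\<^bsub>M\<^esub> cls g \<oplus>\<^bsub>M\<^esub> \<zero>\<^bsub>M\<^esub> \<star>\<^bsub>M\<^esub> cls g"
      by (intro ract_add_left cls_closed) auto
    finally show ?thesis using \<Psi>.\<Phi>_closed[of g] by (simp add: M.add.l_cancel_one)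
  qed
  fix f g :: "(weyl_gen, 'k) free_algebra" and e :: "nat \<Rightarrow> nat"
  show "I \<subseteq> L" using \<Phi>.\<Phi>_zero by (auto simp: I_def L_def cls_zero)
  show "f + g \<in> L" if "f \<in> L" "g \<in> L" using that \<Phi>.\<Phi>_add[of f g] by (simp add: L_def)
  show "f * g \<in> L" if "f \<in> L"
    using that zero_act[of g] ract_mult[OF m_closed cls_closed cls_closed, of f g]
    by (simp add: L_def cls_mult)
  \<comment> \<open>\<open>K_Zset\<close> takes classes without discarding words, whereas
    \<open>cls\<close> discards; the two agree on \<open>Z e\<close> because it involves only the
    generators.\<close>
  have "restrict_words (weyl_gens n) (Z e) = Z e"
    unfolding Z_eq restrict_words_prod_list map_map o_def
    by (intro arg_cong[of _ _ prod_list] map_cong)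
      (auto simp: restrict_words_power restrict_words_z_elem)
  then have "cls (Z e) \<in> graded_quantum_weyl_Zset n q \<gamma>"
    unfolding graded_quantum_weyl_Zset_def K_Zset_def cls_def Z_eq by auto
  then show "Z e \<notin> L" using m_not_torsion by (simp add: L_def)
qed (auto intro: one_short_words short_words_mult short_words_add short_words_scale
    dest: short_words_mono simp: free_gen_short_words[unfolded One_nat_def])

text \<open>More than \<open>lin_dim\<close> monomials of degree at most \<open>N\<close> would
  satisfy a linear relation in the algebra, against \<open>mon_independent\<close>.\<close>

lemma lin_dim_A_ge:
  assumes "3 * n * k \<le> N"
  shows "(k + 1) ^ (2 * n) \<le> lin_dim A (cls ` short_words N)"
proof (rule ccontr)
  assume less: "\<not> ?thesis"
  have "subspace class_ring (cls ` short_words N) A"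
    "vectorspace.fin_dim class_ring (A\<lparr>carrier := cls ` short_words N\<rparr>)"
    using cls_short_fd[of N] by (auto simp: fd_subspaces_def)
  then obtain E where E: "finite E" "card E \<le> lin_dim A (cls ` short_words N)"
    "\<And>f. f \<in> short_words N \<Longrightarrow> \<exists>c. f - (\<Sum>e\<in>E. free_scale (c e) e) \<in> I"
    unfolding I_def mem_Collect_eq by (rule A.obtain_spanning_set) blast
  have card: "card E < card (pos_box k)"
    using less E(2) by (simp add: card_pos_box)
  have "\<forall>s\<in>pos_box k. \<exists>a. mon s - (\<Sum>e\<in>E. free_scale (a e) e) \<in> I"
    by (intro ballI E(3)) (rule subsetD[OF short_words_mono[OF assms] mon_in_F])
  from bchoice[OF this] obtain a
    where a: "\<forall>s\<in>pos_box k. mon s - (\<Sum>e\<in>E. free_scale (a s e) e) \<in> I" ..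
  obtain c where c: "\<exists>s\<in>pos_box k. c s \<noteq> 0" "\<forall>e\<in>E. (\<Sum>s\<in>pos_box k. c s * a s e) = 0"
    using homogeneous_system_nontrivial_solution[OF E(1) finite_pos_box card, of a] by blast
  have "eqv (\<Sum>s\<in>pos_box k. free_scale (c s) (mon s))
      (\<Sum>s\<in>pos_box k. free_scale (c s) (\<Sum>e\<in>E. free_scale (a s e) e))"
    using a by (intro eqv_sum eqv_scale) (simp add: eqv_def)
  also have "(\<Sum>s\<in>pos_box k. free_scale (c s) (\<Sum>e\<in>E. free_scale (a s e) e))
      = (\<Sum>s\<in>pos_box k. \<Sum>e\<in>E. free_scale (c s * a s e) e)"
    by (simp add: free_algebra.scale_sum_right)
  also have "\<dots> = (\<Sum>e\<in>E. \<Sum>s\<in>pos_box k. free_scale (c s * a s e) e)" by (rule sum.swap)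
  also have "\<dots> = (\<Sum>e\<in>E. free_scale (\<Sum>s\<in>pos_box k. c s * a s e) e)"
    by (simp add: free_algebra.scale_sum_left)
  also have "\<dots> = 0" using c(2) by (intro sum.neutral) simp
  finally show False using mon_independent c(1) by blast
qed

text \<open>One bound \<open>?d N\<close> serves both spanning sets, as
  \<open>6 * n\<^sup>2 * k \<le> 9 * n\<^sup>2 * k \<le> N\<close>. Its square is at least
  \<open>(k + 1) ^ (2 * n)\<close>, and the square root halves the exponent: this is the origin of
  the factor 1/2 between the two dimensions.\<close>

lemma lin_dim_S_ge:
  assumes "9 * n\<^sup>2 * k \<le> N"
  shows "(k + 1) ^ n \<le> lin_dim S ((\<lambda>f. m \<star>\<^bsub>M\<^esub> cls f) ` short_words N)" (is "_ \<le> ?d N")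
proof -
  let ?\<Phi> = "\<lambda>f. m \<star>\<^bsub>M\<^esub> cls f"
  interpret \<Phi>: linear_image free_scale S ?\<Phi> by (rule linear_image_S[OF m_closed])
  have sub: "subspace class_ring (?\<Phi> ` short_words K) S"
    "vectorspace.fin_dim class_ring (S\<lparr>carrier := ?\<Phi> ` short_words K\<rparr>)" for K
    using ract_short_fd[OF m_closed, of K] by (auto simp: fd_subspaces_def)
  have ex: "\<exists>E. finite E \<and> E \<subseteq> short_words K \<and> card E \<le> ?d K
      \<and> (\<forall>f\<in>short_words K. \<exists>c. f - (\<Sum>e\<in>E. free_scale (c e) e) \<in> L)" for K
    by (rule \<Phi>.obtain_spanning_set[OF sub, of K]) (auto simp: L_def)
  have mono: "?d K \<le> ?d N" if "K \<le> N" for K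
    by (rule \<Phi>.V.subspace_dim_mono[OF sub(1) sub(1) image_mono[OF short_words_mono[OF that]] sub(2)])
  let ?K = "6 * n\<^sup>2 * k" and ?K' = "9 * n\<^sup>2 * k"
  obtain E where E: "finite E" "E \<subseteq> short_words ?K" "card E \<le> ?d ?K"
    "\<forall>f\<in>short_words ?K. \<exists>c. f - (\<Sum>e\<in>E. free_scale (c e) e) \<in> L"
    using ex[of ?K] by (elim exE conjE) (rule that)
  obtain E' where E': "finite E'" "E' \<subseteq> short_words ?K'" "card E' \<le> ?d ?K'"
    "\<forall>f\<in>short_words ?K'. \<exists>c. f - (\<Sum>e\<in>E'. free_scale (c e) e) \<in> L"
    using ex[of ?K'] by (elim exE conjE) (rule that)
  have "?K \<le> N" using assms by simp
  then have "card E \<le> ?d N" using E(3) mono le_trans by blast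
  moreover have "card E' \<le> ?d N" using E'(3) mono[OF assms] by (rule le_trans)
  ultimately have "card E * card E' \<le> (?d N)\<^sup>2"
    unfolding power2_eq_square by (rule mult_le_mono)
  moreover have "(k + 1) ^ (2 * n) \<le> card E * card E'"
    by (rule pos_box_le_spanning[OF E(1,2) E'(1)])
      (erule bspec[OF E(4)], erule bspec[OF E'(4)])
  moreover have "(k + 1) ^ (2 * n) = ((k + 1) ^ n)\<^sup>2" by (simp add: power_mult mult.commute)
  ultimately have "((k + 1) ^ n)\<^sup>2 \<le> (?d N)\<^sup>2" by linarith
  then show ?thesis by (rule power2_le_imp_le) simp
qed

text \<open>A word is rewritten letter by letter, each letter enlarging the box by one, so length
  \<open>N\<close> fits into \<open>box N\<close>.\<close>

lemma cls_short_words_subset_span: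
  "cls ` short_words N \<subseteq> lin_span A (cls ` mon ` box N)"
proof -
  have word: "\<exists>g\<in>free_algebra.span (mon ` box N). cls h = cls g"
    if h: "h \<in> words (weyl_gens n) N" for h
  proof -
    obtain u where u: "set u \<subseteq> weyl_gens n" "length u \<le> N" "h = prod_list (map free_gen u)"
      using h by (auto simp: words_def single_eq_prod_list)
    have "set (map free_gen u) \<subseteq> (\<lambda>i. xg i) ` {1..n} \<union> (\<lambda>i. yg i) ` {1..n}"
      using u(1) by (auto simp: weyl_gens_def)
    from prod_list_generators_in_spanned[OF this]
    have "h \<in> spanned N" using u(2,3) spanned_mono[of "length u" N] by auto
    then obtain g where "g \<in> free_algebra.span (mon ` box N)" "eqv h g" by (auto simp: spanned_def)
    then show ?thesis unfolding eqv_iff_cls_eq by (rule bexI[rotated])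
  qed
  have sub: "submodule class_ring (lin_span A (cls ` mon ` box N)) A"
    by (intro A.V.span_is_submodule) (auto simp: cls_closed)
  have "cls ` words (weyl_gens n) N \<subseteq> lin_span A (cls ` mon ` box N)"
    using word A.image_span[of "mon ` box N"] by fastforce
  then have "lin_span A (cls ` words (weyl_gens n) N) \<subseteq> lin_span A (cls ` mon ` box N)"
    using sub by (rule A.V.span_is_subset)
  moreover have "cls f \<in> lin_span A (cls ` words (weyl_gens n) N)" if "f \<in> short_words N" for f
    using A.image_span[of "words (weyl_gens n) N"] restrict_words_in_span[OF that, of "weyl_gens n"]
      cls_restrict_words[of f] by (metis image_subset_iff)
  ultimately show ?thesis by blast
qed

lemma gk_dim_module: "ereal (real n) \<le> gk_dim_module A M"
  using growth_lower_bound[of "9 * n\<^sup>2", OF lin_dim_S_ge] gk_dim_module_ge[OF m_closed]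
  by (rule order_trans)

lemma gk_dim_algebra: "gk_dim_algebra A = ereal (real (2 * n))"
proof (rule antisym)
  show "ereal (real (2 * n)) \<le> gk_dim_algebra A"
    using growth_lower_bound[of "3 * n", OF lin_dim_A_ge] gk_dim_algebra_ge by (rule order_trans)
  show "gk_dim_algebra A \<le> ereal (real (2 * n))"
  proof (rule gk_dim_algebra_le, intro exI conjI)
    fix N
    show "finite (cls ` mon ` box N)" by (intro finite_imageI finite_box)
    show "card (cls ` mon ` box N) \<le> (2 * N + 1) ^ (2 * n)"
      using card_image_le[OF finite_box, of mon N] card_box[of N]
        card_image_le[OF finite_imageI[OF finite_box], of cls mon N] by linarith
    show "cls ` mon ` box N \<subseteq> carrier A" by (auto simp: cls_closed)
    show "cls ` short_words N \<subseteq> lin_span A (cls ` mon ` box N)"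
      by (rule cls_short_words_subset_span)
  qed
qed

end

theorem corollary1p1:
  fixes n :: nat
    and q :: "nat \<Rightarrow> 'k::field"
    and \<gamma> :: "nat \<Rightarrow> nat \<Rightarrow> 'k"
    and M :: "((weyl_gen, 'k) free_algebra set, 'm) module"
  assumes "n \<ge> 1"
    and "mult_antisymmetric n \<gamma>"
    and "\<And>i. i \<in> {1..n} \<Longrightarrow> q i \<noteq> 0"
    and "\<And>i. i \<in> {1..n} \<Longrightarrow> \<not> root_of_unity (q i)"
    and "right_module (graded_quantum_weyl_algebra n q \<gamma>) M"
    and "fin_gen_right_module (graded_quantum_weyl_algebra n q \<gamma>) M"
    and "carrier M \<noteq> {\<zero>\<^bsub>M\<^esub>}"
    and "\<not> torsion_right_module (graded_quantum_weyl_Zset n q \<gamma>) M"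
  shows "gk_dim_module (graded_quantum_weyl_algebra n q \<gamma>) M \<ge> ereal (real n) \<and>
         ereal (real n) = gk_dim_algebra (graded_quantum_weyl_algebra n q \<gamma>) / 2"
proof -
  have A: "graded_quantum_weyl_algebra n q \<gamma>
      = presented_algebra (weyl_gens n) (K_relators n (\<lambda>_. 1) q \<gamma>)"
    by (simp add: graded_quantum_weyl_algebra_def K_algebra_def)
  \<comment> \<open>Failure of torsion gives a single element that no product of powers of the
    \<open>z i\<close> annihilates.\<close>
  obtain m where m: "m \<in> carrier M"
    "\<And>s. s \<in> graded_quantum_weyl_Zset n q \<gamma> \<Longrightarrow> m \<star>\<^bsub>M\<^esub> s \<noteq> \<zero>\<^bsub>M\<^esub>"
    using assms(8) unfolding torsion_right_module_def by blast
  interpret right_module "presented_algebra (weyl_gens n) (K_relators n (\<lambda>_. 1) q \<gamma>)" M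
    using assms(5) unfolding A .
  interpret presentation "weyl_gens n" "K_relators n (\<lambda>_. 1) q \<gamma>"
    by unfold_locales (rule K_relators_subset)
  interpret nontorsion_graded_weyl_module n q \<gamma> M m
  proof unfold_locales
    show "finite (weyl_gens n)" by (simp add: weyl_gens_def)
  qed (fact assms(2-4) m)+
  show ?thesis
    unfolding A using gk_dim_module gk_dim_algebra by simp
qed

end
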